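(* Let $M$ be a compact Riemannian manifold of dimension $N$, with a smooth boundary or without boundary, and let $p,q\in C(\overline M)\cap L^\infty(M)$ be variable exponents with values in $(1,\infty)$. Assume that $$q(x)<N,\qquad p(x)<\frac{N\,q(x)}{N-q(x)}\qquad\text{for all }x\in\overline M .$$ Then $W^{1,q(x)}(M)\hookrightarrow L^{p(x)}(M)$, and this embedding is continuous and compact.
   Context: $\overline M$ denotes $M$ together with its boundary, $dv_g$ the Riemannian volume measure, $\nabla$ the (weak) Riemannian gradient. For a variable exponent $r$, $L^{r(x)}(M)$ is the space of measurable $u:M\to\mathbb R$ with $\int_M|u|^{r(x)}dv_g<\infty$, with the Luxemburg norm $\|u\|_{L^{r(x)}(M)}=\inf\{\gamma>0:\int_M|u/\gamma|^{r(x)}dv_g\le1\}$. $W^{1,q(x)}(M)=\{u\in L^{q(x)}(M):|\nabla u|\in L^{q(x)}(M)\}$ with norm $\|u\|_{L^{q(x)}(M)}+\|\,|\nabla u|\,\|_{L^{q(x)}(M)}$. *)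

theory Defs
  imports "HOL-Analysis.Analysis"
begin

section \<open>Smooth maps on subsets of Euclidean space\<close>

text \<open>\<open>Ck_on k f S\<close> is meant for open \<open>S\<close>: all partial derivatives of order up to \<open>k\<close> exist
  and are continuous on \<open>S\<close>.\<close>

fun Ck_on :: "nat \<Rightarrow> (real^'n::finite \<Rightarrow> 'b::real_normed_vector) \<Rightarrow> (real^'n) set \<Rightarrow> bool" where
  "Ck_on 0 f S \<longleftrightarrow> continuous_on S f"
| "Ck_on (Suc k) f S \<longleftrightarrow>
     f differentiable_on S \<and> (\<forall>i. Ck_on k (\<lambda>x. frechet_derivative f (at x) (axis i 1)) S)"

text \<open>On a set that need not be open, smoothness means having a smooth extension to an open
  neighbourhood of each point. This is the convention for relatively open subsets of a half-space.\<close>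

definition smooth_on :: "(real^'n::finite) set \<Rightarrow> (real^'n \<Rightarrow> 'b::real_normed_vector) \<Rightarrow> bool" where
  "smooth_on S f \<longleftrightarrow>
     (\<forall>x\<in>S. \<exists>T F. open T \<and> x \<in> T \<and> (\<forall>k. Ck_on k F T) \<and> (\<forall>y\<in>S \<inter> T. F y = f y))"


section \<open>Riemannian manifolds with (possibly empty) boundary\<close>

text \<open>A chart is a pair of its domain and its coordinate map. The index type \<open>'n\<close> has as many
  elements as the manifold has dimensions. It carries the sort that the library's change of
  variables formula requires.\<close>

type_synonym ('a, 'n) chart = "'a set \<times> ('a \<Rightarrow> (real, 'n) vec)"

text \<open>\<open>metric M c x\<close> is the Gram matrix, at the point \<open>x\<close> of the domain of \<open>c\<close>, of the metric with
  respect to the coordinate basis of the chart \<open>c\<close>.\<close>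

record ('a, 'n::"{finite,wellorder}") riemannian_space =
  mtop :: "'a topology"
  atlas :: "('a, 'n) chart set"
  metric :: "('a, 'n) chart \<Rightarrow> 'a \<Rightarrow> ((real, 'n) vec, 'n) vec"

definition chart_image :: "('a, 'n::finite) chart \<Rightarrow> (real^'n) set" where
  "chart_image c = snd c ` fst c"

definition chart_inv :: "('a, 'n::finite) chart \<Rightarrow> real^'n \<Rightarrow> 'a" where
  "chart_inv c = inv_into (fst c) (snd c)"

definition half_space :: "(real^'n::{finite,wellorder}) set" where
  "half_space = {x. 0 \<le> x $ (LEAST i. True)}"

definition transition :: "('a, 'n::finite) chart \<Rightarrow> ('a, 'n) chart \<Rightarrow> real^'n \<Rightarrow> real^'n" where
  "transition c d = snd d \<circ> chart_inv c"

text \<open>The derivative is taken within the overlap, so that it is the (unique) one-sided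
  derivative at boundary points.\<close>

definition transition_jacobian ::
    "('a, 'n::finite) chart \<Rightarrow> ('a, 'n) chart \<Rightarrow> 'a \<Rightarrow> real^'n^'n" where
  "transition_jacobian c d x =
     jacobian (transition c d) (at (snd c x) within snd c ` (fst c \<inter> fst d))"

definition smooth_manifold :: "('a, 'n::{finite,wellorder}) riemannian_space \<Rightarrow> bool" where
  "smooth_manifold M \<longleftrightarrow>
     Hausdorff_space (mtop M) \<and> second_countable (mtop M) \<and>
     (\<Union>c\<in>atlas M. fst c) = topspace (mtop M) \<and>
     (\<forall>c\<in>atlas M.
        openin (mtop M) (fst c) \<and>
        (open (chart_image c) \<or> openin (top_of_set half_space) (chart_image c)) \<and>
        homeomorphic_map (subtopology (mtop M) (fst c)) (top_of_set (chart_image c)) (snd c)) \<and>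
     (\<forall>c\<in>atlas M. \<forall>d\<in>atlas M. smooth_on (snd c ` (fst c \<inter> fst d)) (transition c d))"

definition riemannian_manifold :: "('a, 'n::{finite,wellorder}) riemannian_space \<Rightarrow> bool" where
  "riemannian_manifold M \<longleftrightarrow>
     smooth_manifold M \<and>
     (\<forall>c\<in>atlas M.
        smooth_on (chart_image c) (metric M c \<circ> chart_inv c) \<and>
        (\<forall>x\<in>fst c. transpose (metric M c x) = metric M c x \<and>
                   (\<forall>v. v \<noteq> 0 \<longrightarrow> 0 < v \<bullet> (metric M c x *v v)))) \<and>
     (\<forall>c\<in>atlas M. \<forall>d\<in>atlas M. \<forall>x\<in>fst c \<inter> fst d.
        metric M c x =
          transpose (transition_jacobian c d x) ** metric M d x ** transition_jacobian c d x)"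


section \<open>The Riemannian volume measure\<close>

definition borel_of_manifold :: "('a, 'n::{finite,wellorder}) riemannian_space \<Rightarrow> 'a measure" where
  "borel_of_manifold M = sigma (topspace (mtop M)) {U. openin (mtop M) U}"

definition volume_density ::
    "('a, 'n::{finite,wellorder}) riemannian_space \<Rightarrow> ('a, 'n) chart \<Rightarrow> real^'n::_ \<Rightarrow> real" where
  "volume_density M c y = sqrt (det (metric M c (chart_inv c y)))"

definition is_riemannian_volume ::
    "('a, 'n::{finite,wellorder}) riemannian_space \<Rightarrow> 'a measure \<Rightarrow> bool" where
  "is_riemannian_volume M \<mu> \<longleftrightarrow>
     sets \<mu> = sets (borel_of_manifold M) \<and>
     (\<forall>c\<in>atlas M. \<forall>A\<in>sets \<mu>. A \<subseteq> fst c \<longrightarrow>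
        emeasure \<mu> A = (\<integral>\<^sup>+y\<in>snd c ` A. ennreal (volume_density M c y) \<partial>lborel))"

text \<open>The theorem \<open>is_riemannian_volume_riemannian_volume\<close> at the end shows that there is exactly one
  such measure.\<close>

definition riemannian_volume :: "('a, 'n::{finite,wellorder}) riemannian_space \<Rightarrow> 'a measure" where
  "riemannian_volume M = (THE \<mu>. is_riemannian_volume M \<mu>)"


section \<open>Vector fields and the weak gradient\<close>

text \<open>A vector field is given by its components in every chart. Under a change of charts the
  components are multiplied by the Jacobian of the transition map.\<close>

type_synonym ('a, 'n) vfield = "('a, 'n) chart \<Rightarrow> 'a \<Rightarrow> (real, 'n) vec"

definition measurable_vector_field ::
    "('a, 'n::{finite,wellorder}) riemannian_space \<Rightarrow> ('a, 'n) vfield \<Rightarrow> bool" where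
  "measurable_vector_field M V \<longleftrightarrow>
     (\<forall>c\<in>atlas M. V c \<in> borel_measurable (restrict_space (borel_of_manifold M) (fst c))) \<and>
     (\<forall>c\<in>atlas M. \<forall>d\<in>atlas M. \<forall>x\<in>fst c \<inter> fst d.
        V d x = transition_jacobian c d x *v V c x)"

definition chart_at :: "('a, 'n::{finite,wellorder}) riemannian_space \<Rightarrow> 'a \<Rightarrow> ('a, 'n) chart" where
  "chart_at M x = (SOME c. c \<in> atlas M \<and> x \<in> fst c)"

text \<open>The pointwise length \<open>|V|\<close> with respect to the metric. By the transformation laws it does not
  depend on the chart around \<open>x\<close>.\<close>

definition field_norm ::
    "('a, 'n::{finite,wellorder}) riemannian_space \<Rightarrow> ('a, 'n) vfield \<Rightarrow> 'a \<Rightarrow> real" where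
  "field_norm M V x =
     (let c = chart_at M x in sqrt (V c x \<bullet> (metric M c x *v V c x)))"

definition locally_integrable :: "(real^'n::finite) set \<Rightarrow> (real^'n \<Rightarrow> real) \<Rightarrow> bool" where
  "locally_integrable \<Omega> f \<longleftrightarrow> (\<forall>K. compact K \<and> K \<subseteq> \<Omega> \<longrightarrow> set_integrable lborel K f)"

definition test_function :: "(real^'n::finite) set \<Rightarrow> (real^'n \<Rightarrow> real) \<Rightarrow> bool" where
  "test_function \<Omega> \<eta> \<longleftrightarrow>
     smooth_on UNIV \<eta> \<and> compact (closure {y. \<eta> y \<noteq> 0}) \<and> closure {y. \<eta> y \<noteq> 0} \<subseteq> \<Omega>"

definition weak_partial ::
    "(real^'n::finite) set \<Rightarrow> 'n \<Rightarrow> (real^'n \<Rightarrow> real) \<Rightarrow> (real^'n \<Rightarrow> real) \<Rightarrow> bool" where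
  "weak_partial \<Omega> i f h \<longleftrightarrow>
     locally_integrable \<Omega> f \<and> locally_integrable \<Omega> h \<and>
     (\<forall>\<eta>. test_function \<Omega> \<eta> \<longrightarrow>
        (LINT y:\<Omega>|lborel. f y * frechet_derivative \<eta> (at y) (axis i 1)) =
        - (LINT y:\<Omega>|lborel. h y * \<eta> y))"

text \<open>The gradient is dual to the differential: \<open>g(\<nabla>u, e\<^sub>i) = \<partial>\<^sub>i u\<close> for the coordinate vectors
  \<open>e\<^sub>i\<close>, where \<open>\<partial>\<^sub>i\<close> is the weak partial derivative on the interior of the chart image (this
  leaves out the boundary of the manifold).\<close>

definition is_weak_gradient ::
    "('a, 'n::{finite,wellorder}) riemannian_space \<Rightarrow> ('a \<Rightarrow> real) \<Rightarrow> ('a, 'n) vfield \<Rightarrow> bool" where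
  "is_weak_gradient M u V \<longleftrightarrow>
     measurable_vector_field M V \<and>
     (\<forall>c\<in>atlas M. \<forall>i. weak_partial (interior (chart_image c)) i
        (\<lambda>y. u (chart_inv c y))
        (\<lambda>y. (metric M c (chart_inv c y) *v V c (chart_inv c y)) $ i))"

text \<open>Weak gradients are unique up to a null set.\<close>

definition weak_gradient ::
    "('a, 'n::{finite,wellorder}) riemannian_space \<Rightarrow> ('a \<Rightarrow> real) \<Rightarrow> ('a, 'n) vfield" where
  "weak_gradient M u = (SOME V. is_weak_gradient M u V)"


section \<open>Variable exponent Lebesgue and Sobolev spaces\<close>

text \<open>The elements of the spaces are measurable functions, not classes modulo equality almost
  everywhere. The norms below are therefore seminorms on these sets of functions.\<close>

definition variable_exponent ::
    "('a, 'n::{finite,wellorder}) riemannian_space \<Rightarrow> ('a \<Rightarrow> real) \<Rightarrow> bool" where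
  "variable_exponent M r \<longleftrightarrow>
     continuous_map (mtop M) euclideanreal r \<and> bounded (r ` topspace (mtop M)) \<and>
     (\<forall>x\<in>topspace (mtop M). 1 < r x)"

definition Lvar ::
    "('a, 'n::{finite,wellorder}) riemannian_space \<Rightarrow> ('a \<Rightarrow> real) \<Rightarrow> ('a \<Rightarrow> real) set" where
  "Lvar M r =
     {u. u \<in> borel_measurable (riemannian_volume M) \<and>
         (\<integral>\<^sup>+x. ennreal (\<bar>u x\<bar> powr r x) \<partial>riemannian_volume M) < \<infinity>}"

definition Lvar_norm ::
    "('a, 'n::{finite,wellorder}) riemannian_space \<Rightarrow> ('a \<Rightarrow> real) \<Rightarrow> ('a \<Rightarrow> real) \<Rightarrow> real" where
  "Lvar_norm M r u =
     Inf {\<gamma>. 0 < \<gamma> \<and> (\<integral>\<^sup>+x. ennreal (\<bar>u x / \<gamma>\<bar> powr r x) \<partial>riemannian_volume M) \<le> 1}"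

definition W1var ::
    "('a, 'n::{finite,wellorder}) riemannian_space \<Rightarrow> ('a \<Rightarrow> real) \<Rightarrow> ('a \<Rightarrow> real) set" where
  "W1var M r =
     {u \<in> Lvar M r. (\<exists>V. is_weak_gradient M u V) \<and> field_norm M (weak_gradient M u) \<in> Lvar M r}"

definition W1var_norm ::
    "('a, 'n::{finite,wellorder}) riemannian_space \<Rightarrow> ('a \<Rightarrow> real) \<Rightarrow> ('a \<Rightarrow> real) \<Rightarrow> real" where
  "W1var_norm M r u = Lvar_norm M r u + Lvar_norm M r (field_norm M (weak_gradient M u))"


section \<open>Continuous and compact embeddings\<close>

definition continuously_embedded ::
    "('a \<Rightarrow> real) set \<Rightarrow> (('a \<Rightarrow> real) \<Rightarrow> real) \<Rightarrow>
     ('a \<Rightarrow> real) set \<Rightarrow> (('a \<Rightarrow> real) \<Rightarrow> real) \<Rightarrow> bool" where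
  "continuously_embedded X normX Y normY \<longleftrightarrow>
     X \<subseteq> Y \<and> (\<exists>C. \<forall>u\<in>X. normY u \<le> C * normX u)"

definition compactly_embedded ::
    "('a \<Rightarrow> real) set \<Rightarrow> (('a \<Rightarrow> real) \<Rightarrow> real) \<Rightarrow>
     ('a \<Rightarrow> real) set \<Rightarrow> (('a \<Rightarrow> real) \<Rightarrow> real) \<Rightarrow> bool" where
  "compactly_embedded X normX Y normY \<longleftrightarrow>
     X \<subseteq> Y \<and>
     (\<forall>u :: nat \<Rightarrow> 'a \<Rightarrow> real. (\<forall>k. u k \<in> X) \<and> (\<exists>B. \<forall>k. normX (u k) \<le> B) \<longrightarrow>
        (\<exists>v\<in>Y. \<exists>s. strict_mono s \<and> (\<lambda>k. normY (\<lambda>x. u (s k) x - v x)) \<longlonglongrightarrow> 0))"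


section \<open>Existence and uniqueness of the Riemannian volume measure\<close>

lemma Ck_continuous: "Ck_on k F T \<Longrightarrow> continuous_on T F"
  by (cases k) (auto intro: differentiable_imp_continuous_on)

lemma smooth_on_differentiable:
  assumes "smooth_on S f" "x \<in> S"
  shows "f differentiable (at x within S)"
proof -
  obtain T F where T: "open T" "x \<in> T" "\<forall>k. Ck_on k F T" "\<forall>y\<in>S \<inter> T. F y = f y"
    using assms by (force simp: smooth_on_def)
  have "F differentiable (at x within T)"
    using T(2) T(3) by (metis Ck_on.simps(2) differentiable_on_def)
  then have "F differentiable (at x within S)"
    using T(1,2) at_within_open differentiable_at_withinI by metis
  then obtain D where "(F has_derivative D) (at x within S)" by (auto simp: differentiable_def)
  then have "(f has_derivative D) (at x within S)"
  proof (rule has_derivative_transform_eventually)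
    show "\<forall>\<^sub>F x' in at x within S. F x' = f x'"
      using T(1,2,4) unfolding eventually_at_topological by blast
    show "F x = f x" using T assms by auto
    show "x \<in> S" by fact
  qed
  then show ?thesis by (auto simp: differentiable_def)
qed

lemma smooth_on_continuous: "smooth_on S f \<Longrightarrow> continuous_on S f"
  using smooth_on_differentiable differentiable_on_def differentiable_imp_continuous_on by blast

lemma smooth_on_jacobian:
  fixes f :: "real^'n::finite \<Rightarrow> real^'n"
  assumes "smooth_on S f" "x \<in> S"
  shows "(f has_derivative (\<lambda>h. jacobian f (at x within S) *v h)) (at x within S)"
  using smooth_on_differentiable[OF assms] jacobian_works by blast

lemma nn_integral_change_of_variables:
  fixes g :: "real^'n::{finite,wellorder} \<Rightarrow> real^'n::_" and f :: "real^'n::_ \<Rightarrow> real"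
  assumes S: "S \<in> sets borel" and T: "g ` S \<in> sets borel"
    and der: "\<And>x. x \<in> S \<Longrightarrow> (g has_derivative (\<lambda>h. J x *v h)) (at x within S)"
    and inj: "inj_on g S"
    and f: "continuous_on (g ` S) f" and f0: "\<And>y. y \<in> g ` S \<Longrightarrow> 0 \<le> f y"
    and cd: "continuous_on S d"
    and d: "\<And>x. x \<in> S \<Longrightarrow> \<bar>det (J x)\<bar> * f (g x) = d x"
  shows "(\<integral>\<^sup>+x\<in>S. ennreal (d x) \<partial>lborel) = (\<integral>\<^sup>+y\<in>g ` S. ennreal (f y) \<partial>lborel)"
proof -
  have cg: "continuous_on S g"
    using der continuous_on_eq_continuous_within has_derivative_continuous by blast
  have cfg: "continuous_on S (f \<circ> g)" using cg f continuous_on_compose by blast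
  define Sk where "Sk k = {x\<in>S. norm (g x) \<le> real k \<and> f (g x) \<le> real k}" for k :: nat
  have mS: "Sk k \<in> sets borel" for k
  proof -
    have "(\<lambda>x. indicator S x *\<^sub>R norm (g x)) \<in> borel_measurable borel"
      "(\<lambda>x. indicator S x *\<^sub>R (f \<circ> g) x) \<in> borel_measurable borel"
      using borel_measurable_continuous_on_indicator[OF S cfg]
        borel_measurable_continuous_on_indicator[OF S continuous_on_norm[OF cg]] by simp_all
    note [measurable] = this S
    have "Sk k = {x\<in>space borel. x \<in> S \<and> indicator S x *\<^sub>R norm (g x) \<le> real k \<and>
        indicator S x *\<^sub>R (f \<circ> g) x \<le> real k}"
      by (auto simp: Sk_def)
    also have "\<dots> \<in> sets borel" by measurable
    finally show ?thesis .
  qed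
  have mT: "g ` Sk k \<in> sets borel" for k
  proof -
    have "(\<lambda>x. indicator (g`S) x *\<^sub>R f x) \<in> borel_measurable borel"
      using T f by (intro borel_measurable_continuous_on_indicator continuous_intros; simp)
    note [measurable] = this T
    have "g ` Sk k = {y\<in>space borel. y \<in> g ` S \<and> norm y \<le> real k \<and> indicator (g ` S) y *\<^sub>R f y \<le> real k}"
      by (auto simp: Sk_def)
    also have "\<dots> \<in> sets borel" by measurable
    finally show ?thesis .
  qed
  have sub: "Sk k \<subseteq> S" for k by (auto simp: Sk_def)
  have key: "(\<integral>\<^sup>+x\<in>Sk k. ennreal (d x) \<partial>lborel) = (\<integral>\<^sup>+y\<in>g ` Sk k. ennreal (f y) \<partial>lborel)" for k
  proof -
    let ?b = "integral (g ` Sk k) f"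
    have bnd: "g ` Sk k \<subseteq> cball 0 (real k)" by (auto simp: Sk_def)
    have fin: "g ` Sk k \<in> lmeasurable"
      using mT[of k] bounded_subset[OF bounded_cball bnd] bounded_set_imp_lmeasurable by (metis sets_completionI_sets sets_lborel)
    have "f absolutely_integrable_on (g ` Sk k)"
    proof (rule measurable_bounded_by_integrable_imp_absolutely_integrable)
      show "f \<in> borel_measurable (lebesgue_on (g ` Sk k))"
        using continuous_on_subset[OF f image_mono[OF sub]] mT[of k]
        by (intro continuous_imp_measurable_on_sets_lebesgue) simp_all
      show "g ` Sk k \<in> sets lebesgue" using fin by auto
      show "(\<lambda>x. real k) integrable_on g ` Sk k" using fin by (simp add: integrable_on_const)
      show "norm (f x) \<le> real k" if "x \<in> g ` Sk k" for x
        using that f0 sub by (force simp: Sk_def)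
    qed
    moreover note fa = this
    then have "(\<lambda>x. vec (f x) :: real^1) absolutely_integrable_on (g ` Sk k) \<and>
        integral (g ` Sk k) (\<lambda>x. vec (f x) :: real^1) = vec ?b"
      by (simp add: absolutely_integrable_on_1_iff integral_on_1_eq)
    moreover have "(\<lambda>x. \<bar>det (matrix (\<lambda>h. J x *v h))\<bar> *\<^sub>R vec (f (g x)) :: real^1) absolutely_integrable_on Sk k \<and>
        integral (Sk k) (\<lambda>x. \<bar>det (matrix (\<lambda>h. J x *v h))\<bar> *\<^sub>R vec (f (g x)) :: real^1) = vec ?b
      \<longleftrightarrow> (\<lambda>x. vec (f x) :: real^1) absolutely_integrable_on (g ` Sk k) \<and>
        integral (g ` Sk k) (\<lambda>x. vec (f x) :: real^1) = vec ?b"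
    proof (rule has_absolute_integral_change_of_variables)
      show "Sk k \<in> sets lebesgue" using mS by simp
      show "(g has_derivative (\<lambda>h. J x *v h)) (at x within Sk k)" if "x \<in> Sk k" for x
        using that der sub has_derivative_subset by blast
      show "inj_on g (Sk k)" using inj sub inj_on_subset by blast
    qed
    ultimately have *: "(\<lambda>x. \<bar>det (J x)\<bar> * f (g x)) absolutely_integrable_on Sk k \<and>
           integral (Sk k) (\<lambda>x. \<bar>det (J x)\<bar> * f (g x)) = ?b"
      by (simp add: absolutely_integrable_on_1_iff integral_on_1_eq)
    have dk: "\<bar>det (J x)\<bar> * f (g x) = d x" if "x \<in> Sk k" for x using d sub that by blast
    have **: "d absolutely_integrable_on Sk k \<and> integral (Sk k) d = ?b"
      using * dk by (metis (no_types, lifting) absolutely_integrable_spike integral_cong negligible_empty empty_iff DiffE Diff_iff)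
    have d0: "0 \<le> d x" if "x \<in> S" for x using d[OF that, symmetric] f0 that by simp
    have eq: "(\<integral>\<^sup>+x\<in>A. ennreal (h x) \<partial>lborel) = ennreal (integral A h)"
      if h: "h absolutely_integrable_on A" "\<And>x. x \<in> A \<Longrightarrow> 0 \<le> h x" for A and h :: "real^'n::_ \<Rightarrow> real"
    proof -
      have "(\<integral>\<^sup>+x\<in>A. ennreal (h x) \<partial>lborel) = (\<integral>\<^sup>+x. ennreal (indicator A x *\<^sub>R h x) \<partial>lebesgue)"
        by (auto simp: nn_integral_completion intro!: nn_integral_cong split: split_indicator)
      also have "\<dots> = ennreal (LINT x|lebesgue. indicator A x *\<^sub>R h x)"
        using h by (intro nn_integral_eq_integral) (auto simp: set_integrable_def indicator_def)
      also have "\<dots> = ennreal (integral A h)"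
        using set_lebesgue_integral_eq_integral(2)[OF h(1)] by (simp add: set_lebesgue_integral_def)
      finally show ?thesis .
    qed
    show ?thesis
    proof -
      have "(\<integral>\<^sup>+x\<in>Sk k. ennreal (d x) \<partial>lborel) = ennreal (integral (Sk k) d)"
        using ** d0 sub by (intro eq) auto
      also have "\<dots> = ennreal (integral (g ` Sk k) f)" using ** by simp
      also have "\<dots> = (\<integral>\<^sup>+y\<in>g ` Sk k. ennreal (f y) \<partial>lborel)"
        using fa f0 sub by (intro eq[symmetric]) auto
      finally show ?thesis .
    qed
  qed
  have lim: "(\<integral>\<^sup>+x\<in>A. h x \<partial>lborel) = (SUP k. \<integral>\<^sup>+x\<in>B k. h x \<partial>lborel)"
    if B: "\<And>k. B k \<in> sets borel" "incseq B" "(\<Union>k. B k) = A" "(\<lambda>x. h x * indicator A x) \<in> borel_measurable borel"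
    for A B and h :: "real^'n::_ \<Rightarrow> ennreal"
  proof -
    have m: "(\<lambda>x. h x * indicator (B k) x) \<in> borel_measurable lborel" for k
    proof -
      have "(\<lambda>x. h x * indicator (B k) x) = (\<lambda>x. (h x * indicator A x) * indicator (B k) x)"
        using B(3) by (auto split: split_indicator)
      then show ?thesis using B(1,4) by simp
    qed
    have "(\<integral>\<^sup>+x\<in>A. h x \<partial>lborel) = (\<integral>\<^sup>+x. (SUP k. h x * indicator (B k) x) \<partial>lborel)"
    proof (rule nn_integral_cong)
      fix x
      show "h x * indicator A x = (SUP k. h x * indicator (B k) x)"
      proof (cases "x \<in> A")
        case True
        then obtain k where "x \<in> B k" using B(3) by auto
        then show ?thesis using True
          by (intro antisym SUP_upper2[of k] SUP_least) (auto split: split_indicator)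
      next
        case False
        then have "x \<notin> B k" for k using B(3) by auto
        then show ?thesis using False by simp
      qed
    qed
    also have "\<dots> = (SUP k. \<integral>\<^sup>+x\<in>B k. h x \<partial>lborel)"
      using m B(2) by (intro nn_integral_monotone_convergence_SUP)
        (auto simp: incseq_def le_fun_def split: split_indicator)
    finally show ?thesis .
  qed
  have inc: "incseq Sk" by (auto simp: incseq_def Sk_def)
  have un: "(\<Union>k. Sk k) = S"
  proof -
    have "\<exists>k. norm (g x) \<le> real k \<and> f (g x) \<le> real k" for x
      using real_arch_simple[of "max (norm (g x)) (f (g x))"] by auto
    then show ?thesis by (auto simp: Sk_def)
  qed
  have "(\<integral>\<^sup>+x\<in>S. ennreal (d x) \<partial>lborel) = (SUP k. \<integral>\<^sup>+x\<in>Sk k. ennreal (d x) \<partial>lborel)"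
  proof (rule lim[OF mS inc un])
    have "(\<lambda>x. indicator S x *\<^sub>R d x) \<in> borel_measurable borel"
      using S cd by (rule borel_measurable_continuous_on_indicator)
    then have "(\<lambda>x. ennreal (indicator S x *\<^sub>R d x)) \<in> borel_measurable borel" by measurable
    also have "(\<lambda>x. ennreal (indicator S x *\<^sub>R d x)) = (\<lambda>x. ennreal (d x) * indicator S x)"
      by (auto split: split_indicator)
    finally show "(\<lambda>x. ennreal (d x) * indicator S x) \<in> borel_measurable borel" .
  qed
  also have "\<dots> = (SUP k. \<integral>\<^sup>+y\<in>g ` Sk k. ennreal (f y) \<partial>lborel)" by (simp add: key)
  also have "\<dots> = (\<integral>\<^sup>+y\<in>g ` S. ennreal (f y) \<partial>lborel)"
  proof (rule lim[OF mT, symmetric])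
    show "incseq (\<lambda>k. g ` Sk k)" using inc by (auto simp: incseq_def)
    show "(\<Union>k. g ` Sk k) = g ` S" using un by auto
    have "(\<lambda>x. indicator (g ` S) x *\<^sub>R f x) \<in> borel_measurable borel"
      using T f by (rule borel_measurable_continuous_on_indicator)
    then have "(\<lambda>x. ennreal (indicator (g ` S) x *\<^sub>R f x)) \<in> borel_measurable borel" by measurable
    also have "(\<lambda>x. ennreal (indicator (g ` S) x *\<^sub>R f x)) = (\<lambda>x. ennreal (f x) * indicator (g ` S) x)"
      by (auto split: split_indicator)
    finally show "(\<lambda>x. ennreal (f x) * indicator (g ` S) x) \<in> borel_measurable borel" .
  qed
  finally show ?thesis .
qed


lemma continuous_on_det:
  fixes A :: "'b::topological_space \<Rightarrow> real^'n^'n"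
  assumes "continuous_on S A"
  shows "continuous_on S (\<lambda>x. det (A x))"
  unfolding det_def
  by (intro continuous_on_sum continuous_on_mult continuous_on_const continuous_on_prod
      continuous_on_component assms)

lemma posdef_det_nonneg:
  fixes g :: "real^'n^'n"
  assumes pd: "\<And>v. v \<noteq> 0 \<Longrightarrow> 0 < v \<bullet> (g *v v)"
  shows "0 \<le> det g"
proof (rule ccontr)
  assume neg: "\<not> 0 \<le> det g"
  let ?A = "\<lambda>t::real. t *\<^sub>R mat 1 + (1 - t) *\<^sub>R g"
  have "continuous_on {0..1} (\<lambda>t. det (?A t))"
    by (intro continuous_on_det continuous_intros)
  moreover have "det (?A 0) \<le> 0" "0 \<le> det (?A 1)" using neg by simp_all
  ultimately obtain t where t: "0 \<le> t" "t \<le> 1" "det (?A t) = 0"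
    using IVT'[of "\<lambda>t. det (?A t)" 0 0 1] by auto
  have "\<not> invertible (?A t)" using t(3) invertible_det_nz by blast
  then obtain v where v: "v \<noteq> 0" "?A t *v v = 0"
    unfolding invertible_left_inverse matrix_left_invertible_ker by blast
  have e: "?A t *v v = t *\<^sub>R v + (1 - t) *\<^sub>R (g *v v)"
    by (simp only: matrix_vector_mult_add_rdistrib scaleR_matrix_vector_assoc[symmetric] matrix_vector_mul_lid)
  have "0 = v \<bullet> (?A t *v v)" using v by simp
  also have "\<dots> = t * (v \<bullet> v) + (1 - t) * (v \<bullet> (g *v v))"
    unfolding e by (simp add: inner_add_right)
  also have "\<dots> > 0"
  proof (cases "t = 0")
    case True then show ?thesis using pd[OF v(1)] by simp
  next
    case False
    then have "0 < t * (v \<bullet> v)" using t v by simp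
    moreover have "0 \<le> (1 - t) * (v \<bullet> (g *v v))"
      using t pd[OF v(1)] by (intro mult_nonneg_nonneg) auto
    ultimately show ?thesis by linarith
  qed
  finally show False by simp
qed

context
  fixes M :: "('a, 'n::{finite,wellorder}) riemannian_space"
  assumes M: "riemannian_manifold M"
begin

lemma smooth_manifold_M: "smooth_manifold M"
  using M by (simp add: riemannian_manifold_def)

lemma space_borel_of_manifold: "space (borel_of_manifold M) = topspace (mtop M)"
  unfolding borel_of_manifold_def by (rule space_measure_of) (auto dest: openin_subset)

lemma sets_borel_of_manifold:
  "sets (borel_of_manifold M) = sigma_sets (topspace (mtop M)) {U. openin (mtop M) U}"
  by (auto simp: borel_of_manifold_def dest: openin_subset intro!: sets_measure_of)

lemma openin_sets: "openin (mtop M) U \<Longrightarrow> U \<in> sets (borel_of_manifold M)"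
  by (simp add: sets_borel_of_manifold)

lemma chart_open: "c \<in> atlas M \<Longrightarrow> openin (mtop M) (fst c)"
  using smooth_manifold_M by (simp add: smooth_manifold_def)

lemma chart_homeo:
  "c \<in> atlas M \<Longrightarrow> homeomorphic_map (subtopology (mtop M) (fst c)) (top_of_set (chart_image c)) (snd c)"
  using smooth_manifold_M by (simp add: smooth_manifold_def)

lemma chart_topspace: "c \<in> atlas M \<Longrightarrow> topspace (subtopology (mtop M) (fst c)) = fst c"
  using openin_subset[OF chart_open[of c]] by (auto simp: topspace_subtopology)

lemma chart_inj: "c \<in> atlas M \<Longrightarrow> inj_on (snd c) (fst c)"
  using homeomorphic_imp_injective_map[OF chart_homeo[of c]] chart_topspace[of c] by simp

lemma chart_inv_left: "c \<in> atlas M \<Longrightarrow> x \<in> fst c \<Longrightarrow> chart_inv c (snd c x) = x"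
  by (simp add: chart_inv_def chart_inj)

lemma chart_image_borel: assumes "c \<in> atlas M" shows "chart_image c \<in> sets borel"
proof -
  have "closed {x::(real,'n) vec. 0 \<le> x $ (LEAST i. True)}"
    using closed_Collect_le[of "\<lambda>x. 0" "\<lambda>x::(real,'n) vec. x $ (LEAST i. True)"] by (simp add: continuous_on_component)
  then have "(half_space :: (real,'n) vec set) \<in> sets borel" by (simp add: half_space_def)
  moreover have "open (chart_image c) \<or> openin (top_of_set half_space) (chart_image c)"
    using smooth_manifold_M assms by (simp add: smooth_manifold_def)
  ultimately show ?thesis by (auto simp: openin_open)
qed

lemma chart_inv_measurable:
  assumes "c \<in> atlas M"
  shows "chart_inv c \<in> measurable (restrict_space borel (chart_image c)) (borel_of_manifold M)"
  unfolding borel_of_manifold_def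
proof (rule measurable_measure_of)
  show "{U. openin (mtop M) U} \<subseteq> Pow (topspace (mtop M))" by (auto dest: openin_subset)
  have *: "chart_inv c y \<in> fst c" if "y \<in> chart_image c" for y
    using that by (auto simp: chart_image_def chart_inv_left assms)
  show "chart_inv c \<in> space (restrict_space borel (chart_image c)) \<rightarrow> topspace (mtop M)"
    using * openin_subset[OF chart_open[OF assms]] by (auto simp: space_restrict_space)
  fix U assume "U \<in> {U. openin (mtop M) U}"
  then have "openin (subtopology (mtop M) (fst c)) (U \<inter> fst c)"
    by (auto simp: openin_subtopology)
  then have "openin (top_of_set (chart_image c)) (snd c ` (U \<inter> fst c))"
    using chart_homeo[OF assms] homeomorphic_map_openness_eq by blast
  moreover have "chart_inv c -` U \<inter> space (restrict_space borel (chart_image c)) = snd c ` (U \<inter> fst c)"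
    by (auto simp: space_restrict_space chart_image_def chart_inv_left assms)
  ultimately show "chart_inv c -` U \<inter> space (restrict_space borel (chart_image c))
      \<in> sets (restrict_space borel (chart_image c))"
    by (auto simp: openin_open sets_restrict_space)
qed

lemma chart_image_sets:
  assumes "c \<in> atlas M" "A \<in> sets (borel_of_manifold M)" "A \<subseteq> fst c"
  shows "snd c ` A \<in> sets borel"
proof -
  have "chart_inv c -` A \<inter> space (restrict_space borel (chart_image c)) \<in> sets (restrict_space borel (chart_image c))"
    using chart_inv_measurable[OF assms(1)] assms(2) by (rule measurable_sets)
  moreover have "chart_inv c -` A \<inter> space (restrict_space borel (chart_image c)) = snd c ` A"
    using assms by (auto simp: space_restrict_space chart_image_def chart_inv_left)
  ultimately show ?thesis
    using chart_image_borel[OF assms(1)] by (auto simp: sets_restrict_space_iff)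
qed

lemma metric_det_pos:
  assumes "c \<in> atlas M" "x \<in> fst c"
  shows "0 \<le> det (metric M c x)"
proof (rule posdef_det_nonneg)
  show "0 < v \<bullet> (metric M c x *v v)" if "v \<noteq> 0" for v
    using M assms that unfolding riemannian_manifold_def by blast
qed

lemma volume_density_continuous:
  assumes "c \<in> atlas M"
  shows "continuous_on (chart_image c) (volume_density M c)"
proof -
  have "continuous_on (chart_image c) (metric M c \<circ> chart_inv c)"
    using M assms smooth_on_continuous unfolding riemannian_manifold_def by blast
  then show ?thesis
    unfolding volume_density_def o_def by (intro continuous_on_real_sqrt continuous_on_det)
qed

definition "chart_volume c A = (\<integral>\<^sup>+y\<in>snd c ` A. ennreal (volume_density M c y) \<partial>lborel)"

lemma chart_volume_eq:
  assumes c: "c \<in> atlas M" and d: "d \<in> atlas M" and A: "A \<in> sets (borel_of_manifold M)" "A \<subseteq> fst c" "A \<subseteq> fst d"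
  shows "chart_volume c A = chart_volume d A"
proof -
  let ?O = "snd c ` (fst c \<inter> fst d)"
  have im: "transition c d ` (snd c ` A) = snd d ` A"
    using A by (force simp: transition_def chart_inv_left c image_image)
  have sO: "smooth_on ?O (transition c d)" using smooth_manifold_M c d by (simp add: smooth_manifold_def)
  have "(\<integral>\<^sup>+x\<in>snd c ` A. ennreal (volume_density M c x) \<partial>lborel) =
    (\<integral>\<^sup>+y\<in>transition c d ` (snd c ` A). ennreal (volume_density M d y) \<partial>lborel)"
  proof (rule nn_integral_change_of_variables)
    show "snd c ` A \<in> sets borel" by (rule chart_image_sets[OF c A(1,2)])
    show "transition c d ` (snd c ` A) \<in> sets borel" unfolding im by (rule chart_image_sets[OF d A(1,3)])
    show "(transition c d has_derivative (\<lambda>h. transition_jacobian c d (chart_inv c x) *v h)) (at x within snd c ` A)"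
      if "x \<in> snd c ` A" for x
    proof -
      have "x \<in> ?O" using that A by auto
      moreover have "snd c (chart_inv c x) = x" using that A by (auto simp: chart_inv_left c)
      ultimately have "(transition c d has_derivative (\<lambda>h. transition_jacobian c d (chart_inv c x) *v h)) (at x within ?O)"
        using smooth_on_jacobian[OF sO] by (simp add: transition_jacobian_def)
      then show ?thesis using A by (auto elim!: has_derivative_subset)
    qed
    show "inj_on (transition c d) (snd c ` A)"
    proof (rule inj_onI)
      fix x y assume "x \<in> snd c ` A" "y \<in> snd c ` A" and e: "transition c d x = transition c d y"
      then obtain a b where ab: "x = snd c a" "y = snd c b" "a \<in> A" "b \<in> A" by auto
      then have "snd d a = snd d b" using e A by (auto simp: transition_def chart_inv_left c subset_iff)
      then have "a = b" using ab A(3) chart_inj[OF d] by (meson inj_onD subsetD)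
      then show "x = y" using ab by simp
    qed
    show "continuous_on (transition c d ` snd c ` A) (volume_density M d)"
      unfolding im using A by (intro continuous_on_subset[OF volume_density_continuous[OF d]]) (auto simp: chart_image_def)
    show "continuous_on (snd c ` A) (volume_density M c)"
      using A by (intro continuous_on_subset[OF volume_density_continuous[OF c]]) (auto simp: chart_image_def)
    show "0 \<le> volume_density M d y" if "y \<in> transition c d ` snd c ` A" for y
      using that A unfolding im by (auto simp: volume_density_def chart_inv_left d subset_iff metric_det_pos)
    show "\<bar>det (transition_jacobian c d (chart_inv c x))\<bar> * volume_density M d (transition c d x) = volume_density M c x"
      if xA: "x \<in> snd c ` A" for x
    proof -
      obtain a where a: "x = snd c a" "a \<in> A" "a \<in> fst c" "a \<in> fst d" using xA A(2,3) by blast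
      have "metric M c a = transpose (transition_jacobian c d a) ** metric M d a ** transition_jacobian c d a"
        using M c d a(3,4) unfolding riemannian_manifold_def by blast
      then have "det (metric M c a) = (det (transition_jacobian c d a))\<^sup>2 * det (metric M d a)"
        by (simp add: det_mul power2_eq_square)
      then show ?thesis
        using a by (simp add: volume_density_def transition_def chart_inv_left c d real_sqrt_mult)
    qed
  qed
  then show ?thesis by (simp add: chart_volume_def im)
qed

lemma chart_volume_suminf:
  assumes c: "c \<in> atlas M" and A: "range A \<subseteq> sets (borel_of_manifold M)" "\<And>i::nat. A i \<subseteq> fst c"
    and dis: "disjoint_family A"
  shows "chart_volume c (\<Union>i. A i) = (\<Sum>i. chart_volume c (A i))"
proof -
  have B: "snd c ` A i \<in> sets borel" for i using chart_image_sets[OF c _ A(2)] A(1) by auto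
  have disB: "disjoint_family (\<lambda>i. snd c ` A i)"
    using dis chart_inj[OF c] A(2) unfolding disjoint_family_on_def
    by (metis image_empty inj_on_image_Int)
  have dens: "(\<lambda>x. ennreal (indicator (chart_image c) x *\<^sub>R volume_density M c x)) \<in> borel_measurable lborel"
    using borel_measurable_continuous_on_indicator[OF chart_image_borel[OF c] volume_density_continuous[OF c]]
    by simp
  let ?m = "density lborel (\<lambda>x. ennreal (indicator (chart_image c) x *\<^sub>R volume_density M c x))"
  have e: "chart_volume c X = emeasure ?m (snd c ` X)" if "snd c ` X \<in> sets borel" "X \<subseteq> fst c" for X
  proof -
    have "snd c ` X \<subseteq> chart_image c" using that(2) by (auto simp: chart_image_def)
    then have "ennreal (indicator (chart_image c) x *\<^sub>R volume_density M c x) * indicator (snd c ` X) x =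
        ennreal (volume_density M c x) * indicator (snd c ` X) x" for x
      by (cases "x \<in> snd c ` X") auto
    then show ?thesis using that(1) dens by (simp add: chart_volume_def emeasure_density)
  qed
  have "chart_volume c (\<Union>i. A i) = emeasure ?m (\<Union>i. snd c ` A i)"
    using e[of "\<Union>i. A i"] B A(2) by (auto simp: image_UN)
  also have "\<dots> = (\<Sum>i. emeasure ?m (snd c ` A i))"
    using B disB by (intro suminf_emeasure[symmetric]) auto
  also have "\<dots> = (\<Sum>i. chart_volume c (A i))" using e B A(2) by simp
  finally show ?thesis .
qed

lemma disjoint_chart_cover:
  assumes ne: "topspace (mtop M) \<noteq> {}"
  obtains C D where "range C \<subseteq> atlas M" "range D \<subseteq> sets (borel_of_manifold M)" "disjoint_family D"
    "\<And>i::nat. D i \<subseteq> fst (C i)" "(\<Union>i. D i) = topspace (mtop M)"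
proof -
  have "Lindelof_space (mtop M)"
    using smooth_manifold_M second_countable_imp_Lindelof_space by (auto simp: smooth_manifold_def)
  moreover have "(\<forall>U\<in>fst ` atlas M. openin (mtop M) U) \<and> \<Union>(fst ` atlas M) = topspace (mtop M)"
    using smooth_manifold_M by (auto simp: smooth_manifold_def)
  ultimately obtain V where V: "countable V" "V \<subseteq> fst ` atlas M" "\<Union>V = topspace (mtop M)"
    unfolding Lindelof_space_def by meson
  then have "V \<noteq> {}" using ne by (metis Union_empty)
  let ?U = "from_nat_into V"
  have U: "?U i \<in> V" for i using \<open>V \<noteq> {}\<close> by (rule from_nat_into)
  have "\<forall>i. \<exists>c. c \<in> atlas M \<and> fst c = ?U i" using U V(2) by (metis image_iff subsetD)
  then obtain C where C: "\<And>i. C i \<in> atlas M" "\<And>i. fst (C i) = ?U i" by metis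
  show ?thesis
  proof (rule that[of C "disjointed ?U"])
    show "range C \<subseteq> atlas M" using C by auto
    have "range ?U \<subseteq> sets (borel_of_manifold M)" using C chart_open openin_sets by (metis image_subsetI)
    then show "range (disjointed ?U) \<subseteq> sets (borel_of_manifold M)" by (rule sets.range_disjointed_sets)
    show "disjoint_family (disjointed ?U)" by (rule disjoint_family_disjointed)
    show "disjointed ?U i \<subseteq> fst (C i)" for i using C disjointed_subset by metis
    show "(\<Union>i. disjointed ?U i) = topspace (mtop M)"
      using V range_from_nat_into[OF \<open>V \<noteq> {}\<close> V(1)] by (simp add: UN_disjointed_eq)
  qed
qed

lemma is_riemannian_volume_chart_volume:
  "is_riemannian_volume M \<mu> \<longleftrightarrow> sets \<mu> = sets (borel_of_manifold M) \<and>
     (\<forall>c\<in>atlas M. \<forall>A\<in>sets \<mu>. A \<subseteq> fst c \<longrightarrow> emeasure \<mu> A = chart_volume c A)"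
  by (simp add: is_riemannian_volume_def chart_volume_def)

lemma volume_unique:
  assumes m: "is_riemannian_volume M \<mu>" and n: "is_riemannian_volume M \<nu>"
  shows "\<mu> = \<nu>"
proof (rule measure_eqI)
  show s: "sets \<mu> = sets \<nu>" using m n by (simp add: is_riemannian_volume_chart_volume)
  fix A assume A: "A \<in> sets \<mu>"
  then have Ab: "A \<in> sets (borel_of_manifold M)" using m by (simp add: is_riemannian_volume_chart_volume)
  then have At: "A \<subseteq> topspace (mtop M)" using sets.sets_into_space space_borel_of_manifold by metis
  show "emeasure \<mu> A = emeasure \<nu> A"
  proof (cases "topspace (mtop M) = {}")
    case True then show ?thesis using At by simp
  next
    case False
    obtain C D where CD: "range C \<subseteq> atlas M" "range D \<subseteq> sets (borel_of_manifold M)" "disjoint_family D"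
      "\<And>i::nat. D i \<subseteq> fst (C i)" "(\<Union>i. D i) = topspace (mtop M)" using disjoint_chart_cover[OF False] by metis
    have AD: "A \<inter> D i \<in> sets (borel_of_manifold M)" for i using Ab CD by auto
    have "emeasure \<rho> A = (\<Sum>i. chart_volume (C i) (A \<inter> D i))" if r: "is_riemannian_volume M \<rho>" for \<rho>
    proof -
      have "A = (\<Union>i. A \<inter> D i)" using At CD by auto
      then have "emeasure \<rho> A = emeasure \<rho> (\<Union>i. A \<inter> D i)" by simp
      also have "\<dots> = (\<Sum>i. emeasure \<rho> (A \<inter> D i))"
        using r AD CD(3) by (intro suminf_emeasure[symmetric]) (auto simp: is_riemannian_volume_chart_volume disjoint_family_on_def)
      also have "\<dots> = (\<Sum>i. chart_volume (C i) (A \<inter> D i))"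
      proof (rule suminf_cong)
        fix i show "emeasure \<rho> (A \<inter> D i) = chart_volume (C i) (A \<inter> D i)"
          using r AD[of i] CD(1) CD(4)[of i] unfolding is_riemannian_volume_chart_volume
          by (metis inf.coboundedI2 rangeI subsetD)
      qed
      finally show ?thesis .
    qed
    then show ?thesis using m n by simp
  qed
qed

lemma volume_exists: "\<exists>\<mu>. is_riemannian_volume M \<mu>"
proof (cases "topspace (mtop M) = {}")
  case True
  have e: "A = {}" if "A \<in> sets (borel_of_manifold M)" for A
    using sets.sets_into_space[OF that] True space_borel_of_manifold by auto
  then have "is_riemannian_volume M (borel_of_manifold M)"
    unfolding is_riemannian_volume_def
  proof (intro conjI ballI impI refl)
    fix c A assume "A \<in> sets (borel_of_manifold M)"
    then have "A = {}" by (rule e)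
    then show "emeasure (borel_of_manifold M) A = (\<integral>\<^sup>+y\<in>snd c ` A. ennreal (volume_density M c y) \<partial>lborel)"
      by simp
  qed
  then show ?thesis ..
next
  case False
  obtain C D where CD: "range C \<subseteq> atlas M" "range D \<subseteq> sets (borel_of_manifold M)" "disjoint_family D"
    "\<And>i::nat. D i \<subseteq> fst (C i)" "(\<Union>i. D i) = topspace (mtop M)" using disjoint_chart_cover[OF False] by metis
  let ?f = "\<lambda>A. \<integral>\<^sup>+i. chart_volume (C i) (A \<inter> D i) \<partial>count_space UNIV"
  define \<mu> where "\<mu> = measure_of (topspace (mtop M)) (sets (borel_of_manifold M)) ?f"
  have sp: "sets (borel_of_manifold M) \<subseteq> Pow (topspace (mtop M))"
    using sets.space_closed[of "borel_of_manifold M"] space_borel_of_manifold by simp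
  have sa: "sigma_algebra (topspace (mtop M)) (sets (borel_of_manifold M))"
    using sets.sigma_algebra_axioms[of "borel_of_manifold M"] space_borel_of_manifold by simp
  have smu: "sets \<mu> = sets (borel_of_manifold M)"
    unfolding \<mu>_def by (rule sigma_algebra.sets_measure_of_eq[OF sa])
  have em: "emeasure \<mu> A = ?f A" if "A \<in> sets (borel_of_manifold M)" for A
    unfolding \<mu>_def
  proof (rule emeasure_measure_of_sigma[OF sa _ _ that])
    show "positive (sets (borel_of_manifold M)) ?f" by (simp add: positive_def chart_volume_def)
    show "countably_additive (sets (borel_of_manifold M)) ?f"
    proof (rule countably_additiveI)
      fix A :: "nat \<Rightarrow> 'a set"
      assume A: "range A \<subseteq> sets (borel_of_manifold M)" "disjoint_family A"
      have "(\<Sum>k. ?f (A k)) = (\<integral>\<^sup>+i. (\<Sum>k. chart_volume (C i) (A k \<inter> D i)) \<partial>count_space UNIV)"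
        by (rule nn_integral_suminf[symmetric]) simp
      also have "\<dots> = ?f (\<Union>k. A k)"
      proof (rule nn_integral_cong)
        fix i
        have "chart_volume (C i) (\<Union>k. A k \<inter> D i) = (\<Sum>k. chart_volume (C i) (A k \<inter> D i))"
        proof (rule chart_volume_suminf)
          show "C i \<in> atlas M" using CD by auto
          show "range (\<lambda>k. A k \<inter> D i) \<subseteq> sets (borel_of_manifold M)" using A CD by auto
          show "A k \<inter> D i \<subseteq> fst (C i)" for k using CD(4)[of i] by auto
          show "disjoint_family (\<lambda>k. A k \<inter> D i)" using A by (auto simp: disjoint_family_on_def)
        qed
        then show "(\<Sum>k. chart_volume (C i) (A k \<inter> D i)) = chart_volume (C i) ((\<Union>k. A k) \<inter> D i)" by simp
      qed
      finally show "(\<Sum>k. ?f (A k)) = ?f (\<Union>k. A k)" .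
    qed
  qed
  have "emeasure \<mu> A = chart_volume c A" if c: "c \<in> atlas M" and A: "A \<in> sets \<mu>" "A \<subseteq> fst c" for c A
  proof -
    have Ab: "A \<in> sets (borel_of_manifold M)" using A smu by simp
    have AD: "A \<inter> D i \<in> sets (borel_of_manifold M)" for i using Ab CD by auto
    have "emeasure \<mu> A = (\<Sum>i. chart_volume (C i) (A \<inter> D i))" using em[OF Ab] by (simp add: nn_integral_count_space_nat)
    also have "\<dots> = (\<Sum>i. chart_volume c (A \<inter> D i))"
    proof (rule suminf_cong)
      fix i
      show "chart_volume (C i) (A \<inter> D i) = chart_volume c (A \<inter> D i)"
        using CD(1) CD(4)[of i] A by (intro chart_volume_eq[OF _ c AD]) auto
    qed
    also have "\<dots> = chart_volume c (\<Union>i. A \<inter> D i)"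
    proof (rule chart_volume_suminf[OF c, symmetric])
      show "range (\<lambda>i. A \<inter> D i) \<subseteq> sets (borel_of_manifold M)" using AD by blast
      show "A \<inter> D i \<subseteq> fst c" for i using A by blast
      show "disjoint_family (\<lambda>i. A \<inter> D i)" using CD(3) unfolding disjoint_family_on_def by blast
    qed
    also have "(\<Union>i. A \<inter> D i) = A"
      using CD(5) A(2) openin_subset[OF chart_open[OF c]] by auto
    finally show ?thesis .
  qed
  then have "is_riemannian_volume M \<mu>" by (simp add: is_riemannian_volume_chart_volume smu)
  then show ?thesis ..
qed

theorem is_riemannian_volume_riemannian_volume: "is_riemannian_volume M (riemannian_volume M)"
  unfolding riemannian_volume_def using volume_exists volume_unique by (metis theI)

end

end

theory Submission
  imports Defs "HOL-Library.Diagonal_Subsequence"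
begin

text \<open>By compactness of \<open>M\<close> and continuity of the exponents the statement is local. Around each point there
are a chart and constants \<open>q0 \<le> q\<close>, \<open>p0 \<ge> p\<close> that satisfy \<open>1 \<le> q0 \<le> p0\<close> and still
\<open>p0 (1/q0 - 1/N) < 1\<close> (\<open>subcritical_exponents\<close>). In the chart the point has a neighbourhood that is a
coordinate box up to a null set, also when it lies on the boundary of \<open>M\<close> (\<open>fat_cell_near\<close>). It
therefore suffices to bound \<open>f\<close> in \<open>L^p0\<close> of a box, and to extract convergent subsequences there, when
\<open>f\<close> and its weak partial derivatives are bounded in \<open>L^q0\<close> of the box.

On the box a martingale replaces mollification and potential estimates. The box is bisected again and again across
a longest side, and \<open>f\<close> is replaced by its averages \<open>E\<^sub>k f\<close> over the \<open>2^k\<close> cells of generation \<open>k\<close>.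
Testing the weak derivative with functions that approximate a piecewise linear profile in one coordinate shows
that the integrals of \<open>f\<close> over the two halves of a cell with long side \<open>l\<close> differ by at most
\<open>l/2\<close> times the integral of the gradient over the cell (\<open>weak_partial_halves\<close>). As the cells keep bounded
proportions, \<open>l\<close> is comparable to the \<open>N\<close>-th root of the volume. Since \<open>p0 \<ge> q0\<close>, summing \<open>p0\<close>-th powers over
the cells gives
\<open>\<integral> |E\<^sub>k\<^sub>+\<^sub>1 f - E\<^sub>k f|^p0 \<le> const (2^-k)^\<delta> (\<integral> |\<nabla>f|^q0)^(p0/q0)\<close> with \<open>\<delta> = 1 + p0/N - p0/q0\<close>
(\<open>dyadic_increment\<close>). Subcriticality says exactly that \<open>\<delta> > 0\<close>, so the increments are summable and \<open>E\<^sub>m f\<close>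
converges to \<open>f\<close> in \<open>L^p0\<close> at a geometric rate that is uniform on bounded sets
(\<open>dyadic_average_tail\<close>). Each \<open>E\<^sub>m\<close> has finite rank, so boundedness and precompactness follow
(\<open>sobolev_ball_precompact\<close>).

The local results are added up over a finite cover (\<open>precompact_unit_sobolev\<close>). A diagonal argument produces a
subsequence that is Cauchy for the modular \<open>\<integral> |u|^p(x)\<close>, which is complete (\<open>modular_complete\<close>). Because
the exponents are bounded and at least one, bounds and convergence for the modular amount to bounds and convergence
for the Luxemburg norm.\<close>

section \<open>Smooth functions of one real variable\<close>

text \<open>Stating the existence of a derivative, instead of iterating a derivative operator, makes each closure property
a short induction.\<close>

fun Ck_real :: "nat \<Rightarrow> (real \<Rightarrow> real) \<Rightarrow> bool" where
  "Ck_real 0 g \<longleftrightarrow> continuous_on UNIV g"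
| "Ck_real (Suc n) g \<longleftrightarrow> (\<exists>g'. (\<forall>t. (g has_real_derivative g' t) (at t)) \<and> Ck_real n g')"

lemma Ck_real_continuous: "Ck_real n g \<Longrightarrow> continuous_on UNIV g"
  by (cases n) (auto simp: continuous_on_eq_continuous_at intro: DERIV_isCont)

lemma Ck_real_SucI: "(\<And>t. (g has_real_derivative g' t) (at t)) \<Longrightarrow> Ck_real n g' \<Longrightarrow> Ck_real (Suc n) g"
  by auto

lemma Ck_real_SucD: "Ck_real (Suc n) g \<Longrightarrow> Ck_real n g"
proof (induction n arbitrary: g)
  case 0 then show ?case using Ck_real_continuous by (metis Ck_real.simps(1))
next
  case (Suc n) then show ?case by (metis Ck_real.simps(2))
qed

lemma Ck_real_const [simp]: "Ck_real n (\<lambda>t. c)"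
proof (induction n arbitrary: c)
  case (Suc n) then show ?case by (auto intro!: exI[of _ "\<lambda>t. 0"])
qed simp

lemma Ck_real_add: "Ck_real n f \<Longrightarrow> Ck_real n g \<Longrightarrow> Ck_real n (\<lambda>t. f t + g t)"
proof (induction n arbitrary: f g)
  case (Suc n)
  then obtain f' g' where "\<And>t. (f has_real_derivative f' t) (at t)" "Ck_real n f'"
    "\<And>t. (g has_real_derivative g' t) (at t)" "Ck_real n g'" by auto
  then have "((\<lambda>t. f t + g t) has_real_derivative f' t + g' t) (at t)" "Ck_real n (\<lambda>t. f' t + g' t)" for t
    using Suc.IH by (auto intro: DERIV_add)
  then show ?case by (rule Ck_real_SucI)
qed (auto intro: continuous_intros)

lemma Ck_real_mult: "Ck_real n f \<Longrightarrow> Ck_real n g \<Longrightarrow> Ck_real n (\<lambda>t. f t * g t)"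
proof (induction n arbitrary: f g)
  case (Suc n)
  then obtain f' g' where *: "\<And>t. (f has_real_derivative f' t) (at t)" "Ck_real n f'"
    "\<And>t. (g has_real_derivative g' t) (at t)" "Ck_real n g'" by auto
  have "Ck_real n f" "Ck_real n g" using Suc.prems Ck_real_SucD by blast+
  then have "Ck_real n (\<lambda>t. f t * g' t + f' t * g t)"
    using Suc.IH * by (intro Ck_real_add) auto
  moreover have "((\<lambda>t. f t * g t) has_real_derivative f t * g' t + f' t * g t) (at t)" for t
    by (rule DERIV_mult'[OF *(1,3)])
  ultimately show ?case by (intro Ck_real_SucI)
qed (auto intro: continuous_intros)

lemma Ck_real_affine: "Ck_real n f \<Longrightarrow> Ck_real n (\<lambda>t. f (c * t + d))"
proof (induction n arbitrary: f)
  case 0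
  then have "continuous_on UNIV f" by simp
  then have "continuous_on UNIV (\<lambda>t. f (c * t + d))"
    by (rule continuous_on_compose2) (auto intro: continuous_intros)
  then show ?case by simp
next
  case (Suc n)
  then obtain f' where *: "\<And>t. (f has_real_derivative f' t) (at t)" "Ck_real n f'" by auto
  have "((\<lambda>t. f (c * t + d)) has_real_derivative f' (c * t + d) * c) (at t)" for t
    by (rule DERIV_chain2[OF *(1)]) (auto intro!: derivative_eq_intros)
  moreover have "Ck_real n (\<lambda>t. f' (c * t + d) * c)" using Suc.IH[OF *(2)] by (intro Ck_real_mult) auto
  ultimately show ?case by (rule Ck_real_SucI)
qed

lemma tendsto_poly_times_exp_minus: "((\<lambda>s. poly P s * exp (- s)) \<longlongrightarrow> (0::real)) at_top"
proof -
  have "((\<lambda>s. \<Sum>i\<le>degree P. coeff P i * (s ^ i / exp s)) \<longlongrightarrow> (\<Sum>i\<le>degree P. coeff P i * 0)) at_top"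
    by (intro tendsto_sum tendsto_mult tendsto_const tendsto_power_div_exp_0)
  then show ?thesis by (simp add: poly_altdef exp_minus sum_distrib_right divide_inverse mult.assoc)
qed

text \<open>For \<open>P = 1\<close> this is the classical smooth function that vanishes to infinite order at the origin. The whole family
is closed under differentiation, so that the smoothness of all its members can be proved by one induction.\<close>

definition flat :: "real poly \<Rightarrow> real \<Rightarrow> real" where
  "flat P t = (if t > 0 then poly P (1/t) * exp (- (1/t)) else 0)"

lemma flat_has_derivative:
  "(flat P has_real_derivative flat ((P - pderiv P) * [:0,0,1:]) t) (at t)"
proof -
  let ?P' = "(P - pderiv P) * [:0,0,1:]"
  consider "t < 0" | "t > 0" | "t = 0" by linarith
  then show ?thesis
  proof cases
    case 1
    have "((\<lambda>t. 0) has_real_derivative 0) (at t)" by simp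
    then have "(flat P has_real_derivative 0) (at t)"
      by (rule has_field_derivative_transform_within_open[where S="{..<0}"]) (use 1 in \<open>auto simp: flat_def\<close>)
    then show ?thesis using 1 by (simp add: flat_def)
  next
    case t: 2
    have "((\<lambda>t. poly P (1/t) * exp (- (1/t))) has_real_derivative poly ?P' (1/t) * exp (- (1/t))) (at t)"
    proof -
      have d: "((\<lambda>t. 1/t) has_real_derivative - 1/t\<^sup>2) (at t)"
        using t by (auto intro!: derivative_eq_intros simp: power2_eq_square)
      have "((\<lambda>t. poly P (1/t)) has_real_derivative poly (pderiv P) (1/t) * (- 1/t\<^sup>2)) (at t)"
        by (rule DERIV_chain2[OF poly_DERIV d])
      moreover have "((\<lambda>t. exp (- (1/t))) has_real_derivative exp (- (1/t)) * - (- 1/t\<^sup>2)) (at t)"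
        by (rule DERIV_chain2[OF DERIV_exp DERIV_minus[OF d]])
      ultimately show ?thesis
        by (rule DERIV_mult'[THEN DERIV_cong]) (simp add: power2_eq_square algebra_simps diff_divide_distrib add_divide_distrib)
    qed
    then have "(flat P has_real_derivative poly ?P' (1/t) * exp (- (1/t))) (at t)"
      by (rule has_field_derivative_transform_within_open[where S="{0<..}"]) (use t in \<open>auto simp: flat_def\<close>)
    then show ?thesis using t by (simp add: flat_def)
  next
    case t: 3
    \<comment> \<open>the difference quotient at \<open>0\<close> is \<open>s P(s) exp(-s)\<close> with \<open>s = 1/h\<close>\<close>
    have "((\<lambda>s. poly (pCons 0 P) s * exp (- s)) \<longlongrightarrow> 0) at_top" by (rule tendsto_poly_times_exp_minus)
    then have "((\<lambda>h. poly (pCons 0 P) (inverse h) * exp (- inverse h)) \<longlongrightarrow> 0) (at_right 0)"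
      by (rule filterlim_compose) (rule filterlim_inverse_at_top_right)
    then have "((\<lambda>h. (flat P (0 + h) - flat P 0) / h) \<longlongrightarrow> 0) (at_right 0)"
      by (rule Lim_transform_eventually)
         (auto simp: eventually_at_filter divide_inverse flat_def intro!: always_eventually)
    moreover have "((\<lambda>h. (flat P (0 + h) - flat P 0) / h) \<longlongrightarrow> 0) (at_left 0)"
      by (rule Lim_transform_eventually[OF tendsto_const])
         (auto simp: eventually_at_filter flat_def intro!: always_eventually)
    ultimately have "((\<lambda>h. (flat P (0 + h) - flat P 0) / h) \<longlongrightarrow> 0) (at 0)"
      using filterlim_split_at by blast
    then show ?thesis using t by (simp add: DERIV_def flat_def)
  qed
qed

lemma Ck_real_flat: "Ck_real n (flat P)"
proof (induction n arbitrary: P)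
  case 0
  show ?case using DERIV_isCont[OF flat_has_derivative] by (simp add: continuous_on_eq_continuous_at)
next
  case (Suc n) then show ?case by (intro Ck_real_SucI[OF flat_has_derivative])
qed

text \<open>Smooth approximations of the indicator of the open interval from below; each one has compact support inside it.\<close>

definition cutoffs :: "real \<Rightarrow> real \<Rightarrow> (nat \<Rightarrow> real \<Rightarrow> real) \<Rightarrow> bool" where
  "cutoffs a b \<beta> \<longleftrightarrow> (\<forall>K n. Ck_real n (\<beta> K)) \<and> (\<forall>K t. 0 \<le> \<beta> K t) \<and> (\<forall>K t. \<beta> K t \<le> 1) \<and>
     (\<forall>K. \<exists>a' b'. a < a' \<and> b' < b \<and> (\<forall>t. \<beta> K t \<noteq> 0 \<longrightarrow> a' \<le> t \<and> t \<le> b')) \<and>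
     (\<forall>t. (\<lambda>K. \<beta> K t) \<longlonglongrightarrow> indicator {a<..<b} t)"

lemma cutoffsD:
  assumes "cutoffs a b \<beta>"
  shows "Ck_real n (\<beta> K)" "0 \<le> \<beta> K t" "\<beta> K t \<le> 1"
    "\<exists>a' b'. a < a' \<and> b' < b \<and> (\<forall>t. \<beta> K t \<noteq> 0 \<longrightarrow> a' \<le> t \<and> t \<le> b')"
    "(\<lambda>K. \<beta> K t) \<longlonglongrightarrow> indicator {a<..<b} t"
  using assms unfolding cutoffs_def by blast+

text \<open>With \<open>e(t) = exp(-1/t)\<close> for \<open>t > 0\<close> and \<open>e(t) = 0\<close> otherwise, the product \<open>e(K(t-a)-1) e(K(b-t)-1)\<close> tends to \<open>1\<close> on the interval because \<open>e\<close> tends to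
\<open>1\<close> at infinity. The shift by \<open>1\<close> in the arguments keeps the supports away from the end points.\<close>

lemma cutoffs_exist:
  assumes "a < (b::real)"
  shows "\<exists>\<beta>. cutoffs a b \<beta>"
proof -
  define e where "e = flat 1"
  have e: "0 \<le> e t" "e t \<le> 1" "t \<le> 0 \<Longrightarrow> e t = 0" for t by (auto simp: e_def flat_def)
  have e1: "(e \<longlongrightarrow> 1) at_top"
  proof -
    have "((\<lambda>t::real. exp (- (1/t))) \<longlongrightarrow> exp (- 0)) at_top"
      by (intro tendsto_intros tendsto_divide_0[OF tendsto_const] filterlim_at_top_imp_at_infinity filterlim_ident)
    then have "((\<lambda>t::real. exp (- (1/t))) \<longlongrightarrow> 1) at_top" by simp
    then show ?thesis
      by (rule Lim_transform_eventually) (use eventually_gt_at_top[of 0] in eventually_elim, auto simp: e_def flat_def)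
  qed
  define \<beta> where "\<beta> K t = e (real (Suc K) * (t - a) - 1) * e (real (Suc K) * (b - t) - 1)" for K t
  have "cutoffs a b \<beta>"
    unfolding cutoffs_def
  proof (intro conjI allI)
    show "Ck_real n (\<beta> K)" for n K
    proof -
      have "Ck_real n (\<lambda>t. e (real (Suc K) * t + (- real (Suc K) * a - 1)))" "Ck_real n (\<lambda>t. e ((-real (Suc K)) * t + (real (Suc K) * b - 1)))"
        unfolding e_def by (rule Ck_real_affine[OF Ck_real_flat])+
      from Ck_real_mult[OF this] show ?thesis by (simp add: \<beta>_def[abs_def] algebra_simps)
    qed
    show "0 \<le> \<beta> K t" "\<beta> K t \<le> 1" for K t unfolding \<beta>_def by (auto intro!: mult_nonneg_nonneg mult_le_one e)
    show "\<exists>a' b'. a < a' \<and> b' < b \<and> (\<forall>t. \<beta> K t \<noteq> 0 \<longrightarrow> a' \<le> t \<and> t \<le> b')" for K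
    proof (intro exI conjI allI impI)
      show "a < a + 1 / real (Suc K)" "b - 1 / real (Suc K) < b" by auto
      fix t assume "\<beta> K t \<noteq> 0"
      then have "\<not> real (Suc K) * (t - a) - 1 \<le> 0" "\<not> real (Suc K) * (b - t) - 1 \<le> 0"
        using e(3) by (auto simp: \<beta>_def simp del: of_nat_Suc)
      then show "a + 1 / real (Suc K) \<le> t" "t \<le> b - 1 / real (Suc K)"
        by (auto simp: field_simps simp del: of_nat_Suc)
    qed
    show "(\<lambda>K. \<beta> K t) \<longlonglongrightarrow> indicator {a<..<b} t" for t
    proof (cases "a < t \<and> t < b")
      case True
      have *: "(\<lambda>K. e (real (Suc K) * s - 1)) \<longlonglongrightarrow> 1" if "s > 0" for s
      proof (rule filterlim_compose[OF e1])
        have "filterlim (\<lambda>K. s * real (Suc K)) at_top sequentially"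
          by (intro filterlim_tendsto_pos_mult_at_top[OF tendsto_const that]
              filterlim_compose[OF filterlim_real_sequentially filterlim_Suc])
        then have "filterlim (\<lambda>K. -1 + s * real (Suc K)) at_top sequentially"
          by (rule filterlim_tendsto_add_at_top[OF tendsto_const])
        then show "filterlim (\<lambda>K. real (Suc K) * s - 1) at_top sequentially" by (simp add: mult.commute add.commute del: of_nat_Suc)
      qed
      have "(\<lambda>K. \<beta> K t) \<longlonglongrightarrow> 1 * 1" unfolding \<beta>_def using True by (intro tendsto_mult *) auto
      then show ?thesis using True by simp
    next
      case False
      then have "\<beta> K t = 0" for K
      proof -
        have "t - a \<le> 0 \<or> b - t \<le> 0" using False by auto
        then have "real (Suc K) * (t - a) - 1 \<le> 0 \<or> real (Suc K) * (b - t) - 1 \<le> 0"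
          using mult_nonneg_nonpos[of "real (Suc K)"] by fastforce
        then show ?thesis using e(3) by (auto simp: \<beta>_def simp del: of_nat_Suc)
      qed
      then show ?thesis using False by simp
    qed
  qed
  then show ?thesis by blast
qed

text \<open>In the direction of differentiation the test function has to be an antiderivative of a cutoff on \<open>(a,b)\<close> minus its
translate by \<open>l\<close>. The two masses cancel, so the antiderivative has compact support. In the limit it is the tent or
trapezoid with slopes \<open>1\<close> and \<open>-1\<close>, whose height is at most \<open>l\<close>.\<close>

definition shift_bumps :: "real \<Rightarrow> real \<Rightarrow> real \<Rightarrow> (nat \<Rightarrow> real \<Rightarrow> real) \<Rightarrow> (nat \<Rightarrow> real \<Rightarrow> real) \<Rightarrow> bool" where
  "shift_bumps a b l \<psi> \<psi>' \<longleftrightarrow> (\<forall>K n. Ck_real n (\<psi> K)) \<and> (\<forall>K n. Ck_real n (\<psi>' K)) \<and>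
    (\<forall>K t. (\<psi> K has_real_derivative \<psi>' K t) (at t)) \<and>
    (\<forall>K t. 0 \<le> \<psi> K t) \<and> (\<forall>K t. \<psi> K t \<le> l) \<and> (\<forall>K t. \<bar>\<psi>' K t\<bar> \<le> 1) \<and>
    (\<forall>K t. \<psi>' K t \<noteq> 0 \<longrightarrow> a < t \<and> t < b + l) \<and>
    (\<forall>K. \<exists>a' b'. a < a' \<and> b' < b + l \<and> (\<forall>t. \<psi> K t \<noteq> 0 \<longrightarrow> a' \<le> t \<and> t \<le> b')) \<and>
    (\<forall>t. (\<lambda>K. \<psi>' K t) \<longlonglongrightarrow> indicator {a<..<b} t - indicator {a+l<..<b+l} t)"

lemma shift_bumpsD:
  assumes "shift_bumps a b l \<psi> \<psi>'"
  shows "Ck_real n (\<psi> K)" "Ck_real n (\<psi>' K)" "(\<psi> K has_real_derivative \<psi>' K t) (at t)"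
    "0 \<le> \<psi> K t" "\<psi> K t \<le> l" "\<bar>\<psi>' K t\<bar> \<le> 1" "\<psi>' K t \<noteq> 0 \<Longrightarrow> a < t \<and> t < b + l"
    "\<exists>a' b'. a < a' \<and> b' < b + l \<and> (\<forall>t. \<psi> K t \<noteq> 0 \<longrightarrow> a' \<le> t \<and> t \<le> b')"
    "(\<lambda>K. \<psi>' K t) \<longlonglongrightarrow> indicator {a<..<b} t - indicator {a+l<..<b+l} t"
  using assms unfolding shift_bumps_def by blast+

text \<open>If \<open>B\<close> is an antiderivative of the cutoff, then \<open>B(t) - B(t-l)\<close> is the required function: by the mean value theorem
it equals \<open>l\<close> times a value of the cutoff in \<open>(t-l, t)\<close>, which gives both its bounds and its support.\<close>

lemma shift_bumps_exist:
  assumes "a < (b::real)" "0 < l"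
  shows "\<exists>\<psi> \<psi>'. shift_bumps a b l \<psi> \<psi>'"
proof -
  obtain \<beta> where "cutoffs a b \<beta>" using cutoffs_exist[OF assms(1)] by blast
  note \<beta> = cutoffsD[OF this]
  have "\<exists>F. \<forall>t. (F has_real_derivative \<beta> K t) (at t)" for K
  proof -
    have c: "isCont (\<beta> K) t" for t
      using Ck_real_continuous[OF \<beta>(1)[of 0 K]] by (simp add: continuous_on_eq_continuous_at)
    have "\<exists>F. \<forall>t. -\<infinity> < ereal t \<longrightarrow> ereal t < \<infinity> \<longrightarrow> (F has_vector_derivative \<beta> K t) (at t)"
      by (rule einterval_antiderivative) (simp_all add: c)
    then show ?thesis by (simp add: has_real_derivative_iff_has_vector_derivative)
  qed
  then obtain B where B: "\<And>K t. (B K has_real_derivative \<beta> K t) (at t)" by metis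
  define \<psi> where "\<psi> K t = B K t - B K (t - l)" for K t
  define \<psi>' where "\<psi>' K t = \<beta> K t - \<beta> K (t - l)" for K t
  have dB: "((\<lambda>t. B K (t - l)) has_real_derivative \<beta> K (t - l)) (at t)" for K t
  proof -
    have "((\<lambda>t. t - l) has_real_derivative 1) (at t)" by (auto intro!: derivative_eq_intros)
    then show ?thesis using DERIV_chain2[of "B K" "\<beta> K (t - l)" "\<lambda>t. t - l" t 1 UNIV] B by simp
  qed
  have d: "(\<psi> K has_real_derivative \<psi>' K t) (at t)" for K t
    unfolding \<psi>_def[abs_def] \<psi>'_def by (rule DERIV_diff[OF B dB])
  have mv: "\<exists>z. t - l < z \<and> z < t \<and> \<psi> K t = l * \<beta> K z" for K t
    using MVT2[of "t - l" t "B K" "\<beta> K", OF _ B] assms(2) by (simp add: \<psi>_def)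
  have C': "Ck_real n (\<psi>' K)" for n K
  proof -
    have "Ck_real n (\<lambda>t. \<beta> K t + (-1) * \<beta> K (1 * t + (- l)))"
      by (intro Ck_real_add Ck_real_mult Ck_real_const Ck_real_affine \<beta>(1))
    then show ?thesis by (simp add: \<psi>'_def[abs_def])
  qed
  have "shift_bumps a b l \<psi> \<psi>'"
    unfolding shift_bumps_def
  proof (intro conjI allI impI)
    show "Ck_real n (\<psi> K)" for n K using Ck_real_SucD[OF Ck_real_SucI[OF d C']] .
    show "Ck_real n (\<psi>' K)" for n K by (rule C')
    show "(\<psi> K has_real_derivative \<psi>' K t) (at t)" for K t by (rule d)
    show "0 \<le> \<psi> K t" for K t using mv[of t K] \<beta>(2) assms(2) by auto
    show "\<psi> K t \<le> l" for K t using mv[of t K] \<beta>(3) assms(2) by (auto simp: mult_left_le)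
    show "\<bar>\<psi>' K t\<bar> \<le> 1" for K t
      using \<beta>(2)[of K t] \<beta>(3)[of K t] \<beta>(2)[of K "t - l"] \<beta>(3)[of K "t - l"] unfolding \<psi>'_def by linarith
    fix K t assume that: "\<psi>' K t \<noteq> 0"
    have "a < t \<and> t < b + l"
    proof -
      have "\<beta> K t \<noteq> 0 \<or> \<beta> K (t - l) \<noteq> 0" using that by (auto simp: \<psi>'_def)
      then show ?thesis using \<beta>(4)[of K] assms by fastforce
    qed
    then show "a < t" "t < b + l" by auto
  next
    show "\<exists>a' b'. a < a' \<and> b' < b + l \<and> (\<forall>t. \<psi> K t \<noteq> 0 \<longrightarrow> a' \<le> t \<and> t \<le> b')" for K
    proof -
      obtain a' b' where ab: "a < a'" "b' < b" "\<And>t. \<beta> K t \<noteq> 0 \<Longrightarrow> a' \<le> t \<and> t \<le> b'" using \<beta>(4) by metis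
      have "a' \<le> t \<and> t \<le> b' + l" if nz: "\<psi> K t \<noteq> 0" for t
      proof -
        obtain z where z: "t - l < z" "z < t" "\<psi> K t = l * \<beta> K z" using mv by blast
        then have "\<beta> K z \<noteq> 0" using nz by auto
        then show ?thesis using ab(3)[of z] z by auto
      qed
      then show ?thesis using ab by (intro exI[of _ a'] exI[of _ "b' + l"]) auto
    qed
    show "(\<lambda>K. \<psi>' K t) \<longlonglongrightarrow> indicator {a<..<b} t - indicator {a+l<..<b+l} t" for t
    proof -
      have "(\<lambda>K. \<psi>' K t) \<longlonglongrightarrow> indicator {a<..<b} t - indicator {a<..<b} (t - l)"
        unfolding \<psi>'_def by (intro tendsto_diff \<beta>(5))
      moreover have "indicator {a<..<b} (t - l) = (indicator {a+l<..<b+l} t :: real)"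
        by (auto simp: indicator_def)
      ultimately show ?thesis by simp
    qed
  qed
  then show ?thesis by blast
qed

section \<open>Test functions of product form\<close>

lemma has_derivative_coordinate_product:
  fixes g g' :: "'n::finite \<Rightarrow> real \<Rightarrow> real"
  assumes "\<And>j t. (g j has_real_derivative g' j t) (at t)"
  shows "((\<lambda>x::real^'n. \<Prod>j\<in>UNIV. g j (x $ j)) has_derivative
     (\<lambda>h. \<Sum>i\<in>UNIV. g' i (x $ i) * h $ i * (\<Prod>j\<in>UNIV-{i}. g j (x $ j)))) (at x)"
proof (rule has_derivative_prod[THEN has_derivative_eq_rhs])
  fix j
  show "((\<lambda>x. g j (x $ j)) has_derivative (\<lambda>h. g' j (x $ j) * h $ j)) (at x)"
    using assms[of j "x $ j"] unfolding has_field_derivative_def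
    by (rule has_derivative_compose[rotated, of _ _ "\<lambda>x. x $ j"])
       (simp add: bounded_linear_imp_has_derivative bounded_linear_vec_nth)
qed simp

text \<open>Differentiating a product of functions of single coordinates replaces one factor by its derivative and again gives
such a product. This makes products of one-dimensional cutoffs into test functions.\<close>

lemma frechet_derivative_coordinate_product:
  fixes g g' :: "'n::finite \<Rightarrow> real \<Rightarrow> real"
  assumes "\<And>j t. (g j has_real_derivative g' j t) (at t)"
  shows "frechet_derivative (\<lambda>x::real^'n. \<Prod>j\<in>UNIV. g j (x $ j)) (at x) (axis i 1) =
     (\<Prod>j\<in>UNIV. (g(i := g' i)) j (x $ j))"
proof -
  have "frechet_derivative (\<lambda>x::real^'n. \<Prod>j\<in>UNIV. g j (x $ j)) (at x) =
     (\<lambda>h. \<Sum>i\<in>UNIV. g' i (x $ i) * h $ i * (\<Prod>j\<in>UNIV-{i}. g j (x $ j)))"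
    using has_derivative_coordinate_product[of g g', OF assms] by (rule frechet_derivative_at[symmetric])
  then have "frechet_derivative (\<lambda>x::real^'n. \<Prod>j\<in>UNIV. g j (x $ j)) (at x) (axis i 1) =
     (\<Sum>k\<in>UNIV. if k = i then g' i (x $ i) * (\<Prod>j\<in>UNIV-{i}. g j (x $ j)) else 0)"
    by (simp add: axis_def if_distrib[of "\<lambda>u. _ * u"] if_distrib[of "\<lambda>u. u * _"] cong: if_cong)
  also have "\<dots> = (\<Prod>j\<in>UNIV. (g(i := g' i)) j (x $ j))"
    by (subst prod.remove[of UNIV i]) (auto intro!: prod.cong)
  finally show ?thesis .
qed

lemma Ck_on_coordinate_product:
  fixes g :: "'n::finite \<Rightarrow> real \<Rightarrow> real"
  assumes "\<And>j. Ck_real k (g j)"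
  shows "Ck_on k (\<lambda>x::real^'n. \<Prod>j\<in>UNIV. g j (x $ j)) UNIV"
  using assms
proof (induction k arbitrary: g)
  case 0
  have "continuous_on UNIV (\<lambda>x::real^'n. g j (x $ j))" for j
    by (rule continuous_on_compose2[of UNIV "g j"]) (use 0 in \<open>auto intro: continuous_on_component\<close>)
  then show ?case by (simp add: continuous_on_prod)
next
  case (Suc k)
  then have "\<forall>j. \<exists>g'. (\<forall>t. (g j has_real_derivative g' t) (at t)) \<and> Ck_real k g'" by simp
  then obtain g' where g': "\<And>j t. (g j has_real_derivative g' j t) (at t)" "\<And>j. Ck_real k (g' j)" by metis
  have "(\<lambda>x::real^'n. \<Prod>j\<in>UNIV. g j (x $ j)) differentiable_on UNIV"
    using has_derivative_coordinate_product[of g g', OF g'(1)]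
    by (auto simp: differentiable_on_def differentiable_def)
  moreover have "Ck_on k (\<lambda>x::real^'n. \<Prod>j\<in>UNIV. (g(i := g' i)) j (x $ j)) UNIV" for i
  proof (rule Suc.IH)
    show "Ck_real k ((g(i := g' i)) j)" for j using g'(2) Ck_real_SucD[OF Suc.prems] by (cases "j = i") auto
  qed
  ultimately show ?case
    by (simp only: Ck_on.simps frechet_derivative_coordinate_product[of g g', OF g'(1)]) blast
qed

lemma smooth_on_coordinate_product:
  fixes g :: "'n::finite \<Rightarrow> real \<Rightarrow> real"
  assumes "\<And>k j. Ck_real k (g j)"
  shows "smooth_on UNIV (\<lambda>x::real^'n. \<Prod>j\<in>UNIV. g j (x $ j))"
  unfolding smooth_on_def using Ck_on_coordinate_product[of _ g, OF assms] open_UNIV by blast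

section \<open>Comparing the two halves of a box\<close>

definition vec_upd :: "real^'n \<Rightarrow> 'n \<Rightarrow> real \<Rightarrow> real^'n" where
  "vec_upd x i t = (\<chi> j. if j = i then t else x $ j)"

lemma vec_upd_nth [simp]: "vec_upd x i t $ j = (if j = i then t else x $ j)"
  by (simp add: vec_upd_def)

lemma prod_01:
  fixes f :: "'i \<Rightarrow> real"
  assumes "\<And>j. j \<in> A \<Longrightarrow> \<bar>f j\<bar> \<le> 1"
  shows "\<bar>\<Prod>j\<in>A. f j\<bar> \<le> 1"
  unfolding abs_prod using assms by (intro prod_le_1) auto

text \<open>The only place where weak derivatives enter the Euclidean argument. The test function is a shift bump in direction
\<open>i\<close>, with shift \<open>l\<close> equal to half the side, times cutoffs in the other coordinates. Its derivative tends to
the indicator of the lower half minus that of the upper half, while its size never exceeds \<open>l\<close>.\<close>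

lemma weak_partial_halves:
  fixes f g h :: "real^'n::finite \<Rightarrow> real"
  assumes wp: "weak_partial \<Omega> i f h" and sub: "box a b \<subseteq> \<Omega>" and ab: "\<And>j. a $ j < b $ j"
    and f: "set_integrable lborel (box a b) f" and g: "set_integrable lborel (box a b) g"
    and hg: "\<And>x. x \<in> box a b \<Longrightarrow> \<bar>h x\<bar> \<le> g x"
    and m: "m = (a $ i + b $ i) / 2"
  shows "\<bar>(LINT x:box a (vec_upd b i m)|lborel. f x) - (LINT x:box (vec_upd a i m) b|lborel. f x)\<bar>
     \<le> (b $ i - a $ i) / 2 * (LINT x:box a b|lborel. g x)"
proof -
  define l where "l = (b $ i - a $ i) / 2"
  have ml: "a $ i < m" "0 < l" "m + l = b $ i" "a $ i + l = m" using ab[of i] by (auto simp: m l_def field_simps)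
  obtain \<psi> \<psi>' where "shift_bumps (a $ i) m l \<psi> \<psi>'" using shift_bumps_exist[OF ml(1,2)] by blast
  note \<psi> = shift_bumpsD[OF this, unfolded ml]
  have "\<forall>j. \<exists>\<kappa>. cutoffs (a $ j) (b $ j) \<kappa>" using cutoffs_exist[OF ab] by blast
  then obtain \<kappa> where "\<And>j. cutoffs (a $ j) (b $ j) (\<kappa> j)" by metis
  note \<kappa> = cutoffsD[OF this]
  have "\<forall>j K. \<exists>d. \<forall>t. (\<kappa> j K has_real_derivative d t) (at t)" using \<kappa>(1) Ck_real.simps(2) by metis
  then obtain d\<kappa> where d\<kappa>: "\<And>j K t. (\<kappa> j K has_real_derivative d\<kappa> j K t) (at t)" by metis
  define G where "G K j = (if j = i then \<psi> K else \<kappa> j K)" for K j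
  define G' where "G' K j = (if j = i then \<psi>' K else d\<kappa> j K)" for K j
  define \<eta> where "\<eta> K x = (\<Prod>j\<in>UNIV. G K j (x $ j))" for K and x :: "real^'n"
  define D where "D K x = (\<Prod>j\<in>UNIV. ((G K)(i := \<psi>' K)) j (x $ j))" for K and x :: "real^'n"
  have D: "frechet_derivative (\<eta> K) (at x) (axis i 1) = D K x" for K x
  proof -
    have "frechet_derivative (\<eta> K) (at x) (axis i 1) = (\<Prod>j\<in>UNIV. ((G K)(i := G' K i)) j (x $ j))"
      unfolding \<eta>_def[abs_def]
    proof (rule frechet_derivative_coordinate_product)
      show "(G K j has_real_derivative G' K j t) (at t)" for j t
        using \<psi>(3)[of K t] d\<kappa>[of j K t] unfolding G_def G'_def by (cases "j = i") simp_all
    qed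
    then show ?thesis by (simp add: D_def G'_def)
  qed
  have D_eq: "D K x = \<psi>' K (x $ i) * (\<Prod>j\<in>UNIV-{i}. \<kappa> j K (x $ j))" for K x
    unfolding D_def by (subst prod.remove[of UNIV i]) (auto simp: G_def intro!: prod.cong)
  have \<eta>_eq: "\<eta> K x = \<psi> K (x $ i) * (\<Prod>j\<in>UNIV-{i}. \<kappa> j K (x $ j))" for K x
    unfolding \<eta>_def by (subst prod.remove[of UNIV i]) (auto simp: G_def intro!: prod.cong)
  have \<kappa>supp: "a $ j < t \<and> t < b $ j" if "\<kappa> j K t \<noteq> 0" for j K t
    using \<kappa>(4)[of j K] that by fastforce
  have Dsupp: "x \<in> box a b" if "D K x \<noteq> 0" for K x
  proof -
    have "\<psi>' K (x $ i) \<noteq> 0" "\<And>j. j \<noteq> i \<Longrightarrow> \<kappa> j K (x $ j) \<noteq> 0" using that by (auto simp: D_eq)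
    then show ?thesis using \<psi>(7) \<kappa>supp unfolding mem_box_cart by metis
  qed
  have \<eta>supp: "\<exists>a' b'. (\<forall>j. a $ j < a' $ j \<and> b' $ j < b $ j) \<and> {x. \<eta> K x \<noteq> 0} \<subseteq> cbox a' b'" for K
  proof -
    have "\<forall>j. \<exists>a' b'. a $ j < a' \<and> b' < b $ j \<and> (\<forall>t. G K j t \<noteq> 0 \<longrightarrow> a' \<le> t \<and> t \<le> b')"
      using \<psi>(8)[of K] \<kappa>(4)[of _ K] by (simp add: G_def)
    then obtain a' b' where *: "\<And>j. a $ j < a' j \<and> b' j < b $ j \<and> (\<forall>t. G K j t \<noteq> 0 \<longrightarrow> a' j \<le> t \<and> t \<le> b' j)"
      by metis
    then show ?thesis
      by (intro exI[of _ "vec_lambda a'"] exI[of _ "vec_lambda b'"]) (auto simp: \<eta>_def mem_box_cart)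
  qed
  have \<eta>supp': "x \<in> box a b" if "\<eta> K x \<noteq> 0" for K x
  proof -
    obtain a' b' where *: "\<forall>j. a $ j < a' $ j \<and> b' $ j < b $ j" "{x. \<eta> K x \<noteq> 0} \<subseteq> cbox a' b'"
      using \<eta>supp[of K] by (elim exE conjE)
    have "x \<in> cbox a' b'" using *(2) that by (simp add: subset_eq)
    then show ?thesis using *(1) by (simp add: mem_box_cart) (smt (verit))
  qed
  have tf: "test_function \<Omega> (\<eta> K)" for K
  proof -
    obtain a' b' where *: "\<forall>j. a $ j < a' $ j \<and> b' $ j < b $ j" "{x. \<eta> K x \<noteq> 0} \<subseteq> cbox a' b'"
      using \<eta>supp[of K] by (elim exE conjE)
    have cl: "closure {x. \<eta> K x \<noteq> 0} \<subseteq> cbox a' b'" using *(2) closed_cbox by (rule closure_minimal)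
    have "cbox a' b' \<subseteq> box a b"
    proof
      fix x assume "x \<in> cbox a' b'"
      then show "x \<in> box a b" using *(1) by (simp add: mem_box_cart) (smt (verit))
    qed
    then have "closure {x. \<eta> K x \<noteq> 0} \<subseteq> \<Omega>" using cl sub by blast
    moreover have "compact (closure {x. \<eta> K x \<noteq> 0})"
      using cl compact_cbox closed_closure by (meson compact_eq_bounded_closed bounded_subset)
    moreover have "smooth_on UNIV (\<eta> K)"
      unfolding \<eta>_def[abs_def] by (rule smooth_on_coordinate_product) (simp add: G_def \<psi>(1) \<kappa>(1))
    ultimately show ?thesis by (simp add: test_function_def)
  qed
  have \<eta>b: "\<bar>\<eta> K x\<bar> \<le> l" for K x
  proof -
    have "\<bar>\<eta> K x\<bar> = \<bar>\<psi> K (x $ i)\<bar> * \<bar>\<Prod>j\<in>UNIV-{i}. \<kappa> j K (x $ j)\<bar>" by (simp add: \<eta>_eq abs_mult)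
    also have "\<dots> \<le> l * 1" using \<psi>(4,5) \<kappa>(2,3) ml by (intro mult_mono prod_01) auto
    finally show ?thesis by simp
  qed
  have Db: "\<bar>D K x\<bar> \<le> 1" for K x
    unfolding D_eq abs_mult using \<psi>(6) \<kappa>(2,3) by (intro mult_le_one prod_01) auto
  have Dm [measurable]: "D K \<in> borel_measurable borel" for K
  proof -
    have "Ck_on 0 (D K) UNIV"
      unfolding D_def[abs_def] by (rule Ck_on_coordinate_product) (auto simp: G_def \<psi>(1,2) \<kappa>(1) simp del: Ck_real.simps)
    then show ?thesis by (simp add: borel_measurable_continuous_onI)
  qed
  define fb where "fb x = indicator (box a b) x * f x" for x
  have fb: "integrable lborel fb" using f by (simp add: fb_def[abs_def] set_integrable_def)
  have bound: "\<bar>LINT x|lborel. fb x * D K x\<bar> \<le> l * (LINT x:box a b|lborel. g x)" for K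
  proof -
    have "(LINT x|lborel. fb x * D K x) = (LINT x:\<Omega>|lborel. f x * frechet_derivative (\<eta> K) (at x) (axis i 1))"
      unfolding set_lebesgue_integral_def D
      by (rule Bochner_Integration.integral_cong) (use Dsupp sub in \<open>auto simp: fb_def indicator_def\<close>)
    also have "\<dots> = - (LINT x:\<Omega>|lborel. h x * \<eta> K x)"
      using wp tf unfolding weak_partial_def by blast
    finally have "\<bar>LINT x|lborel. fb x * D K x\<bar> = norm (LINT x:\<Omega>|lborel. h x * \<eta> K x)" by simp
    also have "\<dots> \<le> (LINT x|lborel. norm (indicator \<Omega> x *\<^sub>R (h x * \<eta> K x)))"
      unfolding set_lebesgue_integral_def by (rule integral_norm_bound)
    also have "\<dots> \<le> (LINT x|lborel. indicator (box a b) x *\<^sub>R (l * g x))"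
    proof (rule integral_mono')
      show "integrable lborel (\<lambda>x. indicator (box a b) x *\<^sub>R (l * g x))"
        using set_integrable_mult_right[OF g, of l] by (simp add: set_integrable_def)
      show "norm (indicator \<Omega> x *\<^sub>R (h x * \<eta> K x)) \<le> indicator (box a b) x *\<^sub>R (l * g x)" for x
      proof (cases "x \<in> box a b")
        case True
        have "\<bar>h x\<bar> * \<bar>\<eta> K x\<bar> \<le> g x * l"
          using hg[OF True] \<eta>b[of K x] by (intro mult_mono) auto
        then show ?thesis using True sub by (auto simp: abs_mult mult.commute)
      next
        case False then show ?thesis using \<eta>supp' by auto
      qed
      show "0 \<le> indicator (box a b) x *\<^sub>R (l * g x)" for x
        using hg[of x] ml(2) by (cases "x \<in> box a b") auto
    qed
    also have "\<dots> = l * (LINT x:box a b|lborel. g x)"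
      by (simp add: set_lebesgue_integral_def mult.left_commute)
    finally show ?thesis .
  qed
  let ?L = "box a (vec_upd b i m)" and ?U = "box (vec_upd a i m) b"
  have inL: "x \<in> ?L \<longleftrightarrow> x \<in> box a b \<and> x $ i < m" and inU: "x \<in> ?U \<longleftrightarrow> x \<in> box a b \<and> m < x $ i" for x
    using ml ab[of i] by (simp_all add: mem_box_cart) (smt (verit))+
  have lim: "(\<lambda>K. LINT x|lborel. fb x * D K x) \<longlonglongrightarrow> (LINT x|lborel. fb x * (indicator ?L x - indicator ?U x))"
  proof (rule integral_dominated_convergence[where w="\<lambda>x. norm (fb x)"])
    show "integrable lborel (\<lambda>x. norm (fb x))" using fb by simp
    show "(\<lambda>x. fb x * (indicator ?L x - indicator ?U x)) \<in> borel_measurable lborel"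
      using fb by (intro borel_measurable_times borel_measurable_diff) auto
    show "(\<lambda>x. fb x * D K x) \<in> borel_measurable lborel" for K using fb by auto
    show "AE x in lborel. norm (fb x * D K x) \<le> norm (fb x)" for K
      using Db by (auto simp: abs_mult mult_left_le)
    show "AE x in lborel. (\<lambda>K. fb x * D K x) \<longlonglongrightarrow> fb x * (indicator ?L x - indicator ?U x)"
    proof (rule AE_I2)
      fix x
      have "(\<lambda>K. D K x) \<longlonglongrightarrow> (indicator {a $ i<..<m} (x $ i) - indicator {m<..<b $ i} (x $ i)) *
         (\<Prod>j\<in>UNIV-{i}. indicator {a $ j<..<b $ j} (x $ j))"
        unfolding D_eq by (intro tendsto_mult tendsto_prod \<psi>(9) \<kappa>(5))
      also have "(indicator {a $ i<..<m} (x $ i) - indicator {m<..<b $ i} (x $ i)) *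
         (\<Prod>j\<in>UNIV-{i}. indicator {a $ j<..<b $ j} (x $ j)) = indicator ?L x - (indicator ?U x :: real)"
      proof (cases "\<forall>j\<in>UNIV-{i}. a $ j < x $ j \<and> x $ j < b $ j")
        case True
        then have "(\<Prod>j\<in>UNIV-{i}. indicator {a $ j<..<b $ j} (x $ j)) = (1::real)" by (intro prod.neutral) auto
        moreover have "x \<in> ?L \<longleftrightarrow> a $ i < x $ i \<and> x $ i < m" "x \<in> ?U \<longleftrightarrow> m < x $ i \<and> x $ i < b $ i"
          using True by (auto simp: mem_box_cart)
        ultimately show ?thesis by (auto simp: indicator_def)
      next
        case False
        then have "(\<Prod>j\<in>UNIV-{i}. indicator {a $ j<..<b $ j} (x $ j)) = (0::real)"
          by (intro prod_zero) (auto simp: indicator_def)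
        moreover have "x \<notin> box a b" using False by (auto simp: mem_box_cart)
        ultimately show ?thesis using inL inU by auto
      qed
      finally show "(\<lambda>K. fb x * D K x) \<longlonglongrightarrow> fb x * (indicator ?L x - indicator ?U x)" by (intro tendsto_mult) auto
    qed
  qed
  have iL: "integrable lborel (\<lambda>x. indicator ?L x *\<^sub>R f x)" and iU: "integrable lborel (\<lambda>x. indicator ?U x *\<^sub>R f x)"
    using set_integrable_subset[OF f, of ?L] set_integrable_subset[OF f, of ?U] inL inU
    by (auto simp: set_integrable_def)
  have "(LINT x|lborel. fb x * (indicator ?L x - indicator ?U x)) = (LINT x|lborel. indicator ?L x *\<^sub>R f x - indicator ?U x *\<^sub>R f x)"
    by (rule Bochner_Integration.integral_cong) (auto simp: fb_def indicator_def inL inU)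
  also have "\<dots> = (LINT x:?L|lborel. f x) - (LINT x:?U|lborel. f x)"
    unfolding set_lebesgue_integral_def by (rule Bochner_Integration.integral_diff[OF iL iU])
  finally have e: "(LINT x|lborel. fb x * (indicator ?L x - indicator ?U x)) = (LINT x:?L|lborel. f x) - (LINT x:?U|lborel. f x)" .
  show ?thesis
    using LIMSEQ_le_const2[OF tendsto_rabs[OF lim]] bound unfolding e l_def by blast
qed

section \<open>Bisecting boxes across a longest side\<close>

text \<open>A cell is a box given by its two extreme corners.\<close>

type_synonym 'n cell = "(real^'n) \<times> (real^'n)"

abbreviation ibox :: "'n::finite cell \<Rightarrow> (real^'n) set" where
  "ibox B \<equiv> box (fst B) (snd B)"

definition side :: "'n::finite cell \<Rightarrow> 'n \<Rightarrow> real" where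
  "side B j = snd B $ j - fst B $ j"

definition vol :: "'n::finite cell \<Rightarrow> real" where
  "vol B = (\<Prod>j\<in>UNIV. side B j)"

definition long_axis :: "'n::finite cell \<Rightarrow> 'n" where
  "long_axis B = (SOME i. \<forall>j. side B j \<le> side B i)"

definition cut :: "'n::finite cell \<Rightarrow> real" where
  "cut B = (fst B $ long_axis B + snd B $ long_axis B) / 2"

definition lower :: "'n::finite cell \<Rightarrow> 'n cell" where
  "lower B = (fst B, vec_upd (snd B) (long_axis B) (cut B))"

definition upper :: "'n::finite cell \<Rightarrow> 'n cell" where
  "upper B = (vec_upd (fst B) (long_axis B) (cut B), snd B)"

text \<open>Sides that agree up to a factor \<open>2\<close>. Halving a longest side preserves this, so all descendants of a fat cell have
a diameter comparable to the \<open>N\<close>-th root of their volume.\<close>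

definition fat :: "'n::finite cell \<Rightarrow> bool" where
  "fat B \<longleftrightarrow> (\<forall>j. 0 < side B j) \<and> (\<forall>i j. side B i \<le> 2 * side B j)"

lemma side_le_long_axis: "side B j \<le> side B (long_axis B)"
proof -
  have "Max (range (side B)) \<in> range (side B)" by (rule Max_in) auto
  then obtain i where "side B i = Max (range (side B))" by (metis imageE)
  then have "\<forall>j. side B j \<le> side B i" by simp
  then have "\<forall>j. side B j \<le> side B (long_axis B)" unfolding long_axis_def by (rule someI)
  then show ?thesis by blast
qed

lemma fat_side_pos: "fat B \<Longrightarrow> 0 < side B j" by (simp add: fat_def)

lemma side_lower: "side (lower B) j = (if j = long_axis B then side B j / 2 else side B j)"
  and side_upper: "side (upper B) j = (if j = long_axis B then side B j / 2 else side B j)"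
  by (auto simp: side_def lower_def upper_def cut_def field_simps)

lemma vol_halved:
  assumes "\<And>j. side B' j = (if j = long_axis B then side B j / 2 else side B j)"
  shows "vol B' = vol B / 2"
  unfolding vol_def assms by (simp add: prod.remove[of UNIV "long_axis B"])

lemma vol_lower: "vol (lower B) = vol B / 2"
  and vol_upper: "vol (upper B) = vol B / 2"
  by (rule vol_halved[OF side_lower], rule vol_halved[OF side_upper])

lemma fat_halved:
  assumes "fat B" "\<And>j. side B' j = (if j = long_axis B then side B j / 2 else side B j)"
  shows "fat B'"
  unfolding fat_def assms(2)
proof (intro conjI allI)
  fix i j
  show "0 < (if j = long_axis B then side B j / 2 else side B j)" using fat_side_pos[OF assms(1)] by auto
  show "(if i = long_axis B then side B i / 2 else side B i) \<le> 2 * (if j = long_axis B then side B j / 2 else side B j)"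
    using assms(1) side_le_long_axis[of B i] fat_side_pos[OF assms(1), of "long_axis B"]
    unfolding fat_def by (smt (verit) field_sum_of_halves)
qed

lemma fat_lower: "fat B \<Longrightarrow> fat (lower B)" and fat_upper: "fat B \<Longrightarrow> fat (upper B)"
  by (erule fat_halved[OF _ side_lower], erule fat_halved[OF _ side_upper])

lemma vol_pos: "fat B \<Longrightarrow> 0 < vol B"
  by (simp add: vol_def fat_side_pos prod_pos)

lemma fat_side_le:
  fixes B :: "'n::finite cell"
  assumes "fat B"
  shows "side B j \<le> 2 * vol B powr (1 / real CARD('n))"
proof -
  have "(side B j / 2) ^ CARD('n) \<le> vol B"
  proof -
    have "(side B j / 2) ^ CARD('n) = (\<Prod>k\<in>(UNIV::'n set). side B j / 2)" by simp
    also have "\<dots> \<le> (\<Prod>k\<in>UNIV. side B k)"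
    proof (rule prod_mono)
      fix k
      have "side B j \<le> 2 * side B k" using assms unfolding fat_def by blast
      then show "0 \<le> side B j / 2 \<and> side B j / 2 \<le> side B k"
        using fat_side_pos[OF assms, of j] by simp
    qed
    finally show ?thesis by (simp add: vol_def)
  qed
  then have "((side B j / 2) ^ CARD('n)) powr (1 / real CARD('n)) \<le> vol B powr (1 / real CARD('n))"
    using fat_side_pos[OF assms, of j] by (intro powr_mono2) auto
  moreover have "((side B j / 2) ^ CARD('n)) powr (1 / real CARD('n)) = side B j / 2"
    using fat_side_pos[OF assms, of j] by (simp add: powr_realpow[symmetric] powr_powr)
  ultimately show ?thesis by simp
qed

lemma mem_lower: "fat B \<Longrightarrow> x \<in> ibox (lower B) \<longleftrightarrow> x \<in> ibox B \<and> x $ long_axis B < cut B"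
  and mem_upper: "fat B \<Longrightarrow> x \<in> ibox (upper B) \<longleftrightarrow> x \<in> ibox B \<and> cut B < x $ long_axis B"
proof -
  assume "fat B"
  then have "fst B $ long_axis B < cut B" "cut B < snd B $ long_axis B"
    using fat_side_pos[of B "long_axis B"] by (auto simp: cut_def side_def)
  then show "x \<in> ibox (lower B) \<longleftrightarrow> x \<in> ibox B \<and> x $ long_axis B < cut B"
    "x \<in> ibox (upper B) \<longleftrightarrow> x \<in> ibox B \<and> cut B < x $ long_axis B"
    by (simp_all add: lower_def upper_def mem_box_cart) (smt (verit))+
qed

lemma AE_hyperplane: "AE x in lborel. (x::real^'n::finite) $ i \<noteq> c"
proof -
  have "negligible {x::real^'n. x \<bullet> axis i 1 = c}"
    by (rule negligible_standard_hyperplane) (auto simp: Basis_vec_def)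
  then have "negligible {x::real^'n. x $ i = c}" by (simp add: inner_axis)
  moreover have "{x::real^'n. x $ i = c} \<in> sets borel"
    using closed_Collect_eq[of "\<lambda>x::real^'n. x $ i" "\<lambda>x. c"] by (simp add: continuous_on_component)
  ultimately have "{x::real^'n. x $ i = c} \<in> null_sets lborel"
    by (simp add: negligible_iff_null_sets null_sets_completion_iff)
  then show ?thesis by (rule AE_I') auto
qed

text \<open>The two halves miss only the cutting hyperplane, which is a null set.\<close>

lemma AE_indicator_split:
  assumes "fat B"
  shows "AE x in lborel. indicator (ibox B) x =
     indicator (ibox (lower B)) x + (indicator (ibox (upper B)) x :: 'b::semiring_1)"
  using AE_hyperplane[of "long_axis B" "cut B"]
  by (rule AE_mp) (intro AE_I2 impI, auto simp: indicator_def mem_lower[OF assms] mem_upper[OF assms])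

lemma nn_integral_split:
  fixes F :: "real^'n::finite \<Rightarrow> ennreal"
  assumes "fat B" and [measurable]: "F \<in> borel_measurable borel"
  shows "(\<integral>\<^sup>+x\<in>ibox B. F x \<partial>lborel) =
     (\<integral>\<^sup>+x\<in>ibox (lower B). F x \<partial>lborel) + (\<integral>\<^sup>+x\<in>ibox (upper B). F x \<partial>lborel)"
proof -
  have "(\<integral>\<^sup>+x\<in>ibox B. F x \<partial>lborel) =
    (\<integral>\<^sup>+x. F x * indicator (ibox (lower B)) x + F x * indicator (ibox (upper B)) x \<partial>lborel)"
    by (rule nn_integral_cong_AE, use AE_indicator_split[OF assms(1), where 'b=ennreal] in eventually_elim)
       (simp add: distrib_left)
  also have "\<dots> = (\<integral>\<^sup>+x\<in>ibox (lower B). F x \<partial>lborel) + (\<integral>\<^sup>+x\<in>ibox (upper B). F x \<partial>lborel)"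
    by (rule nn_integral_add) measurable
  finally show ?thesis .
qed

lemma set_integrable_lower:
  fixes f :: "real^'n::finite \<Rightarrow> real"
  shows "fat B \<Longrightarrow> set_integrable lborel (ibox B) f \<Longrightarrow> set_integrable lborel (ibox (lower B)) f"
  and set_integrable_upper:
  "fat B \<Longrightarrow> set_integrable lborel (ibox B) f \<Longrightarrow> set_integrable lborel (ibox (upper B)) f"
  by (erule set_integrable_subset; auto simp: mem_lower mem_upper)+

lemma set_integral_split:
  fixes f :: "real^'n::finite \<Rightarrow> real"
  assumes B: "fat B" and f: "set_integrable lborel (ibox B) f"
  shows "(LINT x:ibox B|lborel. f x) =
     (LINT x:ibox (lower B)|lborel. f x) + (LINT x:ibox (upper B)|lborel. f x)"
proof -
  note L = set_integrable_lower[OF assms] and U = set_integrable_upper[OF assms]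
  have "(LINT x:ibox B|lborel. f x) =
     (LINT x|lborel. indicator (ibox (lower B)) x *\<^sub>R f x + indicator (ibox (upper B)) x *\<^sub>R f x)"
    unfolding set_lebesgue_integral_def
  proof (rule integral_cong_AE)
    show "AE x in lborel. indicator (ibox B) x *\<^sub>R f x =
       indicator (ibox (lower B)) x *\<^sub>R f x + indicator (ibox (upper B)) x *\<^sub>R f x"
      using AE_indicator_split[OF B, where 'b=real] by eventually_elim (simp add: distrib_right)
  qed (use f L U in \<open>auto simp: set_integrable_def\<close>)
  then show ?thesis
    using L U by (simp add: set_lebesgue_integral_def set_integrable_def)
qed

lemma emeasure_cell:
  assumes "fat B"
  shows "emeasure lborel (ibox B) = ennreal (vol B)"
proof -
  have le: "fst B $ j \<le> snd B $ j" for j using fat_side_pos[OF assms, of j] by (simp add: side_def)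
  have ne: "cbox (fst B) (snd B) \<noteq> {}" by (simp add: interval_ne_empty_cart le)
  have "emeasure lborel (ibox B) = emeasure lborel (cbox (fst B) (snd B))"
    by (simp add: emeasure_lborel_box_eq emeasure_lborel_cbox_eq)
  also have "\<dots> = ennreal (measure lborel (cbox (fst B) (snd B)))"
    using emeasure_lborel_cbox_finite[of "fst B" "snd B"] by (intro emeasure_eq_ennreal_measure) auto
  also have "measure lborel (cbox (fst B) (snd B)) = vol B"
    using content_cbox_cart[OF ne] by (simp add: vol_def side_def)
  finally show ?thesis .
qed

lemma measure_cell: "fat B \<Longrightarrow> measure lborel (ibox B) = vol B"
  using emeasure_cell[of B] vol_pos[of B] by (simp add: measure_def)

lemma nn_integral_const_cell: "fat B \<Longrightarrow> (\<integral>\<^sup>+x\<in>ibox B. c \<partial>lborel) = c * ennreal (vol B)"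
  by (simp add: nn_integral_cmult_indicator emeasure_cell)

lemma set_integrable_const_cell: "fat B \<Longrightarrow> set_integrable lborel (ibox B) (\<lambda>x. c::real)"
  by (simp add: set_integrable_def emeasure_cell)

section \<open>Averages over the cells of a generation\<close>

definition average :: "(real^'n \<Rightarrow> real) \<Rightarrow> 'n::finite cell \<Rightarrow> real" where
  "average f B = (LINT x:ibox B|lborel. f x) / vol B"

text \<open>The conditional expectation of \<open>f\<close> with respect to the \<open>2^k\<close> cells obtained from \<open>B\<close> by \<open>k\<close> rounds of bisection.
Descending from the root lets every estimate be proved by induction on \<open>k\<close> for all cells at once, by adding
the estimates for the two halves, without naming the partition. Points on cutting hyperplanes follow the upper half;
they form a null set.\<close>

fun dyadic_average :: "nat \<Rightarrow> (real^'n \<Rightarrow> real) \<Rightarrow> 'n::finite cell \<Rightarrow> real^'n \<Rightarrow> real" where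
  "dyadic_average 0 f B x = average f B"
| "dyadic_average (Suc k) f B x =
     dyadic_average k f (if x $ long_axis B < cut B then lower B else upper B) x"

lemma dyadic_average_measurable [measurable]:
  fixes f :: "real^'n::finite \<Rightarrow> real"
  shows "dyadic_average k f B \<in> borel_measurable borel"
proof (induction k arbitrary: B)
  case 0 then show ?case by (simp cong: measurable_cong)
next
  case (Suc k)
  have [measurable]: "(\<lambda>x::real^'n. x $ long_axis B) \<in> borel_measurable borel"
    by (intro borel_measurable_continuous_onI continuous_on_component continuous_on_id)
  note [measurable] = Suc
  have "dyadic_average (Suc k) f B =
    (\<lambda>x. if x $ long_axis B < cut B then dyadic_average k f (lower B) x else dyadic_average k f (upper B) x)"
    by (auto simp: fun_eq_iff)
  then show ?case by simp
qed

lemma dyadic_average_lower: "fat B \<Longrightarrow> x \<in> ibox (lower B) \<Longrightarrow>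
    dyadic_average (Suc k) f B x = dyadic_average k f (lower B) x"
  and dyadic_average_upper: "fat B \<Longrightarrow> x \<in> ibox (upper B) \<Longrightarrow>
    dyadic_average (Suc k) f B x = dyadic_average k f (upper B) x"
  by (auto simp: mem_lower mem_upper)

lemma nn_integral_split_cong:
  fixes F G H :: "real^'n::finite \<Rightarrow> ennreal"
  assumes B: "fat B" and F: "F \<in> borel_measurable borel"
    and G: "\<And>x. x \<in> ibox (lower B) \<Longrightarrow> F x = G x"
    and H: "\<And>x. x \<in> ibox (upper B) \<Longrightarrow> F x = H x"
  shows "(\<integral>\<^sup>+x\<in>ibox B. F x \<partial>lborel) =
     (\<integral>\<^sup>+x\<in>ibox (lower B). G x \<partial>lborel) + (\<integral>\<^sup>+x\<in>ibox (upper B). H x \<partial>lborel)"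
proof -
  have "(\<integral>\<^sup>+x\<in>ibox (lower B). F x \<partial>lborel) = (\<integral>\<^sup>+x\<in>ibox (lower B). G x \<partial>lborel)"
    "(\<integral>\<^sup>+x\<in>ibox (upper B). F x \<partial>lborel) = (\<integral>\<^sup>+x\<in>ibox (upper B). H x \<partial>lborel)"
    by (rule nn_integral_cong; auto simp: indicator_def G H)+
  then show ?thesis using nn_integral_split[OF B F] by simp
qed

lemma nn_integral_split_le:
  fixes F G H :: "real^'n::finite \<Rightarrow> ennreal"
  assumes "fat B" "F \<in> borel_measurable borel"
    "\<And>x. x \<in> ibox (lower B) \<Longrightarrow> F x = G x" "\<And>x. x \<in> ibox (upper B) \<Longrightarrow> F x = H x"
    "(\<integral>\<^sup>+x\<in>ibox (lower B). G x \<partial>lborel) \<le> c" "(\<integral>\<^sup>+x\<in>ibox (upper B). H x \<partial>lborel) \<le> d"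
    "c + d \<le> e"
  shows "(\<integral>\<^sup>+x\<in>ibox B. F x \<partial>lborel) \<le> e"
  by (rule ord_eq_le_trans[OF nn_integral_split_cong[OF assms(1-4)] order_trans[OF add_mono[OF assms(5,6)] assms(7)]])

lemma nn_integral_set_le_const:
  fixes F :: "real^'n::finite \<Rightarrow> ennreal"
  assumes "fat B" "\<And>x. x \<in> ibox B \<Longrightarrow> F x \<le> c"
  shows "(\<integral>\<^sup>+x\<in>ibox B. F x \<partial>lborel) \<le> c * ennreal (vol B)"
  unfolding nn_integral_const_cell[OF assms(1), symmetric]
  by (intro nn_integral_mono) (auto simp: indicator_def assms(2))

lemma abs_set_integral_le:
  fixes f :: "real^'n::finite \<Rightarrow> real"
  assumes "set_integrable lborel S f"
  shows "ennreal \<bar>LINT x:S|lborel. f x\<bar> \<le> (\<integral>\<^sup>+x\<in>S. ennreal \<bar>f x\<bar> \<partial>lborel)"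
proof -
  have "ennreal \<bar>LINT x:S|lborel. f x\<bar> \<le> (\<integral>\<^sup>+x. ennreal (norm (indicator S x *\<^sub>R f x)) \<partial>lborel)"
    using integral_norm_bound_ennreal[OF assms[unfolded set_integrable_def]]
    by (simp add: set_lebesgue_integral_def)
  also have "\<dots> = (\<integral>\<^sup>+x\<in>S. ennreal \<bar>f x\<bar> \<partial>lborel)"
    by (rule nn_integral_cong) (auto simp: indicator_def)
  finally show ?thesis .
qed

text \<open>On one cell this is the triangle inequality for the integral of \<open>f - \<phi>\<close>; the cells are then added up.\<close>

lemma dyadic_average_contraction:
  fixes f \<phi> :: "real^'n::finite \<Rightarrow> real"
  assumes "fat B" "set_integrable lborel (ibox B) f" "set_integrable lborel (ibox B) \<phi>"
    and [measurable]: "f \<in> borel_measurable borel" "\<phi> \<in> borel_measurable borel"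
  shows "(\<integral>\<^sup>+x\<in>ibox B. ennreal \<bar>dyadic_average k f B x - dyadic_average k \<phi> B x\<bar> \<partial>lborel)
     \<le> (\<integral>\<^sup>+x\<in>ibox B. ennreal \<bar>f x - \<phi> x\<bar> \<partial>lborel)"
  using assms(1-3)
proof (induction k arbitrary: B)
  case 0
  have v: "vol B > 0" by (rule vol_pos[OF 0(1)])
  have "(\<integral>\<^sup>+x\<in>ibox B. ennreal \<bar>dyadic_average 0 f B x - dyadic_average 0 \<phi> B x\<bar> \<partial>lborel)
    = ennreal (\<bar>average f B - average \<phi> B\<bar> * vol B)"
    by (simp add: nn_integral_const_cell[OF 0(1)] ennreal_mult'' less_imp_le[OF v])
  also have "\<bar>average f B - average \<phi> B\<bar> * vol B = \<bar>LINT x:ibox B|lborel. f x - \<phi> x\<bar>"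
    using v 0 by (simp add: average_def set_integral_diff abs_divide diff_divide_distrib[symmetric])
  also have "ennreal \<dots> \<le> (\<integral>\<^sup>+x\<in>ibox B. ennreal \<bar>f x - \<phi> x\<bar> \<partial>lborel)"
    using 0 by (intro abs_set_integral_le set_integral_diff)
  finally show ?case .
next
  case (Suc k)
  show ?case
  proof (rule nn_integral_split_le[OF Suc.prems(1)])
    show "(\<lambda>x. ennreal \<bar>dyadic_average (Suc k) f B x - dyadic_average (Suc k) \<phi> B x\<bar>) \<in> borel_measurable borel"
      by measurable
    show "ennreal \<bar>dyadic_average (Suc k) f B x - dyadic_average (Suc k) \<phi> B x\<bar> = ennreal \<bar>dyadic_average k f (lower B) x - dyadic_average k \<phi> (lower B) x\<bar>"
      if "x \<in> ibox (lower B)" for x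
      by (simp only: dyadic_average_lower[OF Suc.prems(1) that])
    show "ennreal \<bar>dyadic_average (Suc k) f B x - dyadic_average (Suc k) \<phi> B x\<bar> = ennreal \<bar>dyadic_average k f (upper B) x - dyadic_average k \<phi> (upper B) x\<bar>"
      if "x \<in> ibox (upper B)" for x
      by (simp only: dyadic_average_upper[OF Suc.prems(1) that])
    show "(\<integral>\<^sup>+x\<in>ibox (lower B). ennreal \<bar>dyadic_average k f (lower B) x - dyadic_average k \<phi> (lower B) x\<bar> \<partial>lborel)
      \<le> (\<integral>\<^sup>+x\<in>ibox (lower B). ennreal \<bar>f x - \<phi> x\<bar> \<partial>lborel)"
      using Suc.prems by (intro Suc.IH fat_lower set_integrable_lower)
    show "(\<integral>\<^sup>+x\<in>ibox (upper B). ennreal \<bar>dyadic_average k f (upper B) x - dyadic_average k \<phi> (upper B) x\<bar> \<partial>lborel)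
      \<le> (\<integral>\<^sup>+x\<in>ibox (upper B). ennreal \<bar>f x - \<phi> x\<bar> \<partial>lborel)"
      using Suc.prems by (intro Suc.IH fat_upper set_integrable_upper)
    show "(\<integral>\<^sup>+x\<in>ibox (lower B). ennreal \<bar>f x - \<phi> x\<bar> \<partial>lborel) +
      (\<integral>\<^sup>+x\<in>ibox (upper B). ennreal \<bar>f x - \<phi> x\<bar> \<partial>lborel)
      \<le> (\<integral>\<^sup>+x\<in>ibox B. ennreal \<bar>f x - \<phi> x\<bar> \<partial>lborel)"
      using Suc.prems by (subst nn_integral_split[of B]) auto
  qed
qed

text \<open>On a cell of generation \<open>k\<close> a function differs from its average by at most its oscillation there, and the
sides of such a cell are bounded by \<open>2 (vol B / 2^k)^(1/N)\<close>.\<close>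

lemma dyadic_average_near_continuous:
  fixes \<phi> :: "real^'n::finite \<Rightarrow> real"
  assumes "fat B" "set_integrable lborel (ibox B) \<phi>" and [measurable]: "\<phi> \<in> borel_measurable borel"
    and "\<And>x y. x \<in> ibox B \<Longrightarrow> y \<in> ibox B \<Longrightarrow>
       (\<And>j. \<bar>x $ j - y $ j\<bar> \<le> 2 * (vol B / 2 ^ k) powr (1 / real CARD('n))) \<Longrightarrow> \<bar>\<phi> x - \<phi> y\<bar> \<le> \<omega>"
  shows "(\<integral>\<^sup>+x\<in>ibox B. ennreal \<bar>dyadic_average k \<phi> B x - \<phi> x\<bar> \<partial>lborel) \<le> ennreal (\<omega> * vol B)"
  using assms(1,2,4)
proof (induction k arbitrary: B)
  case 0
  have v: "vol B > 0" by (rule vol_pos[OF 0(1)])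
  have osc: "\<bar>\<phi> x - \<phi> y\<bar> \<le> \<omega>" if "x \<in> ibox B" "y \<in> ibox B" for x y
  proof (rule 0(3)[OF that])
    fix j
    have "\<bar>x $ j - y $ j\<bar> \<le> side B j"
      using that unfolding mem_box_cart side_def by (smt (verit))
    then show "\<bar>x $ j - y $ j\<bar> \<le> 2 * (vol B / 2 ^ 0) powr (1 / real CARD('n))"
      using fat_side_le[OF 0(1), of j] by simp
  qed
  have le: "\<bar>average \<phi> B - \<phi> x\<bar> \<le> \<omega>" if x: "x \<in> ibox B" for x
  proof -
    have c: "set_integrable lborel (ibox B) (\<lambda>y. \<phi> x)" using set_integrable_const_cell[OF 0(1)] .
    have "(LINT y:ibox B|lborel. \<phi> y - \<phi> x) = (LINT y:ibox B|lborel. \<phi> y) - vol B * \<phi> x"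
      using 0(2) c measure_cell[OF 0(1)] emeasure_cell[OF 0(1)] by (simp add: set_integral_diff(2) set_integral_const)
    then have "(average \<phi> B - \<phi> x) * vol B = (LINT y:ibox B|lborel. \<phi> y - \<phi> x)"
      using v by (simp add: average_def left_diff_distrib)
    then have "\<bar>average \<phi> B - \<phi> x\<bar> * vol B = \<bar>LINT y:ibox B|lborel. \<phi> y - \<phi> x\<bar>"
      using v by (metis abs_mult abs_of_pos)
    also have "ennreal \<dots> \<le> (\<integral>\<^sup>+y\<in>ibox B. ennreal \<bar>\<phi> y - \<phi> x\<bar> \<partial>lborel)"
      using 0(2) c by (intro abs_set_integral_le set_integral_diff)
    also have "\<dots> \<le> ennreal \<omega> * ennreal (vol B)"
      by (intro nn_integral_set_le_const[OF 0(1)] ennreal_leI osc x)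
    also have "\<dots> = ennreal (\<omega> * vol B)" by (simp add: ennreal_mult'' less_imp_le[OF v])
    finally have "\<bar>average \<phi> B - \<phi> x\<bar> * vol B \<le> \<omega> * vol B"
      using v osc[OF x x] by simp
    then show ?thesis using v by simp
  qed
  then have "(\<integral>\<^sup>+x\<in>ibox B. ennreal \<bar>dyadic_average 0 \<phi> B x - \<phi> x\<bar> \<partial>lborel) \<le> ennreal \<omega> * ennreal (vol B)"
    by (intro nn_integral_set_le_const[OF 0(1)] ennreal_leI) simp
  then show ?case by (simp add: ennreal_mult'' less_imp_le[OF v])
next
  case (Suc k)
  have "\<omega> \<ge> 0"
  proof -
    have "ibox B \<noteq> {}" using emeasure_cell[OF Suc.prems(1)] vol_pos[OF Suc.prems(1)] by auto
    then obtain x where "x \<in> ibox B" by blast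
    then show ?thesis using Suc.prems(3)[of x x] by simp
  qed
  have e: "vol B / 2 / 2 ^ k = vol B / 2 ^ Suc k" by simp
  show ?case
  proof (rule nn_integral_split_le[OF Suc.prems(1)])
    show "(\<lambda>x. ennreal \<bar>dyadic_average (Suc k) \<phi> B x - \<phi> x\<bar>) \<in> borel_measurable borel"
      by measurable
    show "ennreal \<bar>dyadic_average (Suc k) \<phi> B x - \<phi> x\<bar> = ennreal \<bar>dyadic_average k \<phi> (lower B) x - \<phi> x\<bar>"
      if "x \<in> ibox (lower B)" for x
      by (simp only: dyadic_average_lower[OF Suc.prems(1) that])
    show "ennreal \<bar>dyadic_average (Suc k) \<phi> B x - \<phi> x\<bar> = ennreal \<bar>dyadic_average k \<phi> (upper B) x - \<phi> x\<bar>"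
      if "x \<in> ibox (upper B)" for x
      by (simp only: dyadic_average_upper[OF Suc.prems(1) that])
    show "(\<integral>\<^sup>+x\<in>ibox (lower B). ennreal \<bar>dyadic_average k \<phi> (lower B) x - \<phi> x\<bar> \<partial>lborel) \<le> ennreal (\<omega> * vol (lower B))"
    proof (rule Suc.IH)
      show "\<bar>\<phi> x - \<phi> y\<bar> \<le> \<omega>" if "x \<in> ibox (lower B)" "y \<in> ibox (lower B)"
        "\<And>j. \<bar>x $ j - y $ j\<bar> \<le> 2 * (vol (lower B) / 2 ^ k) powr (1 / real CARD('n))" for x y
        using that(1,2) that(3)[unfolded vol_lower e] unfolding mem_lower[OF Suc.prems(1)]
        by (intro Suc.prems(3)) auto
    qed (use Suc.prems in \<open>auto intro: fat_lower set_integrable_lower\<close>)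
    show "(\<integral>\<^sup>+x\<in>ibox (upper B). ennreal \<bar>dyadic_average k \<phi> (upper B) x - \<phi> x\<bar> \<partial>lborel) \<le> ennreal (\<omega> * vol (upper B))"
    proof (rule Suc.IH)
      show "\<bar>\<phi> x - \<phi> y\<bar> \<le> \<omega>" if "x \<in> ibox (upper B)" "y \<in> ibox (upper B)"
        "\<And>j. \<bar>x $ j - y $ j\<bar> \<le> 2 * (vol (upper B) / 2 ^ k) powr (1 / real CARD('n))" for x y
        using that(1,2) that(3)[unfolded vol_upper e] unfolding mem_upper[OF Suc.prems(1)]
        by (intro Suc.prems(3)) auto
    qed (use Suc.prems in \<open>auto intro: fat_upper set_integrable_upper\<close>)
    show "ennreal (\<omega> * vol (lower B)) + ennreal (\<omega> * vol (upper B)) \<le> ennreal (\<omega> * vol B)"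
      using vol_pos[OF Suc.prems(1)] \<open>0 \<le> \<omega>\<close> by (simp add: vol_lower vol_upper flip: ennreal_plus)
  qed
qed

section \<open>Convergence of the averages\<close>

text \<open>Truncation reduces the claim to bounded functions. A measurable function is an almost everywhere limit of continuous
functions, and these can be truncated at the same level without losing continuity, so that dominated convergence
applies.\<close>

lemma continuous_dense_L1:
  fixes f :: "real^'n::finite \<Rightarrow> real"
  assumes [measurable]: "f \<in> borel_measurable borel" and S[measurable]: "S \<in> sets borel" and fin: "emeasure lborel S < \<infinity>"
    and f: "set_integrable lborel S f" and e: "0 < e"
  obtains \<phi> where "continuous_on UNIV \<phi>" "bounded (range \<phi>)" "(\<integral>\<^sup>+x\<in>S. ennreal \<bar>f x - \<phi> x\<bar> \<partial>lborel) < ennreal e"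
proof -
  define clip where "clip K t = max (- K) (min K t)" for K t :: real
  have clip_cont: "continuous_on UNIV (clip K)" for K
    unfolding clip_def by (intro continuous_intros)
  have clip_meas [measurable]: "clip K \<in> borel_measurable borel" for K
    using clip_cont by (rule borel_measurable_continuous_onI)
  have clip_b: "\<bar>clip K t\<bar> \<le> K" if "0 \<le> K" for K t using that by (auto simp: clip_def)
  have clip_clip: "clip K (clip K t) = clip K t" if "0 \<le> K" for K t using that by (auto simp: clip_def)
  have "(\<lambda>K. \<integral>\<^sup>+x\<in>S. ennreal \<bar>f x - clip (real K) (f x)\<bar> \<partial>lborel) \<longlonglongrightarrow> (\<integral>\<^sup>+x. 0 \<partial>(lborel :: (real^'n) measure))"
  proof (rule nn_integral_dominated_convergence[where w="\<lambda>x. ennreal \<bar>f x\<bar> * indicator S x"])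
    show "AE x in lborel. ennreal \<bar>f x - clip (real K) (f x)\<bar> * indicator S x \<le> ennreal \<bar>f x\<bar> * indicator S x" for K
      by (intro AE_I2 mult_right_mono ennreal_leI) (auto simp: clip_def)
    have "(\<integral>\<^sup>+x\<in>S. ennreal \<bar>f x\<bar> \<partial>lborel) = (\<integral>\<^sup>+x. ennreal (norm (indicator S x *\<^sub>R f x)) \<partial>lborel)"
      by (rule nn_integral_cong) (auto simp: indicator_def)
    then show "(\<integral>\<^sup>+x\<in>S. ennreal \<bar>f x\<bar> \<partial>lborel) < \<infinity>"
      using f by (simp add: set_integrable_def integrable_iff_bounded)
    show "AE x in lborel. (\<lambda>K. ennreal \<bar>f x - clip (real K) (f x)\<bar> * indicator S x) \<longlonglongrightarrow> 0"
    proof (intro AE_I2 tendsto_eventually)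
      fix x
      obtain K0 where "\<bar>f x\<bar> \<le> real K0" using real_arch_simple by blast
      then have "clip (real K) (f x) = f x" if "K \<ge> K0" for K using that by (auto simp: clip_def)
      then show "\<forall>\<^sub>F K in sequentially. ennreal \<bar>f x - clip (real K) (f x)\<bar> * indicator S x = 0"
        by (intro eventually_sequentiallyI[of K0]) simp
    qed
  qed measurable
  then have "\<forall>\<^sub>F K in sequentially. (\<integral>\<^sup>+x\<in>S. ennreal \<bar>f x - clip (real K) (f x)\<bar> \<partial>lborel) < ennreal (e/2)"
    using e by (intro order_tendstoD(2)) auto
  then obtain K where K: "(\<integral>\<^sup>+x\<in>S. ennreal \<bar>f x - clip (real K) (f x)\<bar> \<partial>lborel) < ennreal (e/2)"
    by (meson eventually_sequentially order_refl)
  define h where "h x = clip (real K) (f x)" for x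
  have [measurable]: "h \<in> borel_measurable borel" unfolding h_def[abs_def] by measurable
  have "h \<in> borel_measurable lborel" by simp
  then have "h \<in> borel_measurable lebesgue" by (rule measurable_completion)
  then have "h measurable_on UNIV" by (rule lebesgue_measurable_imp_measurable_on_real) simp
  then obtain N g where N: "negligible N" and g: "\<And>n. continuous_on UNIV (g n)"
    "\<And>x. x \<notin> N \<Longrightarrow> (\<lambda>n. g n x) \<longlonglongrightarrow> h x"
    unfolding measurable_on_def by auto
  define \<phi> where "\<phi> n x = clip (real K) (g n x)" for n :: nat and x
  have c: "continuous_on UNIV (\<phi> n)" for n
    unfolding \<phi>_def[abs_def] by (rule continuous_on_compose2[OF clip_cont g(1)]) simp
  then have [measurable]: "\<phi> n \<in> borel_measurable borel" for n by (rule borel_measurable_continuous_onI)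
  have "(\<lambda>n. \<integral>\<^sup>+x\<in>S. ennreal \<bar>h x - \<phi> n x\<bar> \<partial>lborel) \<longlonglongrightarrow> (\<integral>\<^sup>+x. 0 \<partial>(lborel :: (real^'n) measure))"
  proof (rule nn_integral_dominated_convergence[where w="\<lambda>x. ennreal (2 * real K) * indicator S x"])
    have b: "\<bar>h x\<bar> \<le> real K" "\<bar>\<phi> n x\<bar> \<le> real K" for n x unfolding h_def \<phi>_def by (auto intro!: clip_b)
    show "AE x in lborel. ennreal \<bar>h x - \<phi> n x\<bar> * indicator S x \<le> ennreal (2 * real K) * indicator S x" for n
    proof (intro AE_I2 mult_right_mono ennreal_leI)
      show "\<bar>h x - \<phi> n x\<bar> \<le> 2 * real K" for x using b(1)[of x] b(2)[of n x] by linarith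
    qed simp
    show "(\<integral>\<^sup>+x\<in>S. ennreal (2 * real K) \<partial>lborel) < \<infinity>"
      using fin by (simp add: nn_integral_cmult_indicator ennreal_mult_less_top)
    have "AE x in lebesgue. x \<notin> N" using N by (simp add: negligible_iff_null_sets AE_not_in)
    then have "AE x in lborel. x \<notin> N" by (simp add: AE_completion_iff)
    then show "AE x in lborel. (\<lambda>n. ennreal \<bar>h x - \<phi> n x\<bar> * indicator S x) \<longlonglongrightarrow> 0"
    proof eventually_elim
      case (elim x)
      have "(\<lambda>n. \<phi> n x) \<longlonglongrightarrow> clip (real K) (h x)"
        unfolding \<phi>_def by (rule continuous_on_tendsto_compose[OF clip_cont g(2)[OF elim]]) auto
      then have "(\<lambda>n. \<phi> n x) \<longlonglongrightarrow> h x" by (simp add: h_def clip_clip)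
      then have "(\<lambda>n. \<bar>h x - \<phi> n x\<bar>) \<longlonglongrightarrow> \<bar>h x - h x\<bar>" by (intro tendsto_intros)
      then have "(\<lambda>n. ennreal \<bar>h x - \<phi> n x\<bar>) \<longlonglongrightarrow> 0" using tendsto_ennrealI by force
      then show ?case by (cases "x \<in> S") auto
    qed
  qed measurable
  then have "\<forall>\<^sub>F n in sequentially. (\<integral>\<^sup>+x\<in>S. ennreal \<bar>h x - \<phi> n x\<bar> \<partial>lborel) < ennreal (e/2)"
    using e by (intro order_tendstoD(2)) auto
  then obtain n where n: "(\<integral>\<^sup>+x\<in>S. ennreal \<bar>h x - \<phi> n x\<bar> \<partial>lborel) < ennreal (e/2)"
    by (meson eventually_sequentially order_refl)
  show thesis
  proof (rule that[OF c[of n]])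
    show "bounded (range (\<phi> n))" unfolding \<phi>_def by (rule boundedI[of _ "real K"]) (auto intro!: clip_b)
    have "(\<integral>\<^sup>+x\<in>S. ennreal \<bar>f x - \<phi> n x\<bar> \<partial>lborel) \<le>
      (\<integral>\<^sup>+x. ennreal \<bar>f x - h x\<bar> * indicator S x + ennreal \<bar>h x - \<phi> n x\<bar> * indicator S x \<partial>lborel)"
      by (intro nn_integral_mono) (auto simp: indicator_def simp flip: ennreal_plus intro!: ennreal_leI)
    also have "\<dots> = (\<integral>\<^sup>+x\<in>S. ennreal \<bar>f x - h x\<bar> \<partial>lborel) + (\<integral>\<^sup>+x\<in>S. ennreal \<bar>h x - \<phi> n x\<bar> \<partial>lborel)"
      by (rule nn_integral_add) measurable
    also have "\<dots> < ennreal (e/2) + ennreal (e/2)"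
      using K n by (intro add_strict_mono) (auto simp: h_def)
    also have "\<dots> = ennreal e" using e by (simp flip: ennreal_plus)
    finally show "(\<integral>\<^sup>+x\<in>S. ennreal \<bar>f x - \<phi> n x\<bar> \<partial>lborel) < ennreal e" .
  qed
qed

lemma small_cells:
  assumes "0 < v" "0 < N" "0 < d"
  shows "\<exists>k0. \<forall>k\<ge>k0. N * (2 * (v / 2 ^ k) powr (1 / N)) < (d::real)"
proof -
  have "(\<lambda>k. v * (1/2) ^ k) \<longlonglongrightarrow> v * 0" by (intro tendsto_intros LIMSEQ_realpow_zero) auto
  then have "(\<lambda>k. (v * (1/2) ^ k) powr (1/N)) \<longlonglongrightarrow> 0"
    using assms by (intro tendsto_zero_powrI[where b="1/N"]) auto
  then have "(\<lambda>k. N * (2 * (v * (1/2) ^ k) powr (1 / N))) \<longlonglongrightarrow> N * (2 * 0)"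
    by (intro tendsto_mult tendsto_const)
  then have "\<forall>\<^sub>F k in sequentially. N * (2 * (v * (1/2) ^ k) powr (1 / N)) < d"
    using assms by (intro order_tendstoD(2)) auto
  then show ?thesis by (simp add: eventually_sequentially power_divide)
qed

text \<open>For continuous functions the averages converge uniformly; contraction transfers this to the closure in \<open>L^1\<close>.\<close>

lemma dyadic_average_tendsto_L1:
  fixes f :: "real^'n::finite \<Rightarrow> real"
  assumes B: "fat B" and f: "set_integrable lborel (ibox B) f" and [measurable]: "f \<in> borel_measurable borel"
  shows "(\<lambda>k. \<integral>\<^sup>+x\<in>ibox B. ennreal \<bar>dyadic_average k f B x - f x\<bar> \<partial>lborel) \<longlonglongrightarrow> 0"
proof (rule order_tendstoI)
  fix c :: ennreal assume "0 < c"
  then obtain e where e: "0 < e" "ennreal e < c"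
    by (metis dense ennreal_cases ennreal_less_zero_iff not_less_iff_gr_or_eq order_less_imp_not_less top.not_eq_extremum)
  let ?S = "ibox B"
  have v: "0 < vol B" by (rule vol_pos[OF B])
  have "emeasure lborel ?S < \<infinity>" by (simp add: emeasure_cell[OF B])
  then obtain \<phi> where \<phi>: "continuous_on UNIV \<phi>" "bounded (range \<phi>)" "(\<integral>\<^sup>+x\<in>?S. ennreal \<bar>f x - \<phi> x\<bar> \<partial>lborel) < ennreal (e/3)"
    using e by (elim continuous_dense_L1[rotated 2, OF _ f, of "e/3"]) auto
  have [measurable]: "\<phi> \<in> borel_measurable borel" using \<phi>(1) by (rule borel_measurable_continuous_onI)
  obtain K where K: "\<bar>\<phi> x\<bar> \<le> K" for x using \<phi>(2) by (auto simp: bounded_iff)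
  have i\<phi>: "set_integrable lborel ?S \<phi>"
    unfolding set_integrable_def
    by (rule integrableI_bounded_set_indicator[where B=K]) (use K emeasure_cell[OF B] in auto)
  have "uniformly_continuous_on (cbox (fst B) (snd B)) \<phi>"
    by (intro compact_uniformly_continuous continuous_on_subset[OF \<phi>(1)]) auto
  then obtain d where d: "0 < d" "\<And>x y. x \<in> cbox (fst B) (snd B) \<Longrightarrow> y \<in> cbox (fst B) (snd B) \<Longrightarrow> dist x y < d \<Longrightarrow>
      dist (\<phi> x) (\<phi> y) < e / (3 * vol B)"
    unfolding uniformly_continuous_on_def using e v by (metis dist_commute divide_pos_pos mult_pos_pos zero_less_numeral)
  obtain k0 where k0: "\<And>k. k \<ge> k0 \<Longrightarrow> real CARD('n) * (2 * (vol B / 2 ^ k) powr (1 / real CARD('n))) < d"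
    using small_cells[OF v _ d(1), of "real CARD('n)"] by auto
  show "\<forall>\<^sub>F k in sequentially. (\<integral>\<^sup>+x\<in>?S. ennreal \<bar>dyadic_average k f B x - f x\<bar> \<partial>lborel) < c"
  proof (rule eventually_sequentiallyI[of k0])
    fix k assume k: "k0 \<le> k"
    have near: "(\<integral>\<^sup>+x\<in>?S. ennreal \<bar>dyadic_average k \<phi> B x - \<phi> x\<bar> \<partial>lborel) \<le> ennreal (e / (3 * vol B) * vol B)"
    proof (rule dyadic_average_near_continuous[OF B i\<phi>])
      fix x y assume xy: "x \<in> ?S" "y \<in> ?S" "\<And>j. \<bar>x $ j - y $ j\<bar> \<le> 2 * (vol B / 2 ^ k) powr (1 / real CARD('n))"
      have "dist x y \<le> (\<Sum>j\<in>UNIV. \<bar>(x - y) $ j\<bar>)" unfolding dist_norm by (rule norm_le_l1_cart)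
      also have "\<dots> \<le> (\<Sum>j\<in>(UNIV::'n set). 2 * (vol B / 2 ^ k) powr (1 / real CARD('n)))"
        using xy(3) by (intro sum_mono) simp
      also have "\<dots> < d" using k0[OF k] by simp
      finally have "dist (\<phi> x) (\<phi> y) < e / (3 * vol B)"
        using xy box_subset_cbox by (intro d(2)) auto
      then show "\<bar>\<phi> x - \<phi> y\<bar> \<le> e / (3 * vol B)" by (simp add: dist_real_def)
    qed measurable
    have contr: "(\<integral>\<^sup>+x\<in>?S. ennreal \<bar>dyadic_average k f B x - dyadic_average k \<phi> B x\<bar> \<partial>lborel) < ennreal (e/3)"
      using dyadic_average_contraction[OF B f i\<phi>, of k] \<phi>(3) by simp
    have "(\<integral>\<^sup>+x\<in>?S. ennreal \<bar>dyadic_average k f B x - f x\<bar> \<partial>lborel) \<le>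
      (\<integral>\<^sup>+x. ennreal \<bar>dyadic_average k f B x - dyadic_average k \<phi> B x\<bar> * indicator ?S x +
        (ennreal \<bar>dyadic_average k \<phi> B x - \<phi> x\<bar> * indicator ?S x + ennreal \<bar>f x - \<phi> x\<bar> * indicator ?S x) \<partial>lborel)"
      by (intro nn_integral_mono) (auto simp: indicator_def simp flip: ennreal_plus intro!: ennreal_leI)
    also have "\<dots> = (\<integral>\<^sup>+x\<in>?S. ennreal \<bar>dyadic_average k f B x - dyadic_average k \<phi> B x\<bar> \<partial>lborel) +
       ((\<integral>\<^sup>+x\<in>?S. ennreal \<bar>dyadic_average k \<phi> B x - \<phi> x\<bar> \<partial>lborel) + (\<integral>\<^sup>+x\<in>?S. ennreal \<bar>f x - \<phi> x\<bar> \<partial>lborel))"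
      by (subst nn_integral_add; (subst nn_integral_add)?; measurable?)
    also have "\<dots> \<le> ennreal (e/3) + (ennreal (e/3) + ennreal (e/3))"
      using near contr \<phi>(3) v by (intro add_mono) auto
    also have "\<dots> = ennreal e" using e by (simp flip: ennreal_plus)
    finally show "(\<integral>\<^sup>+x\<in>?S. ennreal \<bar>dyadic_average k f B x - f x\<bar> \<partial>lborel) < c" using e(2) by simp
  qed
qed simp

section \<open>Decay of the increments\<close>

text \<open>Hoelder's inequality up to the factor \<open>2\<close>, obtained by integrating \<open>g \<le> s + s^(1-q) g^q\<close>, which holds for every
\<open>s > 0\<close>, and optimizing over \<open>s\<close>.\<close>

lemma mean_le_power_mean:
  fixes g :: "real^'n::finite \<Rightarrow> real"
  assumes S: "S \<in> sets borel" "emeasure lborel S = ennreal v" and v: "0 < v" and q: "1 \<le> q" and g0: "\<And>x. 0 \<le> g x"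
    and g: "set_integrable lborel S g" and gq: "set_integrable lborel S (\<lambda>x. g x powr q)"
  shows "(LINT x:S|lborel. g x) \<le> 2 * v powr (1 - 1/q) * (LINT x:S|lborel. g x powr q) powr (1/q)"
proof -
  define G where "G = (LINT x:S|lborel. g x powr q)"
  have G0: "0 \<le> G" unfolding G_def set_lebesgue_integral_def by (intro integral_nonneg_AE) auto
  have c: "set_integrable lborel S (\<lambda>x. c::real)" for c using S by (simp add: set_integrable_def)
  have key: "(LINT x:S|lborel. g x) \<le> s * v + s powr (1 - q) * G" if s: "0 < s" for s
  proof -
    have "g x \<le> s + s powr (1 - q) * g x powr q" for x
    proof (cases "g x \<le> s")
      case False
      then have "g x = g x powr (1 - q) * g x powr q" using s by (simp flip: powr_add)
      also have "\<dots> \<le> s powr (1 - q) * g x powr q"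
        using False s q by (intro mult_right_mono powr_mono2') auto
      finally show ?thesis using s by simp
    qed (simp add: add_increasing2)
    then have "(LINT x:S|lborel. g x) \<le> (LINT x:S|lborel. s + s powr (1 - q) * g x powr q)"
      using c gq g by (intro set_integral_mono set_integral_add set_integrable_mult_right) auto
    also have "\<dots> = s * v + s powr (1 - q) * G"
      using c gq S v by (simp add: set_integral_add G_def set_integral_const measure_def)
    finally show ?thesis .
  qed
  show ?thesis
  proof (cases "G = 0")
    case True
    have "(LINT x:S|lborel. g x) \<le> 0"
    proof (rule field_le_epsilon)
      fix e :: real assume "0 < e"
      then show "(LINT x:S|lborel. g x) \<le> 0 + e" using key[of "e / v"] v True by simp
    qed
    then show ?thesis using True by (simp add: G_def)
  next
    case False
    then have G: "0 < G" using G0 by simp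
    \<comment> \<open>the value of \<open>s\<close> that balances the two terms\<close>
    let ?l = "(G / v) powr (1/q)"
    have "?l * v = v powr (1 - 1/q) * G powr (1/q)"
      using G v by (simp add: powr_divide powr_diff)
    moreover have "?l powr (1 - q) * G = v powr (1 - 1/q) * G powr (1/q)"
    proof -
      have e: "1/q * (1 - q) = 1/q - 1" using q by (simp add: field_simps)
      show ?thesis unfolding powr_powr e using G v by (simp add: powr_divide powr_diff field_simps)
    qed
    ultimately show ?thesis using key[of ?l] G v by (simp add: G_def)
  qed
qed

lemma powr_superadditive:
  assumes "0 \<le> a" "0 \<le> b" "1 \<le> (r::real)"
  shows "a powr r + b powr r \<le> (a + b) powr r"
proof -
  have *: "c powr r = c * c powr (r - 1)" if "0 \<le> c" for c :: real
    using that by (cases "c = 0") (simp_all add: powr_diff)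
  have "a powr r + b powr r \<le> a * (a + b) powr (r - 1) + b * (a + b) powr (r - 1)"
    unfolding *[OF assms(1)] *[OF assms(2)] using assms by (intro add_mono mult_left_mono powr_mono2) auto
  also have "\<dots> = (a + b) powr r" using *[of "a + b"] assms by (simp add: distrib_right)
  finally show ?thesis .
qed

text \<open>All that the martingale argument uses about the gradient: the conclusion of \<open>weak_partial_halves\<close> for all fat
subcells.\<close>

definition controls_oscillation :: "(real^'n \<Rightarrow> real) \<Rightarrow> (real^'n \<Rightarrow> real) \<Rightarrow> 'n::finite cell \<Rightarrow> bool" where
  "controls_oscillation g f B0 \<longleftrightarrow> (\<forall>B. fat B \<longrightarrow> ibox B \<subseteq> ibox B0 \<longrightarrow>
     \<bar>(LINT x:ibox (lower B)|lborel. f x) - (LINT x:ibox (upper B)|lborel. f x)\<bar>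
       \<le> side B (long_axis B) / 2 * (LINT x:ibox B|lborel. g x))"

text \<open>On a cell \<open>B\<close> of generation \<open>k\<close> the increment has constant modulus, namely the difference of the integrals over the two
halves divided by the volume, so it is at most a constant times \<open>v^(1/N - 1/q) (\<integral>\<^sub>B g^q)^(1/q)\<close> with
\<open>v = vol B\<close>. Its \<open>p\<close>-th power integrates to at most \<open>v^(1 + p/N - p/q) (\<integral>\<^sub>B g^q)^(p/q)\<close> up to a constant. Superadditivity of
\<open>t^(p/q)\<close>, where \<open>p \<ge> q\<close> enters, allows these bounds to be summed over the cells.\<close>

lemma dyadic_increment:
  fixes f g :: "real^'n::finite \<Rightarrow> real"
  assumes "fat B" "ibox B \<subseteq> ibox B0" "controls_oscillation g f B0"
    and q: "1 \<le> q" "q \<le> p" and [measurable]: "f \<in> borel_measurable borel" and g0: "\<And>x. 0 \<le> g x"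
    and "set_integrable lborel (ibox B) f"
    and "set_integrable lborel (ibox B) g" "set_integrable lborel (ibox B) (\<lambda>x. g x powr q)"
  shows "(\<integral>\<^sup>+x\<in>ibox B. ennreal (\<bar>dyadic_average (Suc k) f B x - dyadic_average k f B x\<bar> powr p) \<partial>lborel)
     \<le> ennreal (2 powr p * (vol B / 2 ^ k) powr (1 + p / real CARD('n) - p / q) *
         (LINT x:ibox B|lborel. g x powr q) powr (p / q))"
  using assms(1,2,8-10)
proof (induction k arbitrary: B)
  case 0
  note B = 0(1) and sub = 0(2) and f = 0(3) and g = 0(4) and gq = 0(5)
  have v: "0 < vol B" by (rule vol_pos[OF B])
  define G where "G = (LINT x:ibox B|lborel. g x powr q)"
  have G0: "0 \<le> G" unfolding G_def set_lebesgue_integral_def by (intro integral_nonneg_AE) auto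
  define FL where "FL = (LINT x:ibox (lower B)|lborel. f x)"
  define FU where "FU = (LINT x:ibox (upper B)|lborel. f x)"
  define N where "N = real CARD('n)"
  define c where "c = \<bar>FL - FU\<bar> / vol B"
  have avg: "average f B = (FL + FU) / vol B" "average f (lower B) = 2 * FL / vol B"
    "average f (upper B) = 2 * FU / vol B"
    using v by (simp_all add: average_def FL_def FU_def set_integral_split[OF B f] vol_lower vol_upper)
  have L: "\<bar>average f (lower B) - average f B\<bar> = c"
  proof -
    have "average f (lower B) - average f B = (FL - FU) / vol B"
      unfolding avg using v by (simp add: field_simps)
    then show ?thesis using v by (simp add: c_def)
  qed
  have U: "\<bar>average f (upper B) - average f B\<bar> = c"
  proof -
    have "average f (upper B) - average f B = (FU - FL) / vol B"
      unfolding avg using v by (simp add: field_simps)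
    then show ?thesis using v by (simp add: c_def abs_minus_commute)
  qed
  have "\<bar>FL - FU\<bar> \<le> side B (long_axis B) / 2 * (LINT x:ibox B|lborel. g x)"
    using assms(3) B sub unfolding controls_oscillation_def FL_def FU_def by blast
  also have "\<dots> \<le> vol B powr (1/N) * (2 * vol B powr (1 - 1/q) * G powr (1/q))"
  proof (rule mult_mono)
    show "side B (long_axis B) / 2 \<le> vol B powr (1/N)" using fat_side_le[OF B, of "long_axis B"] by (simp add: N_def)
    show "(LINT x:ibox B|lborel. g x) \<le> 2 * vol B powr (1 - 1/q) * G powr (1/q)"
      unfolding G_def by (rule mean_le_power_mean) (use emeasure_cell[OF B] v q g0 g gq in auto)
    show "0 \<le> (LINT x:ibox B|lborel. g x)"
      unfolding set_lebesgue_integral_def by (intro integral_nonneg_AE) (auto simp: g0)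
  qed auto
  finally have "c \<le> vol B powr (1/N) * (2 * vol B powr (1 - 1/q) * G powr (1/q)) / vol B"
    using v by (simp add: c_def divide_right_mono)
  also have "\<dots> = 2 * vol B powr (1/N - 1/q) * G powr (1/q)"
    using v by (simp add: powr_diff field_simps)
  finally have "c powr p \<le> (2 * vol B powr (1/N - 1/q) * G powr (1/q)) powr p"
    using q v by (intro powr_mono2) (auto simp: c_def)
  also have "\<dots> = 2 powr p * vol B powr ((1/N - 1/q) * p) * G powr (p/q)"
    using G0 v by (simp add: powr_mult powr_powr)
  finally have "c powr p * vol B \<le> 2 powr p * vol B powr ((1/N - 1/q) * p) * G powr (p/q) * vol B"
    using v by simp
  also have "\<dots> = 2 powr p * (vol B / 2 ^ 0) powr (1 + p / N - p / q) * G powr (p / q)"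
  proof -
    have e: "1 + p / N - p / q = 1 + (1/N - 1/q) * p" by (simp add: algebra_simps)
    show ?thesis using v unfolding e powr_add by simp
  qed
  finally have cv: "c powr p * vol B \<le> 2 powr p * (vol B / 2 ^ 0) powr (1 + p / N - p / q) * G powr (p / q)" .
  show ?case
  proof (rule nn_integral_split_le[OF B])
    let ?F = "\<lambda>x. ennreal (\<bar>dyadic_average (Suc 0) f B x - dyadic_average 0 f B x\<bar> powr p)"
    show "?F \<in> borel_measurable borel" by measurable
    show "?F x = ennreal (c powr p)" if "x \<in> ibox (lower B)" for x
      unfolding dyadic_average_lower[OF B that] by (simp add: L)
    show "?F x = ennreal (c powr p)" if "x \<in> ibox (upper B)" for x
      unfolding dyadic_average_upper[OF B that] by (simp add: U)
    show "(\<integral>\<^sup>+x\<in>ibox (lower B). ennreal (c powr p) \<partial>lborel) \<le> ennreal (c powr p * vol B / 2)"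
      "(\<integral>\<^sup>+x\<in>ibox (upper B). ennreal (c powr p) \<partial>lborel) \<le> ennreal (c powr p * vol B / 2)"
      using v by (simp_all add: nn_integral_const_cell fat_lower fat_upper B vol_lower vol_upper ennreal_mult''[symmetric])
    show "ennreal (c powr p * vol B / 2) + ennreal (c powr p * vol B / 2) \<le>
       ennreal (2 powr p * (vol B / 2 ^ 0) powr (1 + p / real CARD('n) - p / q) *
         (LINT x:ibox B|lborel. g x powr q) powr (p / q))"
    proof -
      have "ennreal (c powr p * vol B / 2) + ennreal (c powr p * vol B / 2) = ennreal (c powr p * vol B)"
        using v by (subst ennreal_plus[symmetric]) (auto simp: field_sum_of_halves)
      then show ?thesis using ennreal_leI[OF cv] unfolding N_def G_def by (simp only:)
    qed
  qed
next
  case (Suc k)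
  note B = Suc.prems(1) and gq = Suc.prems(5)
  let ?I = "\<lambda>B. LINT x:ibox B|lborel. g x powr q"
  let ?K = "2 powr p * (vol B / 2 ^ Suc k) powr (1 + p / real CARD('n) - p / q)"
  have I0: "0 \<le> ?I B'" for B' unfolding set_lebesgue_integral_def by (intro integral_nonneg_AE) auto
  have e: "vol B / 2 / 2 ^ k = vol B / 2 ^ Suc k" by simp
  show ?case
  proof (rule nn_integral_split_le[OF B])
    let ?F = "\<lambda>k B x. ennreal (\<bar>dyadic_average (Suc k) f B x - dyadic_average k f B x\<bar> powr p)"
    show "?F (Suc k) B \<in> borel_measurable borel" by measurable
    show "?F (Suc k) B x = ?F k (lower B) x" if "x \<in> ibox (lower B)" for x
      by (simp only: dyadic_average_lower[OF B that])
    show "?F (Suc k) B x = ?F k (upper B) x" if "x \<in> ibox (upper B)" for x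
      by (simp only: dyadic_average_upper[OF B that])
    show "(\<integral>\<^sup>+x\<in>ibox (lower B). ?F k (lower B) x \<partial>lborel) \<le> ennreal (?K * ?I (lower B) powr (p/q))"
      unfolding e[symmetric] vol_lower[symmetric]
      using Suc.prems by (intro Suc.IH fat_lower set_integrable_lower) (auto simp: mem_lower[OF B])
    show "(\<integral>\<^sup>+x\<in>ibox (upper B). ?F k (upper B) x \<partial>lborel) \<le> ennreal (?K * ?I (upper B) powr (p/q))"
      unfolding e[symmetric] vol_upper[symmetric]
      using Suc.prems by (intro Suc.IH fat_upper set_integrable_upper) (auto simp: mem_upper[OF B])
    have "?I (lower B) powr (p/q) + ?I (upper B) powr (p/q) \<le> ?I B powr (p/q)"
      unfolding set_integral_split[OF B gq] using I0 q by (intro powr_superadditive) auto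
    then have "?K * ?I (lower B) powr (p/q) + ?K * ?I (upper B) powr (p/q) \<le> ?K * ?I B powr (p/q)"
      unfolding distrib_left[symmetric] by (intro mult_left_mono) auto
    then show "ennreal (?K * ?I (lower B) powr (p/q)) + ennreal (?K * ?I (upper B) powr (p/q)) \<le> ennreal (?K * ?I B powr (p/q))"
      by (simp flip: ennreal_plus add: ennreal_leI)
  qed
qed

lemma L1_convergence_subsequence:
  fixes E :: "nat \<Rightarrow> real^'n::finite \<Rightarrow> real"
  assumes [measurable]: "\<And>k. E k \<in> borel_measurable borel" "f \<in> borel_measurable borel" "S \<in> sets borel"
    and L1: "(\<lambda>k. \<integral>\<^sup>+x\<in>S. ennreal \<bar>E k x - f x\<bar> \<partial>lborel) \<longlonglongrightarrow> 0"
  obtains r where "strict_mono r" "AE x in lborel. x \<in> S \<longrightarrow> (\<lambda>k. E (r k) x) \<longlonglongrightarrow> f x"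
proof -
  have "\<forall>\<^sub>F k in sequentially. (\<integral>\<^sup>+x\<in>S. ennreal \<bar>E k x - f x\<bar> \<partial>lborel) < 1"
    by (rule order_tendstoD(2)[OF L1]) simp
  then obtain k0 where k0: "\<And>k. k \<ge> k0 \<Longrightarrow> (\<integral>\<^sup>+x\<in>S. ennreal \<bar>E k x - f x\<bar> \<partial>lborel) < 1"
    by (auto simp: eventually_sequentially)
  define u where "u k x = indicator S x * (E (k + k0) x - f x)" for k x
  have [measurable]: "u k \<in> borel_measurable borel" for k unfolding u_def[abs_def] by measurable
  have n: "(\<integral>\<^sup>+x. ennreal (norm (u k x)) \<partial>lborel) = (\<integral>\<^sup>+x\<in>S. ennreal \<bar>E (k + k0) x - f x\<bar> \<partial>lborel)" for k
    by (rule nn_integral_cong) (auto simp: u_def indicator_def)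
  have int: "integrable lborel (u k)" for k
  proof (rule integrableI_bounded)
    show "(\<integral>\<^sup>+x. ennreal (norm (u k x)) \<partial>lborel) < \<infinity>"
      unfolding n using k0[of "k + k0"] by (simp add: less_trans[OF _ ennreal_one_less_top])
  qed simp
  have "(\<lambda>k. enn2real (\<integral>\<^sup>+x. ennreal (norm (u k x)) \<partial>lborel)) \<longlonglongrightarrow> enn2real 0"
    unfolding n using LIMSEQ_ignore_initial_segment[OF L1, of k0] by (intro tendsto_enn2real) auto
  moreover have "enn2real (\<integral>\<^sup>+x. ennreal (norm (u k x)) \<partial>lborel) = (LINT x|lborel. norm (u k x))" for k
    by (rule integral_eq_nn_integral[symmetric]) auto
  ultimately have "(\<lambda>k. LINT x|lborel. norm (u k x)) \<longlonglongrightarrow> 0" by simp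
  from tendsto_L1_AE_subseq[OF int this]
  obtain r where r: "strict_mono r" "AE x in lborel. (\<lambda>k. u (r k) x) \<longlonglongrightarrow> 0" by auto
  show thesis
  proof (rule that[of "\<lambda>k. r k + k0"])
    show "strict_mono (\<lambda>k. r k + k0)" using r(1) by (simp add: strict_mono_def)
    show "AE x in lborel. x \<in> S \<longrightarrow> (\<lambda>k. E (r k + k0) x) \<longlonglongrightarrow> f x"
      using r(2)
    proof (eventually_elim, intro impI)
      fix x assume "(\<lambda>k. u (r k) x) \<longlonglongrightarrow> 0" "x \<in> S"
      then show "(\<lambda>k. E (r k + k0) x) \<longlonglongrightarrow> f x" by (simp add: u_def LIM_zero_iff)
    qed
  qed
qed

section \<open>Compactness on a box\<close>

definition sobolev_ball :: "real \<Rightarrow> 'n::finite cell \<Rightarrow> real \<Rightarrow> (real^'n \<Rightarrow> real) set" where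
  "sobolev_ball q B R = {f. f \<in> borel_measurable borel \<and> set_integrable lborel (ibox B) f \<and>
     (LINT x:ibox B|lborel. \<bar>f x\<bar>) \<le> R \<and>
     (\<exists>g. (\<forall>x. 0 \<le> g x) \<and> controls_oscillation g f B \<and> set_integrable lborel (ibox B) g \<and>
        set_integrable lborel (ibox B) (\<lambda>x. g x powr q) \<and>
        (LINT x:ibox B|lborel. g x powr q) \<le> R)}"

text \<open>The increments \<open>a k\<close> are summed without Minkowski's inequality. With weights \<open>w^k\<close> whose \<open>p\<close>-th powers decay at
half the rate of the increments, put \<open>T = \<Sum>k. (a k / w^k)^p\<close>. This function is still integrable, and
\<open>a k \<le> w^k T^(1/p)\<close> pointwise, so that the series of increments from \<open>m\<close> on is at most \<open>T^(1/p) w^m / (1-w)\<close>.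
Along a subsequence \<open>E\<^sub>k f\<close> converges to \<open>f\<close> almost everywhere, hence the same bound holds for
\<open>|f - E\<^sub>m f|\<close>.\<close>

lemma dyadic_average_tail:
  fixes B :: "'n::finite cell"
  assumes B: "fat B" and q: "1 \<le> q" "q \<le> p" and sub: "p * (1/q - 1 / real CARD('n)) < 1"
  obtains D \<theta> where "0 < \<theta>" "\<theta> < 1" "0 \<le> D"
    "\<forall>f\<in>sobolev_ball q B R. \<forall>m. (\<integral>\<^sup>+x\<in>ibox B. ennreal (\<bar>f x - dyadic_average m f B x\<bar> powr p) \<partial>lborel)
         \<le> ennreal (D * \<theta> ^ m)"
proof -
  let ?S = "ibox B"
  \<comment> \<open>the decay exponent of the increments; it is positive because \<open>p\<close> is subcritical\<close>
  define \<delta> where "\<delta> = 1 + p / real CARD('n) - p / q"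
  have \<delta>: "0 < \<delta>" using sub by (simp add: \<delta>_def algebra_simps)
  have p: "1 \<le> p" using q by simp
  have v: "0 < vol B" by (rule vol_pos[OF B])
  define \<theta> where "\<theta> = 2 powr (- \<delta> / 2)"
  define w where "w = 2 powr (- \<delta> / (2 * p))"
  have \<theta>: "0 < \<theta>" "\<theta> < 1" and w: "0 < w" "w < 1"
    using \<delta> p by (auto simp: \<theta>_def w_def powr_less_one)
  have wp: "w powr p = \<theta>" using p by (simp add: w_def \<theta>_def powr_powr)
  have wkp: "(w ^ k) powr p = \<theta> ^ k" for k
    using w \<theta> by (simp add: powr_realpow[symmetric] powr_powr wp[symmetric] mult.commute)
  define A where "A = 2 powr p * vol B powr \<delta>"
  define C where "C = A / (1 - \<theta>) / (1 - w) powr p"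
  have C: "0 \<le> C" using \<theta> w v by (simp add: C_def A_def)
  have dk: "2 powr p * (vol B / 2 ^ k) powr \<delta> = A * (\<theta> * \<theta>) ^ k" for k
  proof -
    have t: "\<theta> * \<theta> = 2 powr (-\<delta>)" by (simp add: \<theta>_def flip: powr_add)
    have "(2 powr (-\<delta>)) ^ k = ((2::real) ^ k) powr (-\<delta>)"
      by (simp add: powr_realpow[symmetric] powr_powr mult.commute)
    moreover have "(vol B / 2 ^ k) powr \<delta> = vol B powr \<delta> / (2 ^ k) powr \<delta>"
      using v by (simp add: powr_divide)
    ultimately show ?thesis unfolding t by (simp add: A_def powr_minus divide_inverse)
  qed
  show thesis
  proof (rule that[OF \<theta>, of "C * R powr (p / q)"], use C in simp, intro ballI allI)
    fix f :: "real^'n \<Rightarrow> real" and m :: nat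
    assume "f \<in> sobolev_ball q B R"
    then obtain g where [measurable]: "f \<in> borel_measurable borel" and g0': "\<forall>x. 0 \<le> g x"
      and ctrl: "controls_oscillation g f B" and f: "set_integrable lborel ?S f"
      and g: "set_integrable lborel ?S g" and gq: "set_integrable lborel ?S (\<lambda>x. g x powr q)"
      and gR: "(LINT x:?S|lborel. g x powr q) \<le> R"
      unfolding sobolev_ball_def by blast
    note g0 = g0'[rule_format]
    define E where "E k = dyadic_average k f B" for k
    have [measurable]: "E k \<in> borel_measurable borel" for k by (simp add: E_def)
    define a where "a k x = \<bar>E (Suc k) x - E k x\<bar>" for k x
    have [measurable]: "a k \<in> borel_measurable borel" for k unfolding a_def[abs_def] by measurable
    define G where "G = (LINT x:?S|lborel. g x powr q) powr (p / q)"
    have G0: "0 \<le> G" by (simp add: G_def)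
    define T where "T x = (\<Sum>k. ennreal ((a k x / w ^ k) powr p))" for x
    have [measurable]: "T \<in> borel_measurable borel" unfolding T_def[abs_def] by measurable
    have ak: "(\<integral>\<^sup>+x\<in>?S. ennreal ((a k x / w ^ k) powr p) \<partial>lborel) \<le> ennreal (A * G * \<theta> ^ k)" for k
    proof -
      have "(\<integral>\<^sup>+x\<in>?S. ennreal ((a k x / w ^ k) powr p) \<partial>lborel) =
        (\<integral>\<^sup>+x. ennreal (1 / \<theta> ^ k) * (ennreal (a k x powr p) * indicator ?S x) \<partial>lborel)"
        using w \<theta> by (intro nn_integral_cong)
          (simp add: powr_divide wkp a_def ennreal_mult[symmetric] mult.assoc[symmetric])
      also have "\<dots> = ennreal (1 / \<theta> ^ k) * (\<integral>\<^sup>+x\<in>?S. ennreal (a k x powr p) \<partial>lborel)"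
        by (rule nn_integral_cmult) measurable
      also have "\<dots> \<le> ennreal (1 / \<theta> ^ k) * ennreal (A * (\<theta> * \<theta>) ^ k * G)"
        unfolding a_def E_def dk[symmetric] \<delta>_def G_def
        by (intro mult_left_mono dyadic_increment[OF B _ ctrl q]) (use f g gq g0 in auto)
      also have "\<dots> = ennreal (A * G * \<theta> ^ k)"
      proof -
        have "1 / \<theta> ^ k * (A * (\<theta> * \<theta>) ^ k * G) = A * G * \<theta> ^ k"
          using \<theta> by (simp add: power_mult_distrib)
        then show ?thesis using \<theta> by (subst ennreal_mult'[symmetric]) auto
      qed
      finally show ?thesis .
    qed
    have T_int: "(\<integral>\<^sup>+x\<in>?S. T x \<partial>lborel) \<le> ennreal (A * G / (1 - \<theta>))"
    proof -
      have "(\<integral>\<^sup>+x\<in>?S. T x \<partial>lborel) = (\<integral>\<^sup>+x. (\<Sum>k. ennreal ((a k x / w ^ k) powr p) * indicator ?S x) \<partial>lborel)"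
        unfolding T_def by (simp add: ennreal_suminf_multc)
      also have "\<dots> = (\<Sum>k. \<integral>\<^sup>+x\<in>?S. ennreal ((a k x / w ^ k) powr p) \<partial>lborel)"
        by (rule nn_integral_suminf) measurable
      also have "\<dots> \<le> (\<Sum>k. ennreal (A * G * \<theta> ^ k))"
        by (rule suminf_le[OF ak]) auto
      also have "\<dots> = ennreal (\<Sum>k. A * G * \<theta> ^ k)"
        using \<theta> G0 v by (intro suminf_ennreal2 summable_mult summable_geometric) (auto simp: A_def)
      also have "(\<Sum>k. A * G * \<theta> ^ k) = A * G / (1 - \<theta>)"
        using \<theta> by (subst suminf_mult) (auto simp: summable_geometric suminf_geometric)
      finally show ?thesis .
    qed
    then have "(\<integral>\<^sup>+x\<in>?S. T x \<partial>lborel) \<noteq> \<infinity>" by (auto simp: top_unique)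
    then have fin: "AE x in lborel. T x * indicator ?S x \<noteq> \<infinity>"
      by (rule nn_integral_PInf_AE[rotated]) measurable
    have L1: "(\<lambda>k. \<integral>\<^sup>+x\<in>?S. ennreal \<bar>E k x - f x\<bar> \<partial>lborel) \<longlonglongrightarrow> 0"
      unfolding E_def by (rule dyadic_average_tendsto_L1[OF B f]) measurable
    obtain r where r: "strict_mono r" "AE x in lborel. x \<in> ?S \<longrightarrow> (\<lambda>k. E (r k) x) \<longlonglongrightarrow> f x"
      by (rule L1_convergence_subsequence[OF _ _ _ L1]) simp_all
    have "AE x in lborel. ennreal (\<bar>f x - E m x\<bar> powr p) * indicator ?S x \<le>
        ennreal (\<theta> ^ m / (1 - w) powr p) * (T x * indicator ?S x)"
      using fin r(2)
    proof eventually_elim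
      case (elim x)
      show ?case
      proof (cases "x \<in> ?S")
        case True
        then have "T x \<noteq> \<infinity>" using elim(1) by simp
        then obtain t where t: "0 \<le> t" "T x = ennreal t" by (cases "T x" rule: ennreal_cases) auto
        have "a k x \<le> t powr (1/p) * w ^ k" for k
        proof -
          have nn: "0 \<le> a k x / w ^ k" using w by (simp add: a_def)
          have "ennreal ((a k x / w ^ k) powr p) = (\<Sum>j\<in>{k}. ennreal ((a j x / w ^ j) powr p))" by simp
          also have "\<dots> \<le> ennreal t" unfolding t(2)[symmetric] T_def by (rule sum_le_suminf) auto
          finally have "(a k x / w ^ k) powr p \<le> t" using t(1) by simp
          then have "((a k x / w ^ k) powr p) powr (1/p) \<le> t powr (1/p)" using p by (intro powr_mono2) auto
          moreover have "((a k x / w ^ k) powr p) powr (1/p) = a k x / w ^ k"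
            unfolding powr_powr using abs_of_nonneg[OF nn] p by simp
          ultimately have "a k x / w ^ k \<le> t powr (1/p)" by simp
          then show ?thesis using w by (simp add: pos_divide_le_eq)
        qed note ak' = this
        have tele: "\<bar>E (m + n) x - E m x\<bar> \<le> t powr (1/p) * (w ^ m / (1 - w))" for n
        proof -
          have "\<bar>E (m + n) x - E m x\<bar> \<le> (\<Sum>k<n. a (m + k) x)"
          proof (induction n)
            case (Suc n)
            then show ?case unfolding a_def by simp
          qed simp
          also have "\<dots> \<le> (\<Sum>k<n. t powr (1/p) * w ^ (m + k))" by (intro sum_mono ak')
          also have "\<dots> = t powr (1/p) * w ^ m * (\<Sum>k<n. w ^ k)" by (simp add: sum_distrib_left power_add mult.assoc)
          also have "\<dots> \<le> t powr (1/p) * w ^ m * (1 / (1 - w))"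
          proof (intro mult_left_mono)
            show "(\<Sum>k<n. w ^ k) \<le> 1 / (1 - w)"
              using w sum_le_suminf[OF summable_geometric[of w], of "{..<n}"] suminf_geometric[of w] by simp
          qed (use w in auto)
          finally show ?thesis by simp
        qed
        have lim: "(\<lambda>k. \<bar>E (r k) x - E m x\<bar>) \<longlonglongrightarrow> \<bar>f x - E m x\<bar>"
          using elim(2) True by (intro tendsto_intros) auto
        have "\<bar>f x - E m x\<bar> \<le> t powr (1/p) * (w ^ m / (1 - w))"
        proof (rule LIMSEQ_le_const2[OF lim], intro exI allI impI)
          fix k assume "m \<le> k"
          then have "m \<le> r k" using seq_suble[OF r(1), of k] by simp
          then show "\<bar>E (r k) x - E m x\<bar> \<le> t powr (1/p) * (w ^ m / (1 - w))" using tele[of "r k - m"] by simp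
        qed
        then have "\<bar>f x - E m x\<bar> powr p \<le> (t powr (1/p) * (w ^ m / (1 - w))) powr p"
          using p by (intro powr_mono2) auto
        also have "\<dots> = t * (\<theta> ^ m / (1 - w) powr p)"
          using p t w by (simp add: powr_mult powr_powr powr_divide wkp)
        finally have "\<bar>f x - E m x\<bar> powr p \<le> \<theta> ^ m / (1 - w) powr p * t" by (simp add: mult.commute)
        then show ?thesis using True t \<theta> by (simp add: ennreal_mult'[symmetric] ennreal_leI)
      qed simp
    qed
    then have "(\<integral>\<^sup>+x\<in>?S. ennreal (\<bar>f x - E m x\<bar> powr p) \<partial>lborel) \<le>
       (\<integral>\<^sup>+x. ennreal (\<theta> ^ m / (1 - w) powr p) * (T x * indicator ?S x) \<partial>lborel)"
      by (rule nn_integral_mono_AE)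
    also have "\<dots> = ennreal (\<theta> ^ m / (1 - w) powr p) * (\<integral>\<^sup>+x\<in>?S. T x \<partial>lborel)"
      by (rule nn_integral_cmult) measurable
    also have "\<dots> \<le> ennreal (\<theta> ^ m / (1 - w) powr p) * ennreal (A * G / (1 - \<theta>))"
      by (intro mult_left_mono T_int) simp
    also have "\<dots> = ennreal (C * \<theta> ^ m * G)"
      using \<theta> by (subst ennreal_mult'[symmetric]) (auto simp: C_def field_simps)
    also have "\<dots> \<le> ennreal (C * \<theta> ^ m * R powr (p / q))"
    proof -
      have "0 \<le> (LINT x:?S|lborel. g x powr q)"
        unfolding set_lebesgue_integral_def by (intro integral_nonneg_AE) auto
      then have "G \<le> R powr (p / q)" unfolding G_def using q gR by (intro powr_mono2) auto
      then show ?thesis using C \<theta> by (intro ennreal_leI mult_left_mono) auto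
    qed
    also have "C * \<theta> ^ m * R powr (p / q) = C * R powr (p / q) * \<theta> ^ m" by simp
    finally show "(\<integral>\<^sup>+x\<in>?S. ennreal (\<bar>f x - dyadic_average m f B x\<bar> powr p) \<partial>lborel) \<le>
       ennreal (C * R powr (p / q) * \<theta> ^ m)" by (simp add: E_def)
  qed
qed

text \<open>The averages of generation \<open>k\<close> are determined by \<open>2^k\<close> bounded numbers; passing to a subsequence for the lower half
and then for the upper half is Bolzano-Weierstrass for these numbers.\<close>

lemma dyadic_average_compact:
  fixes f :: "nat \<Rightarrow> real^'n::finite \<Rightarrow> real"
  assumes "fat B" "\<And>j. set_integrable lborel (ibox B) (f j)"
    "\<And>j. (LINT x:ibox B|lborel. \<bar>f j x\<bar>) \<le> R"
  shows "\<exists>r. strict_mono r \<and> uniformly_Cauchy_on UNIV (\<lambda>j. dyadic_average k (f (r j)) B)"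
  using assms
proof (induction k arbitrary: f B)
  case 0
  have "\<bar>average (f j) B\<bar> \<le> R / vol B" for j
  proof -
    have "\<bar>LINT x:ibox B|lborel. f j x\<bar> \<le> (LINT x:ibox B|lborel. \<bar>f j x\<bar>)"
      using set_integral_norm_bound[OF 0(2)[of j]] by simp
    then show ?thesis
      using vol_pos[OF 0(1)] order_trans[OF _ 0(3)[of j]] by (simp add: average_def divide_right_mono)
  qed
  then have "bounded (range (\<lambda>j. average (f j) B))" by (auto intro!: boundedI)
  then obtain l r where r: "strict_mono r" "((\<lambda>j. average (f j) B) \<circ> r) \<longlonglongrightarrow> l"
    using bounded_imp_convergent_subsequence by blast
  then have "Cauchy (\<lambda>j. average (f (r j)) B)" using LIMSEQ_imp_Cauchy by (auto simp: o_def)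
  then have "uniformly_Cauchy_on UNIV (\<lambda>j. dyadic_average 0 (f (r j)) B)"
    by (simp add: uniformly_Cauchy_on_def Cauchy_def)
  then show ?case using r(1) by blast
next
  case (Suc k)
  have le: "(LINT x:ibox B'|lborel. \<bar>f j x\<bar>) \<le> R" if "B' = lower B \<or> B' = upper B" for B' j
  proof -
    have i: "set_integrable lborel (ibox B) (\<lambda>x. \<bar>f j x\<bar>)" using set_integrable_abs[OF Suc.prems(2)] .
    have nn: "0 \<le> (LINT x:ibox B'|lborel. \<bar>f j x\<bar>)" for B'
      unfolding set_lebesgue_integral_def by (intro integral_nonneg_AE) auto
    show ?thesis using set_integral_split[OF Suc.prems(1) i] nn[of "lower B"] nn[of "upper B"] that Suc.prems(3)[of j] by auto
  qed
  have "\<exists>r. strict_mono r \<and> uniformly_Cauchy_on UNIV (\<lambda>j. dyadic_average k (f (r j)) (lower B))"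
    by (rule Suc.IH) (use Suc.prems le in \<open>simp_all add: fat_lower set_integrable_lower\<close>)
  then obtain r where r: "strict_mono r" "uniformly_Cauchy_on UNIV (\<lambda>j. dyadic_average k (f (r j)) (lower B))"
    by (elim exE conjE)
  have "\<exists>s. strict_mono s \<and> uniformly_Cauchy_on UNIV (\<lambda>j. dyadic_average k (f (r (s j))) (upper B))"
    by (rule Suc.IH[where f="\<lambda>j. f (r j)"]) (use Suc.prems le in \<open>simp_all add: fat_upper set_integrable_upper\<close>)
  then obtain s where s: "strict_mono s" "uniformly_Cauchy_on UNIV (\<lambda>j. dyadic_average k (f (r (s j))) (upper B))"
    by (elim exE conjE)
  have "uniformly_Cauchy_on UNIV (\<lambda>j. dyadic_average (Suc k) (f (r (s j))) B)"
    unfolding uniformly_Cauchy_on_def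
  proof (intro allI impI)
    fix e :: real assume e: "0 < e"
    obtain K1 where K1: "\<forall>x\<in>UNIV. \<forall>i\<ge>K1. \<forall>j\<ge>K1.
      dist (dyadic_average k (f (r i)) (lower B) x) (dyadic_average k (f (r j)) (lower B) x) < e"
      using r(2)[unfolded uniformly_Cauchy_on_def, rule_format, OF e] by (elim exE)
    obtain K2 where K2: "\<forall>x\<in>UNIV. \<forall>i\<ge>K2. \<forall>j\<ge>K2.
      dist (dyadic_average k (f (r (s i))) (upper B) x) (dyadic_average k (f (r (s j))) (upper B) x) < e"
      using s(2)[unfolded uniformly_Cauchy_on_def, rule_format, OF e] by (elim exE)
    show "\<exists>K. \<forall>x\<in>UNIV. \<forall>i\<ge>K. \<forall>j\<ge>K.
      dist (dyadic_average (Suc k) (f (r (s i))) B x) (dyadic_average (Suc k) (f (r (s j))) B x) < e"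
    proof (intro exI[of _ "max K1 K2"] allI ballI impI)
      fix i j x assume "max K1 K2 \<le> i" "max K1 K2 \<le> j"
      then have "K2 \<le> i" "K2 \<le> j" "K1 \<le> s i" "K1 \<le> s j"
        using seq_suble[OF s(1), of i] seq_suble[OF s(1), of j] by auto
      then show "dist (dyadic_average (Suc k) (f (r (s i))) B x) (dyadic_average (Suc k) (f (r (s j))) B x) < e"
        using K1 K2 by simp
    qed
  qed
  moreover have "strict_mono (\<lambda>i. r (s i))" using r(1) s(1) by (simp add: strict_mono_def)
  ultimately show ?case by (intro exI[of _ "\<lambda>i. r (s i)"] conjI)
qed

lemma powr_sum3_le:
  assumes "0 \<le> a" "0 \<le> b" "0 \<le> c" "0 \<le> (p::real)"
  shows "(a + b + c) powr p \<le> 3 powr p * (a powr p + b powr p + c powr p)"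
proof -
  define m where "m = max a (max b c)"
  have "(a + b + c) powr p \<le> (3 * m) powr p" using assms by (intro powr_mono2) (auto simp: m_def)
  also have "\<dots> = 3 powr p * m powr p" using assms by (simp add: powr_mult m_def)
  also have "m powr p \<le> a powr p + b powr p + c powr p"
    unfolding m_def max_def by simp
  finally show ?thesis by simp
qed

lemma nn_integral_powr_sum3_le:
  fixes u a b c :: "real^'n::finite \<Rightarrow> real"
  assumes p: "0 \<le> p" and [measurable]: "S \<in> sets borel" "a \<in> borel_measurable borel" "b \<in> borel_measurable borel" "c \<in> borel_measurable borel"
    and u: "\<And>x. \<bar>u x\<bar> \<le> \<bar>a x\<bar> + \<bar>b x\<bar> + \<bar>c x\<bar>"
  shows "(\<integral>\<^sup>+x\<in>S. ennreal (\<bar>u x\<bar> powr p) \<partial>lborel) \<le> ennreal (3 powr p) *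
    ((\<integral>\<^sup>+x\<in>S. ennreal (\<bar>a x\<bar> powr p) \<partial>lborel) + (\<integral>\<^sup>+x\<in>S. ennreal (\<bar>b x\<bar> powr p) \<partial>lborel) +
     (\<integral>\<^sup>+x\<in>S. ennreal (\<bar>c x\<bar> powr p) \<partial>lborel))"
proof -
  have "ennreal (\<bar>u x\<bar> powr p) \<le> ennreal (3 powr p) * (ennreal (\<bar>a x\<bar> powr p) + ennreal (\<bar>b x\<bar> powr p) + ennreal (\<bar>c x\<bar> powr p))" for x
  proof -
    have "\<bar>u x\<bar> powr p \<le> (\<bar>a x\<bar> + \<bar>b x\<bar> + \<bar>c x\<bar>) powr p" using u p by (intro powr_mono2) auto
    also have "\<dots> \<le> 3 powr p * (\<bar>a x\<bar> powr p + \<bar>b x\<bar> powr p + \<bar>c x\<bar> powr p)" using p by (intro powr_sum3_le) auto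
    finally have "ennreal (\<bar>u x\<bar> powr p) \<le> ennreal (3 powr p * (\<bar>a x\<bar> powr p + \<bar>b x\<bar> powr p + \<bar>c x\<bar> powr p))"
      by (rule ennreal_leI)
    then show ?thesis by (simp add: ennreal_mult')
  qed
  then have "(\<integral>\<^sup>+x\<in>S. ennreal (\<bar>u x\<bar> powr p) \<partial>lborel) \<le> (\<integral>\<^sup>+x. ennreal (3 powr p) *
      (ennreal (\<bar>a x\<bar> powr p) * indicator S x + ennreal (\<bar>b x\<bar> powr p) * indicator S x + ennreal (\<bar>c x\<bar> powr p) * indicator S x) \<partial>lborel)"
    by (intro nn_integral_mono) (simp add: indicator_def)
  also have "\<dots> = ennreal (3 powr p) * (\<integral>\<^sup>+x. ennreal (\<bar>a x\<bar> powr p) * indicator S x +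
      ennreal (\<bar>b x\<bar> powr p) * indicator S x + ennreal (\<bar>c x\<bar> powr p) * indicator S x \<partial>lborel)"
    by (rule nn_integral_cmult) measurable
  finally show ?thesis by (simp add: nn_integral_add)
qed

text \<open>Functions are compared through their averages \<open>E\<^sub>m\<close>: the two tails are uniformly small by \<open>dyadic_average_tail\<close>, and
for fixed \<open>m\<close> the averages have a uniformly Cauchy subsequence. For the bound, \<open>m = 0\<close> suffices.\<close>

lemma sobolev_ball_precompact:
  fixes B :: "'n::finite cell"
  assumes B: "fat B" and q: "1 \<le> q" "q \<le> p" and sub: "p * (1/q - 1 / real CARD('n)) < 1"
  shows "\<exists>C\<ge>0. \<forall>f\<in>sobolev_ball q B R. (\<integral>\<^sup>+x\<in>ibox B. ennreal (\<bar>f x\<bar> powr p) \<partial>lborel) \<le> ennreal C"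
    and "0 < e \<Longrightarrow> (\<And>j::nat. f j \<in> sobolev_ball q B R) \<Longrightarrow> \<exists>r::nat \<Rightarrow> nat. strict_mono r \<and>
      (\<forall>i j. (\<integral>\<^sup>+x\<in>ibox B. ennreal (\<bar>f (r i) x - f (r j) x\<bar> powr p) \<partial>lborel) \<le> ennreal e)"
proof -
  let ?S = "ibox B"
  have v: "0 < vol B" by (rule vol_pos[OF B])
  have p: "0 \<le> p" "0 < p / q" using q by auto
  obtain D \<theta> where \<theta>: "0 < \<theta>" "\<theta> < 1" and D: "0 \<le> D" and
    tail: "\<forall>f\<in>sobolev_ball q B R. \<forall>m. (\<integral>\<^sup>+x\<in>?S. ennreal (\<bar>f x - dyadic_average m f B x\<bar> powr p) \<partial>lborel)
         \<le> ennreal (D * \<theta> ^ m)"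
    by (rule dyadic_average_tail[OF assms])
  note tail' = tail[rule_format]
  show "\<exists>C\<ge>0. \<forall>f\<in>sobolev_ball q B R. (\<integral>\<^sup>+x\<in>?S. ennreal (\<bar>f x\<bar> powr p) \<partial>lborel) \<le> ennreal C"
  proof (intro exI[of _ "3 powr p * (D + (\<bar>R\<bar> / vol B) powr p * vol B)"] conjI ballI)
    fix f assume fS: "f \<in> sobolev_ball q B R"
    then have [measurable]: "f \<in> borel_measurable borel" and f: "set_integrable lborel ?S f" "(LINT x:?S|lborel. \<bar>f x\<bar>) \<le> R"
      by (auto simp: sobolev_ball_def)
    have avg: "\<bar>average f B\<bar> \<le> \<bar>R\<bar> / vol B"
    proof -
      have "\<bar>LINT x:?S|lborel. f x\<bar> \<le> \<bar>R\<bar>" using set_integral_norm_bound[OF f(1)] f(2) by simp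
      then show ?thesis using v by (simp add: average_def divide_right_mono)
    qed
    let ?E = "dyadic_average 0 f B"
    have "(\<integral>\<^sup>+x\<in>?S. ennreal (\<bar>f x\<bar> powr p) \<partial>lborel) \<le> ennreal (3 powr p) *
      ((\<integral>\<^sup>+x\<in>?S. ennreal (\<bar>f x - ?E x\<bar> powr p) \<partial>lborel) + (\<integral>\<^sup>+x\<in>?S. ennreal (\<bar>\<bar>R\<bar> / vol B\<bar> powr p) \<partial>lborel) +
       (\<integral>\<^sup>+x\<in>?S. ennreal (\<bar>0\<bar> powr p) \<partial>lborel))"
    proof (rule nn_integral_powr_sum3_le[OF p(1)])
      show "\<bar>f x\<bar> \<le> \<bar>f x - ?E x\<bar> + \<bar>\<bar>R\<bar> / vol B\<bar> + \<bar>0\<bar>" for x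
      proof -
        have "?E x = average f B" by simp
        then show ?thesis using avg by linarith
      qed
    qed measurable
    also have "\<dots> = ennreal (3 powr p) * ((\<integral>\<^sup>+x\<in>?S. ennreal (\<bar>f x - ?E x\<bar> powr p) \<partial>lborel) +
        ennreal ((\<bar>R\<bar> / vol B) powr p * vol B))"
      using v by (simp add: nn_integral_const_cell[OF B] ennreal_mult')
    also have "\<dots> \<le> ennreal (3 powr p) * (ennreal D + ennreal ((\<bar>R\<bar> / vol B) powr p * vol B))"
      using tail'[OF fS, of 0] by (intro mult_left_mono add_right_mono) simp_all
    also have "\<dots> = ennreal (3 powr p) * ennreal (D + (\<bar>R\<bar> / vol B) powr p * vol B)"
      using D v by (subst ennreal_plus) auto
    also have "\<dots> = ennreal (3 powr p * (D + (\<bar>R\<bar> / vol B) powr p * vol B))"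
      by (rule ennreal_mult'[symmetric]) simp
    finally show "(\<integral>\<^sup>+x\<in>?S. ennreal (\<bar>f x\<bar> powr p) \<partial>lborel) \<le> ennreal (3 powr p * (D + (\<bar>R\<bar> / vol B) powr p * vol B))" .
  qed (use D v in auto)
  show "\<exists>r::nat \<Rightarrow> nat. strict_mono r \<and> (\<forall>i j. (\<integral>\<^sup>+x\<in>?S. ennreal (\<bar>f (r i) x - f (r j) x\<bar> powr p) \<partial>lborel) \<le> ennreal e)"
    if e: "0 < e" and fS: "\<And>j::nat. f j \<in> sobolev_ball q B R" for e f
  proof -
    have [measurable]: "f j \<in> borel_measurable borel" for j using fS[of j] by (simp add: sobolev_ball_def)
    have f: "set_integrable lborel ?S (f j)" "(LINT x:?S|lborel. \<bar>f j x\<bar>) \<le> R" for j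
      using fS[of j] by (simp_all add: sobolev_ball_def)
    define e' where "e' = e / (3 powr p * 3)"
    have e': "0 < e'" using e by (simp add: e'_def)
    have "(\<lambda>m. D * \<theta> ^ m) \<longlonglongrightarrow> D * 0" using \<theta> by (intro tendsto_mult tendsto_const LIMSEQ_realpow_zero) auto
    then have "\<forall>\<^sub>F m in sequentially. D * \<theta> ^ m < e'" using e' by (intro order_tendstoD(2)) auto
    then obtain m where m: "D * \<theta> ^ m < e'" by (meson eventually_sequentially order_refl)
    \<comment> \<open>the constant \<open>d\<close> has \<open>p\<close>-th power integral \<open>d^p vol B = e'\<close> over the cell\<close>
    define d where "d = (e' / vol B) powr (1 / p)"
    have d: "0 < d" "d powr p * vol B = e'" using e' v p q by (auto simp: d_def powr_powr)
    have "\<exists>r. strict_mono r \<and> uniformly_Cauchy_on UNIV (\<lambda>j. dyadic_average m (f (r j)) B)"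
      by (rule dyadic_average_compact[OF B f])
    then obtain r where r: "strict_mono r" "uniformly_Cauchy_on UNIV (\<lambda>j. dyadic_average m (f (r j)) B)"
      by (elim exE conjE)
    obtain K where K: "\<forall>x\<in>UNIV. \<forall>i\<ge>K. \<forall>j\<ge>K. dist (dyadic_average m (f (r i)) B x) (dyadic_average m (f (r j)) B x) < d"
      using r(2)[unfolded uniformly_Cauchy_on_def, rule_format, OF d(1)] by (elim exE)
    show ?thesis
    proof (intro exI[of _ "\<lambda>i. r (i + K)"] conjI allI)
      show "strict_mono (\<lambda>i. r (i + K))" using r(1) by (simp add: strict_mono_def)
      fix i j
      define u where "u = f (r (i + K))"
      define w where "w = f (r (j + K))"
      have [measurable]: "u \<in> borel_measurable borel" "w \<in> borel_measurable borel" by (simp_all add: u_def w_def)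
      let ?E = "dyadic_average m"
      have c: "\<bar>?E u B x - ?E w B x\<bar> \<le> d" for x using K unfolding u_def w_def by (simp add: dist_real_def less_imp_le)
      have "(\<integral>\<^sup>+x\<in>?S. ennreal (\<bar>u x - w x\<bar> powr p) \<partial>lborel) \<le> ennreal (3 powr p) *
        ((\<integral>\<^sup>+x\<in>?S. ennreal (\<bar>u x - ?E u B x\<bar> powr p) \<partial>lborel) + (\<integral>\<^sup>+x\<in>?S. ennreal (\<bar>d\<bar> powr p) \<partial>lborel) +
         (\<integral>\<^sup>+x\<in>?S. ennreal (\<bar>w x - ?E w B x\<bar> powr p) \<partial>lborel))"
      proof (rule nn_integral_powr_sum3_le[OF p(1)])
        show "\<bar>u x - w x\<bar> \<le> \<bar>u x - ?E u B x\<bar> + \<bar>d\<bar> + \<bar>w x - ?E w B x\<bar>" for x using c[of x] by linarith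
      qed measurable
      also have "\<dots> \<le> ennreal (3 powr p) * (ennreal e' + ennreal e' + ennreal e')"
      proof (intro mult_left_mono add_mono)
        have le: "ennreal (D * \<theta> ^ m) \<le> ennreal e'" using m by (simp add: ennreal_leI)
        show "(\<integral>\<^sup>+x\<in>?S. ennreal (\<bar>u x - ?E u B x\<bar> powr p) \<partial>lborel) \<le> ennreal e'"
          unfolding u_def by (rule order_trans[OF tail'[OF fS] le])
        show "(\<integral>\<^sup>+x\<in>?S. ennreal (\<bar>w x - ?E w B x\<bar> powr p) \<partial>lborel) \<le> ennreal e'"
          unfolding w_def by (rule order_trans[OF tail'[OF fS] le])
        have "(\<integral>\<^sup>+x\<in>?S. ennreal (\<bar>d\<bar> powr p) \<partial>lborel) = ennreal (d powr p) * ennreal (vol B)"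
          using d(1) by (simp add: nn_integral_const_cell[OF B])
        also have "\<dots> = ennreal e'" unfolding d(2)[symmetric] by (rule ennreal_mult'[symmetric]) simp
        finally show "(\<integral>\<^sup>+x\<in>?S. ennreal (\<bar>d\<bar> powr p) \<partial>lborel) \<le> ennreal e'" by simp
      qed simp
      also have "ennreal e' + ennreal e' + ennreal e' = ennreal (3 * e')" using e' by (simp flip: ennreal_plus)
      also have "ennreal (3 powr p) * ennreal (3 * e') = ennreal e"
        by (subst ennreal_mult'[symmetric]) (simp_all add: e'_def)
      finally show "(\<integral>\<^sup>+x\<in>?S. ennreal (\<bar>f (r (i + K)) x - f (r (j + K)) x\<bar> powr p) \<partial>lborel) \<le> ennreal e"
        by (simp add: u_def w_def)
    qed
  qed
qed

section \<open>Volume and gradient in a chart\<close>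

context
  fixes M :: "('a, 'n::{finite,wellorder}) riemannian_space"
  assumes M: "riemannian_manifold M"
begin

lemma sets_volume: "sets (riemannian_volume M) = sets (borel_of_manifold M)"
  using is_riemannian_volume_riemannian_volume[OF M] by (simp add: is_riemannian_volume_def)

lemma space_volume: "space (riemannian_volume M) = topspace (mtop M)"
  using sets_eq_imp_space_eq[OF sets_volume] space_borel_of_manifold[OF M] by simp

lemma chart_inv_mem: "y \<in> chart_image c \<Longrightarrow> chart_inv c y \<in> fst c"
  by (auto simp: chart_inv_def chart_image_def inv_into_into)

lemma chart_inv_right: "y \<in> chart_image c \<Longrightarrow> snd c (chart_inv c y) = y"
  by (auto simp: chart_inv_def chart_image_def f_inv_into_f)

lemma chart_inv_measurable_volume:
  "c \<in> atlas M \<Longrightarrow> chart_inv c \<in> measurable (restrict_space borel (chart_image c)) (riemannian_volume M)"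
  using chart_inv_measurable[OF M] measurable_cong_sets[OF refl sets_volume] by blast

lemma chart_comp_measurable:
  fixes f :: "'a \<Rightarrow> 'b::{second_countable_topology, topological_space}"
  assumes "c \<in> atlas M" "f \<in> borel_measurable (riemannian_volume M)"
  shows "(\<lambda>y. f (chart_inv c y)) \<in> borel_measurable (restrict_space borel (chart_image c))"
  using measurable_compose[OF chart_inv_measurable_volume assms(2)] assms(1) by simp

text \<open>The defining property of the volume on measurable subsets of the chart domain says that its restriction to the domain
is the image of a density on the chart image; integrals of functions follow.\<close>

lemma nn_integral_chart:
  assumes c: "c \<in> atlas M" and F: "F \<in> borel_measurable (riemannian_volume M)"
  shows "(\<integral>\<^sup>+x\<in>fst c. F x \<partial>riemannian_volume M) =
    (\<integral>\<^sup>+y\<in>chart_image c. F (chart_inv c y) * ennreal (volume_density M c y) \<partial>lborel)"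
proof -
  let ?\<mu> = "riemannian_volume M" and ?I = "chart_image c"
  let ?d = "\<lambda>y. ennreal (volume_density M c y)"
  have I: "?I \<in> sets borel" by (rule chart_image_borel[OF M c])
  have cs: "fst c \<in> sets ?\<mu>" unfolding sets_volume by (rule openin_sets[OF M chart_open[OF M c]])
  have s: "sets (restrict_space lborel ?I) = sets (restrict_space borel ?I)" by (simp add: sets_restrict_space)
  have inv: "chart_inv c \<in> measurable (restrict_space lborel ?I) ?\<mu>"
    unfolding measurable_cong_sets[OF s refl] by (rule chart_inv_measurable_volume[OF c])
  have d: "?d \<in> borel_measurable (restrict_space lborel ?I)"
    unfolding measurable_cong_sets[OF s refl]
    by (intro measurable_compose[OF _ measurable_ennreal]
        borel_measurable_continuous_on_restrict[OF volume_density_continuous[OF M c]])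
  have e: "density ?\<mu> (indicator (fst c)) = distr (density (restrict_space lborel ?I) ?d) ?\<mu> (chart_inv c)"
  proof (rule measure_eqI)
    fix A assume "A \<in> sets (density ?\<mu> (indicator (fst c)))"
    then have A: "A \<in> sets ?\<mu>" by simp
    have im: "snd c ` (A \<inter> fst c) = chart_inv c -` A \<inter> ?I"
      by (auto simp: chart_image_def chart_inv_left[OF M c])
    have pre: "chart_inv c -` A \<inter> ?I \<in> sets (restrict_space lborel ?I)"
      using measurable_sets[OF inv A] by (simp add: space_restrict_space)
    have "emeasure (density ?\<mu> (indicator (fst c))) A = emeasure ?\<mu> (A \<inter> fst c)"
    proof -
      have "emeasure (density ?\<mu> (indicator (fst c))) A = (\<integral>\<^sup>+x. indicator (fst c) x * indicator A x \<partial>?\<mu>)"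
        by (rule emeasure_density) (use A cs in auto)
      also have "\<dots> = (\<integral>\<^sup>+x. indicator (A \<inter> fst c) x \<partial>?\<mu>)"
        by (rule nn_integral_cong) (auto simp: indicator_def)
      also have "\<dots> = emeasure ?\<mu> (A \<inter> fst c)" using A cs by (intro nn_integral_indicator) auto
      finally show ?thesis .
    qed
    also have "\<dots> = (\<integral>\<^sup>+y\<in>snd c ` (A \<inter> fst c). ?d y \<partial>lborel)"
      using is_riemannian_volume_riemannian_volume[OF M] c A cs by (auto simp: is_riemannian_volume_def)
    also have "\<dots> = (\<integral>\<^sup>+y. ?d y * indicator (chart_inv c -` A \<inter> ?I) y * indicator ?I y \<partial>lborel)"
      unfolding im by (rule nn_integral_cong) (auto simp: indicator_def)
    also have "\<dots> = (\<integral>\<^sup>+y. ?d y * indicator (chart_inv c -` A \<inter> ?I) y \<partial>restrict_space lborel ?I)"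
      using I by (simp add: nn_integral_restrict_space)
    also have "\<dots> = emeasure (density (restrict_space lborel ?I) ?d) (chart_inv c -` A \<inter> ?I)"
      by (rule emeasure_density[OF d pre, symmetric])
    also have "\<dots> = emeasure (distr (density (restrict_space lborel ?I) ?d) ?\<mu> (chart_inv c)) A"
      using inv A by (subst emeasure_distr) (auto simp: space_restrict_space)
    finally show "emeasure (density ?\<mu> (indicator (fst c))) A =
      emeasure (distr (density (restrict_space lborel ?I) ?d) ?\<mu> (chart_inv c)) A" .
  qed simp
  have "(\<integral>\<^sup>+x\<in>fst c. F x \<partial>?\<mu>) = (\<integral>\<^sup>+x. F x \<partial>density ?\<mu> (indicator (fst c)))"
    using F cs by (simp add: nn_integral_density mult.commute)
  also have "\<dots> = (\<integral>\<^sup>+y. F (chart_inv c y) \<partial>density (restrict_space lborel ?I) ?d)"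
    unfolding e using inv F by (intro nn_integral_distr) auto
  also have "\<dots> = (\<integral>\<^sup>+y. ?d y * F (chart_inv c y) \<partial>restrict_space lborel ?I)"
    using d measurable_compose[OF inv F] by (intro nn_integral_density) auto
  also have "\<dots> = (\<integral>\<^sup>+y\<in>?I. F (chart_inv c y) * ?d y \<partial>lborel)"
    using I by (simp add: nn_integral_restrict_space mult.commute)
  finally show ?thesis .
qed

lemma volume_density_pos:
  assumes c: "c \<in> atlas M" "y \<in> chart_image c"
  shows "0 < volume_density M c y"
proof -
  let ?g = "metric M c (chart_inv c y)"
  have pd: "0 < v \<bullet> (?g *v v)" if "v \<noteq> 0" for v
    using M c(1) chart_inv_mem[OF c(2)] that unfolding riemannian_manifold_def by blast
  have "det ?g \<noteq> 0"
  proof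
    assume "det ?g = 0"
    then have "\<not> invertible ?g" using invertible_det_nz by blast
    then obtain v where "v \<noteq> 0" "?g *v v = 0"
      unfolding invertible_left_inverse matrix_left_invertible_ker by blast
    then show False using pd[of v] by simp
  qed
  then show ?thesis
    using metric_det_pos[OF M c(1) chart_inv_mem[OF c(2)]] by (simp add: volume_density_def)
qed

lemma quadratic_form_Cauchy_Schwarz:
  fixes g :: "real^'m^'m"
  assumes sym: "transpose g = g" and pd: "\<And>v. v \<noteq> 0 \<Longrightarrow> 0 < v \<bullet> (g *v v)"
  shows "\<bar>a \<bullet> (g *v b)\<bar> \<le> sqrt (a \<bullet> (g *v a)) * sqrt (b \<bullet> (g *v b))"
proof (cases "b = 0")
  case False
  have nn: "0 \<le> v \<bullet> (g *v v)" for v using pd[of v] by (cases "v = 0") auto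
  have s: "b \<bullet> (g *v a) = a \<bullet> (g *v b)"
    by (metis dot_lmul_matrix inner_commute sym transpose_matrix_vector)
  \<comment> \<open>\<open>t b\<close> is the projection of \<open>a\<close> onto \<open>b\<close> with respect to \<open>g\<close>\<close>
  define t where "t = (a \<bullet> (g *v b)) / (b \<bullet> (g *v b))"
  have bb: "0 < b \<bullet> (g *v b)" using pd False by blast
  have "0 \<le> (a - t *\<^sub>R b) \<bullet> (g *v (a - t *\<^sub>R b))" by (rule nn)
  also have "\<dots> = a \<bullet> (g *v a) - 2 * t * (a \<bullet> (g *v b)) + t * t * (b \<bullet> (g *v b))"
    by (simp add: matrix_vector_mult_diff_distrib matrix_vector_mult_scaleR inner_diff_left inner_diff_right s algebra_simps)
  also have "\<dots> = a \<bullet> (g *v a) - (a \<bullet> (g *v b))\<^sup>2 / (b \<bullet> (g *v b))"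
    using bb by (simp add: t_def field_simps power2_eq_square)
  finally have "(a \<bullet> (g *v b))\<^sup>2 \<le> (a \<bullet> (g *v a)) * (b \<bullet> (g *v b))" using bb by (simp add: field_simps)
  then have "sqrt ((a \<bullet> (g *v b))\<^sup>2) \<le> sqrt ((a \<bullet> (g *v a)) * (b \<bullet> (g *v b)))" by (rule real_sqrt_le_mono)
  then show ?thesis by (simp add: real_sqrt_mult)
qed simp

text \<open>The transformation laws of the metric and of the components cancel, so the length may be computed in any chart
around the point and not only in the one selected by \<open>chart_at\<close>.\<close>

lemma field_norm_chart:
  assumes V: "measurable_vector_field M V" and c: "c \<in> atlas M" "x \<in> fst c"
  shows "field_norm M V x = sqrt (V c x \<bullet> (metric M c x *v V c x))"
proof -
  define d where "d = chart_at M x"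
  have "d \<in> atlas M \<and> x \<in> fst d" unfolding d_def chart_at_def by (rule someI[of _ c]) (use c in auto)
  then have d: "d \<in> atlas M" "x \<in> fst d" by auto
  let ?J = "transition_jacobian c d x"
  have Vd: "V d x = ?J *v V c x" using V c d unfolding measurable_vector_field_def by blast
  have "metric M c x = transpose ?J ** metric M d x ** ?J"
    using M c d unfolding riemannian_manifold_def by blast
  then have "V c x \<bullet> (metric M c x *v V c x) = V c x \<bullet> (transpose ?J *v (metric M d x *v V d x))"
    by (simp add: Vd matrix_vector_mul_assoc matrix_mul_assoc)
  also have "\<dots> = V d x \<bullet> (metric M d x *v V d x)"
    by (metis Vd dot_lmul_matrix inner_commute transpose_matrix_vector transpose_transpose)
  finally show ?thesis by (simp add: field_norm_def Let_def d_def[symmetric])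
qed

text \<open>The left-hand side is a coordinate derivative \<open>\<partial>\<^sub>i u = g(\<nabla>u, e\<^sub>i)\<close> when \<open>V\<close> is the gradient; the bound is the
Cauchy-Schwarz inequality for \<open>g\<close> applied to \<open>V\<close> and \<open>e\<^sub>i\<close>.\<close>

lemma gradient_component_le:
  assumes V: "measurable_vector_field M V" and c: "c \<in> atlas M" "x \<in> fst c"
  shows "\<bar>(metric M c x *v V c x) $ i\<bar> \<le> sqrt (metric M c x $ i $ i) * field_norm M V x"
proof -
  let ?g = "metric M c x"
  have g: "transpose ?g = ?g" "\<And>v. v \<noteq> 0 \<Longrightarrow> 0 < v \<bullet> (?g *v v)"
    using M c unfolding riemannian_manifold_def by blast+
  have "(?g *v V c x) $ i = axis i 1 \<bullet> (?g *v V c x)" by (simp add: inner_axis')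
  moreover have "axis i 1 \<bullet> (?g *v axis i 1) = ?g $ i $ i"
    by (simp add: inner_axis' matrix_vector_mult_basis column_def)
  ultimately show ?thesis
    using quadratic_form_Cauchy_Schwarz[OF g, of "axis i 1" "V c x"] by (simp add: field_norm_chart[OF V c])
qed

end

section \<open>Boxes in charts\<close>

text \<open>In a half-space the cube around \<open>y\<close> is cut off at the boundary hyperplane. At least half of the cube remains in that
direction since \<open>y\<close> belongs to the half-space, so the truncated box is still fat.\<close>

lemma fat_cell_near:
  fixes W :: "(real^'n::{finite,wellorder}) set"
  assumes W: "open W \<or> openin (top_of_set half_space) W" and y: "y \<in> W"
  obtains B T where "fat B" "open T" "y \<in> T" "cbox (fst B) (snd B) \<subseteq> W"
    "AE x in lborel. x \<in> W \<inter> T \<longrightarrow> x \<in> ibox B"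
proof -
  define k :: 'n where "k = (LEAST i. True)"
  define lo where "lo r = y - (\<chi> j. r)" for r
  define hi where "hi r = y + (\<chi> j. r)" for r
  have cball: "cbox (lo r) (hi r) \<subseteq> cball y (real CARD('n) * r)" for r
  proof
    fix x assume "x \<in> cbox (lo r) (hi r)"
    then have "lo r $ j \<le> x $ j \<and> x $ j \<le> hi r $ j" for j by (simp add: mem_box_cart)
    then have "\<bar>(y - x) $ j\<bar> \<le> r" for j by (simp add: lo_def hi_def abs_le_iff) (smt (verit))
    then have "(\<Sum>j\<in>UNIV. \<bar>(y - x) $ j\<bar>) \<le> (\<Sum>j\<in>(UNIV::'n set). r)" by (intro sum_mono)
    then show "x \<in> cball y (real CARD('n) * r)"
      using norm_le_l1_cart[of "y - x"] by (simp add: dist_norm)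
  qed
  obtain T0 where T0: "open T0" "y \<in> T0" "T0 \<subseteq> W \<or> (W = half_space \<inter> T0)"
    using W y by (auto simp: openin_open)
  then obtain e where e: "0 < e" "cball y e \<subseteq> T0" by (auto simp: open_contains_cball)
  define r where "r = e / real CARD('n)"
  have r: "0 < r" "real CARD('n) * r = e" using e by (auto simp: r_def)
  have sub: "cbox (lo r) (hi r) \<subseteq> T0" using cball[of r] e(2) r(2) by auto
  have T: "open (box (lo r) (hi r))" "y \<in> box (lo r) (hi r)"
    using r by (auto simp: mem_box_cart lo_def hi_def)
  show thesis
  proof (cases "T0 \<subseteq> W")
    case True
    show thesis
    proof (rule that[of "(lo r, hi r)", OF _ T])
      show "fat (lo r, hi r)" using r by (simp add: fat_def side_def lo_def hi_def)
      show "cbox (fst (lo r, hi r)) (snd (lo r, hi r)) \<subseteq> W" using sub True by simp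
    qed simp
  next
    case False
    then have Weq: "W = half_space \<inter> T0" using T0(3) by blast
    have yk: "0 \<le> y $ k" using y Weq by (simp add: half_space_def k_def)
    \<comment> \<open>the lower corner is raised to the boundary hyperplane if it lies below\<close>
    define a where "a = vec_upd (lo r) k (max 0 (lo r $ k))"
    show thesis
    proof (rule that[of "(a, hi r)", OF _ T])
      have s: "r \<le> side (a, hi r) j \<and> side (a, hi r) j \<le> 2 * r" for j
        using r yk by (auto simp: side_def a_def lo_def hi_def)
      show "fat (a, hi r)" unfolding fat_def using s r by (smt (verit))
      have "cbox a (hi r) \<subseteq> half_space"
      proof
        fix x assume "x \<in> cbox a (hi r)"
        then have "a $ k \<le> x $ k" by (simp add: mem_box_cart)
        then show "x \<in> half_space" by (simp add: half_space_def a_def flip: k_def)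
      qed
      moreover have "cbox a (hi r) \<subseteq> cbox (lo r) (hi r)"
      proof
        fix x assume x: "x \<in> cbox a (hi r)"
        have "lo r $ j \<le> a $ j" for j by (simp add: a_def)
        then show "x \<in> cbox (lo r) (hi r)" using x unfolding mem_box_cart by (meson order_trans)
      qed
      ultimately show "cbox (fst (a, hi r)) (snd (a, hi r)) \<subseteq> W" using sub by (simp add: Weq)
      show "AE x in lborel. x \<in> W \<inter> box (lo r) (hi r) \<longrightarrow> x \<in> ibox (a, hi r)"
        using AE_hyperplane[of k 0]
      proof (eventually_elim, intro impI)
        fix x assume "x $ k \<noteq> 0" "x \<in> W \<inter> box (lo r) (hi r)"
        moreover from this have "0 \<le> x $ k" by (simp add: Weq half_space_def k_def)
        ultimately show "x \<in> ibox (a, hi r)" by (simp add: mem_box_cart a_def)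
      qed
    qed
  qed
qed

definition modular :: "('a, 'n::{finite,wellorder}) riemannian_space \<Rightarrow> ('a \<Rightarrow> real) \<Rightarrow> ('a \<Rightarrow> real) \<Rightarrow> ennreal" where
  "modular M r w = (\<integral>\<^sup>+x. ennreal (\<bar>w x\<bar> powr r x) \<partial>riemannian_volume M)"

text \<open>Formulated with some weak gradient, so that it is visibly stable under the rescaling that normalizes a function.\<close>

definition unit_sobolev :: "('a, 'n::{finite,wellorder}) riemannian_space \<Rightarrow> ('a \<Rightarrow> real) \<Rightarrow> ('a \<Rightarrow> real) set" where
  "unit_sobolev M q = {w \<in> borel_measurable (riemannian_volume M). modular M q w \<le> 1 \<and>
     (\<exists>V. is_weak_gradient M w V \<and> field_norm M V \<in> borel_measurable (riemannian_volume M) \<and>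
        modular M q (field_norm M V) \<le> 1)}"

text \<open>The coordinate expression of \<open>w\<close>, cut off outside the cell so that it is measurable on the whole space.\<close>

definition transplant :: "('a, 'n::finite) chart \<Rightarrow> 'n cell \<Rightarrow> ('a \<Rightarrow> real) \<Rightarrow> real^'n \<Rightarrow> real" where
  "transplant c B w y = (if y \<in> ibox B then w (chart_inv c y) else 0)"

lemma powr_le_1_plus:
  assumes "0 \<le> t" "0 \<le> a" "a \<le> (b::real)"
  shows "t powr a \<le> 1 + t powr b"
proof (cases "t \<le> 1")
  case True
  then have "t powr a \<le> 1 powr a" using assms by (intro powr_mono2) auto
  then show ?thesis by (simp add: add_increasing2)
next
  case False
  then have "t powr a \<le> t powr b" using assms by (intro powr_mono) auto
  then show ?thesis by simp
qed

lemma nn_integral_cell_dominated: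
  fixes h :: "real^'n::finite \<Rightarrow> real" and F :: "real^'n \<Rightarrow> ennreal"
  assumes B: "fat B" and h: "(\<lambda>y. indicator (ibox B) y *\<^sub>R h y) \<in> borel_measurable borel"
    and F: "(\<lambda>y. F y * indicator (ibox B) y) \<in> borel_measurable borel"
    and FS: "(\<integral>\<^sup>+y\<in>ibox B. F y \<partial>lborel) \<le> ennreal s" and 0: "0 \<le> a" "0 \<le> b" "0 \<le> s"
    and le: "\<And>y. y \<in> ibox B \<Longrightarrow> ennreal \<bar>h y\<bar> \<le> ennreal a + ennreal b * F y"
  shows "set_integrable lborel (ibox B) h"
    and "(LINT y:ibox B|lborel. \<bar>h y\<bar>) \<le> a * vol B + b * s"
proof -
  let ?S = "ibox B"
  have v: "0 < vol B" by (rule vol_pos[OF B])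
  have e: "ennreal (norm (indicator ?S y *\<^sub>R h y)) = ennreal \<bar>h y\<bar> * indicator ?S y" for y
    by (simp add: indicator_def)
  have "(\<integral>\<^sup>+y\<in>?S. ennreal \<bar>h y\<bar> \<partial>lborel) \<le> (\<integral>\<^sup>+y. ennreal a * indicator ?S y + ennreal b * (F y * indicator ?S y) \<partial>lborel)"
    using le by (intro nn_integral_mono) (simp add: indicator_def)
  also have "\<dots> = (\<integral>\<^sup>+y. ennreal a * indicator ?S y \<partial>lborel) + (\<integral>\<^sup>+y. ennreal b * (F y * indicator ?S y) \<partial>lborel)"
    by (rule nn_integral_add) (use F in measurable)
  also have "\<dots> = ennreal a * ennreal (vol B) + ennreal b * (\<integral>\<^sup>+y\<in>?S. F y \<partial>lborel)"
    using F by (simp add: nn_integral_const_cell[OF B] nn_integral_cmult)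
  also have "\<dots> \<le> ennreal a * ennreal (vol B) + ennreal b * ennreal s"
    using FS by (intro add_left_mono mult_left_mono) auto
  also have "\<dots> = ennreal (a * vol B + b * s)"
    using 0 v by (subst ennreal_plus) (auto simp: ennreal_mult)
  finally have fin: "(\<integral>\<^sup>+y\<in>?S. ennreal \<bar>h y\<bar> \<partial>lborel) \<le> ennreal (a * vol B + b * s)" .
  show i: "set_integrable lborel ?S h"
    unfolding set_integrable_def
  proof (rule integrableI_bounded)
    show "(\<integral>\<^sup>+y. ennreal (norm (indicator ?S y *\<^sub>R h y)) \<partial>lborel) < \<infinity>"
      unfolding e using fin by (rule order.strict_trans1) simp
  qed (use h in simp)
  have "ennreal (LINT y:?S|lborel. \<bar>h y\<bar>) = (\<integral>\<^sup>+y\<in>?S. ennreal \<bar>h y\<bar> \<partial>lborel)"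
  proof -
    have "ennreal (LINT y|lborel. norm (indicator ?S y *\<^sub>R h y)) = (\<integral>\<^sup>+y. ennreal (norm (indicator ?S y *\<^sub>R h y)) \<partial>lborel)"
      using i unfolding set_integrable_def by (intro nn_integral_eq_integral[symmetric] integrable_norm) auto
    moreover have "norm (indicator ?S y *\<^sub>R h y) = indicator ?S y *\<^sub>R \<bar>h y\<bar>" for y by (simp add: indicator_def)
    ultimately show ?thesis unfolding e by (simp add: set_lebesgue_integral_def)
  qed
  then have "ennreal (LINT y:?S|lborel. \<bar>h y\<bar>) \<le> ennreal (a * vol B + b * s)" using fin by (simp only:)
  then show "(LINT y:?S|lborel. \<bar>h y\<bar>) \<le> a * vol B + b * s"
    using 0 v by (subst (asm) ennreal_le_iff) auto
qed

context
  fixes M :: "('a, 'n::{finite,wellorder}) riemannian_space"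
  assumes M: "riemannian_manifold M"
begin

lemma continuous_map_measurable:
  assumes "continuous_map (mtop M) euclideanreal r"
  shows "r \<in> borel_measurable (riemannian_volume M)"
proof (rule borel_measurableI)
  fix S :: "real set" assume "open S"
  then have "openin (mtop M) {x \<in> topspace (mtop M). r x \<in> S}"
    using assms by (auto intro: openin_continuous_map_preimage)
  moreover have "r -` S \<inter> space (riemannian_volume M) = {x \<in> topspace (mtop M). r x \<in> S}"
    by (auto simp: space_volume[OF M])
  ultimately show "r -` S \<inter> space (riemannian_volume M) \<in> sets (riemannian_volume M)"
    using openin_sets[OF M] by (simp add: sets_volume[OF M])
qed

lemma nn_integral_cell_le_volume:
  assumes c: "c \<in> atlas M" and sub: "ibox B \<subseteq> chart_image c"
    and d0: "0 < d0" "\<And>y. y \<in> ibox B \<Longrightarrow> d0 \<le> volume_density M c y"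
    and F: "F \<in> borel_measurable (riemannian_volume M)"
  shows "(\<lambda>y. F (chart_inv c y) * indicator (ibox B) y) \<in> borel_measurable borel"
    and "(\<integral>\<^sup>+y\<in>ibox B. F (chart_inv c y) \<partial>lborel) \<le> ennreal (1 / d0) * (\<integral>\<^sup>+x. F x \<partial>riemannian_volume M)"
proof -
  let ?S = "ibox B"
  have "(\<lambda>y. F (chart_inv c y)) \<in> borel_measurable (restrict_space borel ?S)"
    using chart_comp_measurable[OF M c F] sub by (rule measurable_restrict_mono)
  then show m: "(\<lambda>y. F (chart_inv c y) * indicator ?S y) \<in> borel_measurable borel"
    by (subst (asm) borel_measurable_restrict_space_iff_ennreal) auto
  have "ennreal d0 * (\<integral>\<^sup>+y\<in>?S. F (chart_inv c y) \<partial>lborel) = (\<integral>\<^sup>+y. ennreal d0 * (F (chart_inv c y) * indicator ?S y) \<partial>lborel)"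
    using m by (intro nn_integral_cmult[symmetric]) simp
  also have "\<dots> \<le> (\<integral>\<^sup>+y\<in>chart_image c. F (chart_inv c y) * ennreal (volume_density M c y) \<partial>lborel)"
  proof (rule nn_integral_mono)
    fix y
    show "ennreal d0 * (F (chart_inv c y) * indicator ?S y) \<le> F (chart_inv c y) * ennreal (volume_density M c y) * indicator (chart_image c) y"
    proof (cases "y \<in> ?S")
      case True
      then have "ennreal d0 * F (chart_inv c y) \<le> ennreal (volume_density M c y) * F (chart_inv c y)"
        using d0 by (intro mult_right_mono ennreal_leI) auto
      then show ?thesis using True sub by (auto simp: mult.commute)
    qed simp
  qed
  also have "\<dots> = (\<integral>\<^sup>+x\<in>fst c. F x \<partial>riemannian_volume M)" by (rule nn_integral_chart[OF M c F, symmetric])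
  also have "\<dots> \<le> (\<integral>\<^sup>+x. F x \<partial>riemannian_volume M)" by (intro nn_integral_mono) (simp add: indicator_def)
  finally have le: "ennreal d0 * (\<integral>\<^sup>+y\<in>?S. F (chart_inv c y) \<partial>lborel) \<le> (\<integral>\<^sup>+x. F x \<partial>riemannian_volume M)" .
  have "(\<integral>\<^sup>+y\<in>?S. F (chart_inv c y) \<partial>lborel) = ennreal (1 / d0) * (ennreal d0 * (\<integral>\<^sup>+y\<in>?S. F (chart_inv c y) \<partial>lborel))"
    using d0(1) by (simp add: mult.assoc[symmetric] ennreal_mult'[symmetric])
  also have "\<dots> \<le> ennreal (1 / d0) * (\<integral>\<^sup>+x. F x \<partial>riemannian_volume M)" by (rule mult_left_mono[OF le]) simp
  finally show "(\<integral>\<^sup>+y\<in>?S. F (chart_inv c y) \<partial>lborel) \<le> ennreal (1 / d0) * (\<integral>\<^sup>+x. F x \<partial>riemannian_volume M)" .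
qed

lemma nn_integral_volume_le_cell:
  assumes c: "c \<in> atlas M" and sub: "ibox B \<subseteq> chart_image c"
    and d1: "\<And>y. y \<in> ibox B \<Longrightarrow> volume_density M c y \<le> d1"
    and U: "U \<in> sets (riemannian_volume M)" "U \<subseteq> fst c" "AE y in lborel. y \<in> chart_image c \<longrightarrow> chart_inv c y \<in> U \<longrightarrow> y \<in> ibox B"
    and F: "F \<in> borel_measurable (riemannian_volume M)"
  shows "(\<integral>\<^sup>+x\<in>U. F x \<partial>riemannian_volume M) \<le> ennreal d1 * (\<integral>\<^sup>+y\<in>ibox B. F (chart_inv c y) \<partial>lborel)"
proof -
  let ?S = "ibox B"
  have FU: "(\<lambda>x. F x * indicator U x) \<in> borel_measurable (riemannian_volume M)" using F U by measurable
  have "(\<integral>\<^sup>+x\<in>U. F x \<partial>riemannian_volume M) = (\<integral>\<^sup>+x\<in>fst c. F x * indicator U x \<partial>riemannian_volume M)"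
    using U by (intro nn_integral_cong) (auto simp: indicator_def)
  also have "\<dots> = (\<integral>\<^sup>+y\<in>chart_image c. F (chart_inv c y) * indicator U (chart_inv c y) * ennreal (volume_density M c y) \<partial>lborel)"
    by (rule nn_integral_chart[OF M c FU])
  also have "\<dots> \<le> (\<integral>\<^sup>+y. ennreal d1 * (F (chart_inv c y) * indicator ?S y) \<partial>lborel)"
  proof (rule nn_integral_mono_AE)
    show "AE y in lborel. F (chart_inv c y) * indicator U (chart_inv c y) * ennreal (volume_density M c y) * indicator (chart_image c) y
      \<le> ennreal d1 * (F (chart_inv c y) * indicator ?S y)"
      using U(3)
    proof eventually_elim
      case (elim y)
      show ?case
      proof (cases "y \<in> chart_image c \<and> chart_inv c y \<in> U")
        case True
        then have y: "y \<in> ?S" using elim by blast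
        then have "F (chart_inv c y) * ennreal (volume_density M c y) \<le> F (chart_inv c y) * ennreal d1"
          using d1 by (intro mult_left_mono ennreal_leI) auto
        then show ?thesis using True y by (simp add: mult.commute)
      qed (auto simp: indicator_def)
    qed
  qed
  also have "\<dots> = ennreal d1 * (\<integral>\<^sup>+y\<in>?S. F (chart_inv c y) \<partial>lborel)"
  proof (rule nn_integral_cmult)
    have "(\<lambda>y. F (chart_inv c y)) \<in> borel_measurable (restrict_space borel ?S)"
      using chart_comp_measurable[OF M c F] sub by (rule measurable_restrict_mono)
    then show "(\<lambda>y. F (chart_inv c y) * indicator ?S y) \<in> borel_measurable lborel"
      by (subst (asm) borel_measurable_restrict_space_iff_ennreal) auto
  qed
  finally show ?thesis .
qed

lemma transplant_measurable:
  assumes "c \<in> atlas M" "ibox B \<subseteq> chart_image c" "w \<in> borel_measurable (riemannian_volume M)"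
  shows "transplant c B w \<in> borel_measurable borel"
proof -
  let ?S = "ibox B"
  have "(\<lambda>y. w (chart_inv c y)) \<in> borel_measurable (restrict_space borel ?S)"
    using chart_comp_measurable[OF M assms(1,3)] assms(2) by (rule measurable_restrict_mono)
  then have "(\<lambda>y. indicator ?S y *\<^sub>R w (chart_inv c y)) \<in> borel_measurable borel"
    by (subst (asm) borel_measurable_restrict_space_iff) auto
  also have "(\<lambda>y. indicator ?S y *\<^sub>R w (chart_inv c y)) = transplant c B w"
    by (auto simp: transplant_def fun_eq_iff)
  finally show ?thesis .
qed

text \<open>On the closed cell the volume density is bounded below and the diagonal entries of the metric are bounded above. The
former turns the modulars on \<open>M\<close> into integrals over the cell, the latter bounds the partial derivatives by a
constant times the length of the gradient. Lowering the exponent from \<open>q\<close> to \<open>q0\<close> costs the volume of the cell.\<close>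

lemma transplant_in_sobolev_ball:
  assumes c: "c \<in> atlas M" and B: "fat B" and sub: "cbox (fst B) (snd B) \<subseteq> chart_image c"
    and qc: "q \<in> borel_measurable (riemannian_volume M)"
    and q: "1 \<le> q0" "\<And>y. y \<in> ibox B \<Longrightarrow> q0 \<le> q (chart_inv c y)"
  shows "\<exists>R. \<forall>w\<in>unit_sobolev M q. transplant c B w \<in> sobolev_ball q0 B R"
proof -
  let ?S = "ibox B" and ?C = "cbox (fst B) (snd B)"
  have SC: "?S \<subseteq> ?C" by (rule box_subset_cbox)
  have S: "?S \<subseteq> chart_image c" using SC sub by blast
  have ne: "?C \<noteq> {}" using emeasure_cell[OF B] vol_pos[OF B] SC by auto
  have cont: "continuous_on ?C (volume_density M c)"
    using volume_density_continuous[OF M c] sub by (rule continuous_on_subset)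
  have "\<exists>y0\<in>?C. \<forall>y\<in>?C. volume_density M c y0 \<le> volume_density M c y"
    by (rule continuous_attains_inf[OF compact_cbox ne cont])
  then obtain y0 where y0: "y0 \<in> ?C" "\<And>y. y \<in> ?C \<Longrightarrow> volume_density M c y0 \<le> volume_density M c y"
    by blast
  define d0 where "d0 = volume_density M c y0"
  have d0: "0 < d0" unfolding d0_def using y0(1) sub by (intro volume_density_pos[OF M c]) blast
  have d0': "d0 \<le> volume_density M c y" if "y \<in> ?S" for y
    unfolding d0_def using that SC by (intro y0(2)) blast
  have "\<exists>K. \<forall>y\<in>?C. metric M c (chart_inv c y) $ i $ i \<le> K" for i
  proof -
    have "continuous_on (chart_image c) (metric M c \<circ> chart_inv c)"
      using M c smooth_on_continuous unfolding riemannian_manifold_def by blast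
    then have "continuous_on ?C (\<lambda>y. metric M c (chart_inv c y))"
      using continuous_on_subset[OF _ sub] by (simp add: o_def)
    then have "continuous_on ?C (\<lambda>y. metric M c (chart_inv c y) $ i $ i)" by (intro continuous_on_component)
    then have "\<exists>x\<in>?C. \<forall>y\<in>?C. metric M c (chart_inv c y) $ i $ i \<le> metric M c (chart_inv c x) $ i $ i"
      by (rule continuous_attains_sup[OF compact_cbox ne])
    then show ?thesis by blast
  qed
  then have "\<exists>Ki. \<forall>i. \<forall>y\<in>?C. metric M c (chart_inv c y) $ i $ i \<le> Ki i" by (intro choice allI)
  then obtain Ki where Ki: "\<forall>i. \<forall>y\<in>?C. metric M c (chart_inv c y) $ i $ i \<le> Ki i" by (elim exE)
  define K where "K = Max (range (\<lambda>i. sqrt (\<bar>Ki i\<bar>)))"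
  have K: "sqrt (metric M c (chart_inv c y) $ i $ i) \<le> K" if "y \<in> ?C" for i y
  proof -
    have "sqrt (metric M c (chart_inv c y) $ i $ i) \<le> sqrt \<bar>Ki i\<bar>"
      using Ki[rule_format, OF that, of i] by (intro real_sqrt_le_mono) simp
    also have "\<dots> \<le> K" unfolding K_def by (intro Max_ge) auto
    finally show ?thesis .
  qed
  have K0: "0 \<le> K"
  proof -
    have "sqrt \<bar>Ki undefined\<bar> \<le> K" unfolding K_def by (intro Max_ge) auto
    then show ?thesis by (rule order_trans[rotated]) simp
  qed
  \<comment> \<open>the two summands come from \<open>t \<le> 2 + t^q\<close> and from the lower bound \<open>d0\<close> of the density\<close>
  define R1 where "R1 = 2 * vol B + 1 * (1 / d0)"
  define R2 where "R2 = K powr q0 * vol B + K powr q0 * (1 / d0)"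
  show ?thesis
  proof (intro exI[of _ "max R1 R2"] ballI)
    fix w assume "w \<in> unit_sobolev M q"
    then obtain V where w: "w \<in> borel_measurable (riemannian_volume M)" "modular M q w \<le> 1"
      and V: "is_weak_gradient M w V" "field_norm M V \<in> borel_measurable (riemannian_volume M)" "modular M q (field_norm M V) \<le> 1"
      unfolding unit_sobolev_def by blast
    have mV: "measurable_vector_field M V" using V(1) by (simp add: is_weak_gradient_def)
    let ?fn = "field_norm M V"
    have fn0: "0 \<le> ?fn (chart_inv c y)" if "y \<in> ?S" for y
    proof -
      have x: "chart_inv c y \<in> fst c" using chart_inv_mem[OF M, of y c] that S by blast
      have "0 < v \<bullet> (metric M c (chart_inv c y) *v v)" if "v \<noteq> 0" for v
        using M c x that unfolding riemannian_manifold_def by blast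
      then have "0 \<le> v \<bullet> (metric M c (chart_inv c y) *v v)" for v
        by (cases "v = 0") (auto simp: less_imp_le)
      then show ?thesis unfolding field_norm_chart[OF M mV c x] by simp
    qed
    define f where "f = transplant c B w"
    define g where "g y = K * transplant c B ?fn y" for y
    have fm: "f \<in> borel_measurable borel" unfolding f_def by (rule transplant_measurable[OF c S w(1)])
    have tm: "transplant c B ?fn \<in> borel_measurable borel" by (rule transplant_measurable[OF c S V(2)])
    have gm: "g \<in> borel_measurable borel" unfolding g_def[abs_def] using tm by simp
    have g0: "0 \<le> g y" for y unfolding g_def transplant_def using fn0 K0 by auto
    define F where "F u x = ennreal (\<bar>u x\<bar> powr q x)" for u and x :: 'a
    have Fm: "F u \<in> borel_measurable (riemannian_volume M)" if "u \<in> borel_measurable (riemannian_volume M)" for u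
      unfolding F_def[abs_def] using that qc by measurable
    have FB: "(\<lambda>y. F u (chart_inv c y) * indicator ?S y) \<in> borel_measurable borel"
      "(\<integral>\<^sup>+y\<in>?S. F u (chart_inv c y) \<partial>lborel) \<le> ennreal (1 / d0)"
      if u: "u \<in> borel_measurable (riemannian_volume M)" "modular M q u \<le> 1" for u
    proof -
      show "(\<lambda>y. F u (chart_inv c y) * indicator ?S y) \<in> borel_measurable borel"
        by (rule nn_integral_cell_le_volume(1)[OF c S d0 d0' Fm[OF u(1)]])
      have "(\<integral>\<^sup>+y\<in>?S. F u (chart_inv c y) \<partial>lborel) \<le> ennreal (1 / d0) * modular M q u"
        unfolding modular_def F_def[symmetric] by (rule nn_integral_cell_le_volume(2)[OF c S d0 d0' Fm[OF u(1)]])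
      also have "\<dots> \<le> ennreal (1 / d0) * 1" using u(2) by (rule mult_left_mono) simp
      finally show "(\<integral>\<^sup>+y\<in>?S. F u (chart_inv c y) \<partial>lborel) \<le> ennreal (1 / d0)" by simp
    qed
    have le_pow: "ennreal (\<bar>t\<bar> powr q0) \<le> 1 + F u (chart_inv c y)" "ennreal \<bar>t\<bar> \<le> 2 + F u (chart_inv c y)"
      if "y \<in> ?S" "t = u (chart_inv c y)" for t u y
    proof -
      have 1: "\<bar>t\<bar> powr q0 \<le> 1 + \<bar>t\<bar> powr q (chart_inv c y)" using q that by (intro powr_le_1_plus) auto
      then show "ennreal (\<bar>t\<bar> powr q0) \<le> 1 + F u (chart_inv c y)"
        unfolding F_def that(2)[symmetric] using ennreal_leI[OF 1] by simp
      have 2: "\<bar>t\<bar> \<le> 2 + \<bar>t\<bar> powr q (chart_inv c y)"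
        using powr_le_1_plus[of "\<bar>t\<bar>" 1 "q (chart_inv c y)"] q(1) q(2)[OF that(1)] by simp
      then show "ennreal \<bar>t\<bar> \<le> 2 + F u (chart_inv c y)"
        unfolding F_def that(2)[symmetric] using ennreal_leI[OF 2] by simp
    qed
    have "ennreal \<bar>f y\<bar> \<le> ennreal 2 + ennreal 1 * F w (chart_inv c y)" if "y \<in> ?S" for y
      using le_pow(2)[OF that refl, of w] that by (simp add: f_def transplant_def)
    note fi = nn_integral_cell_dominated[OF B _ FB[OF w] _ _ _ this]
    have fi: "set_integrable lborel ?S f" "(LINT y:?S|lborel. \<bar>f y\<bar>) \<le> R1"
      unfolding R1_def by (rule fi; use fm d0 in simp)+
    have g_eq: "g y = K * ?fn (chart_inv c y)" if "y \<in> ?S" for y using that by (simp add: g_def transplant_def)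
    have "ennreal \<bar>g y\<bar> \<le> ennreal (K * 2) + ennreal K * F ?fn (chart_inv c y)" if y: "y \<in> ?S" for y
    proof -
      have "ennreal \<bar>g y\<bar> = ennreal K * ennreal \<bar>?fn (chart_inv c y)\<bar>"
        using K0 by (simp add: g_eq[OF y] abs_mult ennreal_mult')
      also have "\<dots> \<le> ennreal K * (2 + F ?fn (chart_inv c y))"
        by (rule mult_left_mono[OF le_pow(2)[OF y refl]]) simp
      also have "\<dots> = ennreal (K * 2) + ennreal K * F ?fn (chart_inv c y)"
        using K0 by (simp add: distrib_left ennreal_mult')
      finally show ?thesis .
    qed
    note gi = nn_integral_cell_dominated(1)[OF B _ FB[OF V(2,3)] _ _ _ this]
    have gi: "set_integrable lborel ?S g" by (rule gi; use gm d0 K0 in simp)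
    have "ennreal \<bar>g y powr q0\<bar> \<le> ennreal (K powr q0) + ennreal (K powr q0) * F ?fn (chart_inv c y)" if y: "y \<in> ?S" for y
    proof -
      have "ennreal \<bar>g y powr q0\<bar> = ennreal (K powr q0) * ennreal (\<bar>?fn (chart_inv c y)\<bar> powr q0)"
        using K0 fn0[OF y] by (simp add: g_eq[OF y] powr_mult ennreal_mult')
      also have "\<dots> \<le> ennreal (K powr q0) * (1 + F ?fn (chart_inv c y))"
        by (rule mult_left_mono[OF le_pow(1)[OF y refl]]) simp
      finally show ?thesis by (simp add: distrib_left)
    qed
    note gqi = nn_integral_cell_dominated[OF B _ FB[OF V(2,3)] _ _ _ this]
    have gqi: "set_integrable lborel ?S (\<lambda>y. g y powr q0)" "(LINT y:?S|lborel. \<bar>g y powr q0\<bar>) \<le> R2"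
      unfolding R2_def by (rule gqi; use gm d0 in simp)+
    have ctrl: "controls_oscillation g f B"
      unfolding controls_oscillation_def
    proof (intro allI impI)
      fix B' :: "'n cell" assume B': "fat B'" and sub': "ibox B' \<subseteq> ?S"
      let ?i = "long_axis B'"
      let ?u = "\<lambda>y. w (chart_inv c y)" and ?h = "\<lambda>y. (metric M c (chart_inv c y) *v V c (chart_inv c y)) $ ?i"
      have cong: "(LINT y:T|lborel. ?u y) = (LINT y:T|lborel. f y)" if "T \<subseteq> ibox B'" "T \<in> sets borel" for T
        using that sub' by (intro set_lebesgue_integral_cong) (auto simp: f_def transplant_def)
      have lo: "ibox (lower B') = box (fst B') (vec_upd (snd B') ?i (cut B'))"
        and up: "ibox (upper B') = box (vec_upd (fst B') ?i (cut B')) (snd B')"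
        by (simp_all add: lower_def upper_def)
      have "\<bar>(LINT y:box (fst B') (vec_upd (snd B') ?i (cut B'))|lborel. ?u y) -
          (LINT y:box (vec_upd (fst B') ?i (cut B')) (snd B')|lborel. ?u y)\<bar>
        \<le> (snd B' $ ?i - fst B' $ ?i) / 2 * (LINT y:ibox B'|lborel. g y)"
      proof (rule weak_partial_halves)
        show "weak_partial (interior (chart_image c)) ?i ?u ?h"
          using V(1) c unfolding is_weak_gradient_def by blast
        show "ibox B' \<subseteq> interior (chart_image c)"
          using sub' S by (intro interior_maximal open_box) blast
        show "fst B' $ j < snd B' $ j" for j using fat_side_pos[OF B', of j] by (simp add: side_def)
        have "set_integrable lborel (ibox B') f" by (rule set_integrable_subset[OF fi(1) _ sub']) simp
        also have "?this \<longleftrightarrow> set_integrable lborel (ibox B') ?u"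
          using sub' by (intro set_integrable_cong) (auto simp: f_def transplant_def)
        finally show "set_integrable lborel (ibox B') ?u" .
        show "set_integrable lborel (ibox B') g" by (rule set_integrable_subset[OF gi _ sub']) simp
        show "\<bar>?h y\<bar> \<le> g y" if y: "y \<in> ibox B'" for y
        proof -
          have yS: "y \<in> ?S" "y \<in> ?C" using y sub' SC by auto
          have x: "chart_inv c y \<in> fst c" using chart_inv_mem[OF M, of y c] yS(1) S by blast
          have "\<bar>?h y\<bar> \<le> sqrt (metric M c (chart_inv c y) $ ?i $ ?i) * ?fn (chart_inv c y)"
            by (rule gradient_component_le[OF M mV c x])
          also have "\<dots> \<le> K * ?fn (chart_inv c y)" by (rule mult_right_mono[OF K[OF yS(2)] fn0[OF yS(1)]])
          finally show ?thesis by (simp add: g_eq[OF yS(1)])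
        qed
        show "cut B' = (fst B' $ ?i + snd B' $ ?i) / 2" by (simp add: cut_def)
      qed
      then show "\<bar>(LINT x:ibox (lower B')|lborel. f x) - (LINT x:ibox (upper B')|lborel. f x)\<bar>
          \<le> side B' ?i / 2 * (LINT x:ibox B'|lborel. g x)"
        unfolding lo[symmetric] up[symmetric] side_def
        using cong[of "ibox (lower B')"] cong[of "ibox (upper B')"] mem_lower[OF B'] mem_upper[OF B']
        by (simp add: subset_iff)
    qed
    have "f \<in> sobolev_ball q0 B (max R1 R2)"
      unfolding sobolev_ball_def using fm fi g0 ctrl gi gqi by (auto intro!: exI[of _ g])
    then show "transplant c B w \<in> sobolev_ball q0 B (max R1 R2)" by (simp add: f_def)
  qed
qed

end

section \<open>Compactness near a point\<close>

text \<open>The condition on \<open>P\<close> means \<open>1/Q - 1/N < 1/P\<close>. A number strictly between the two sides serves as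
\<open>1/q0 - 1/N\<close>. Enlarging \<open>p0\<close> to at least \<open>q0\<close> is harmless because \<open>q0 (1/q0 - 1/N) = 1 - q0/N\<close> is always less than
\<open>1\<close>.\<close>

lemma subcritical_exponents:
  fixes N Q P :: real
  assumes "1 < Q" "Q < N" "1 < P" "P < N * Q / (N - Q)"
  obtains q0 p0 where "1 \<le> q0" "q0 < Q" "P < p0" "q0 \<le> p0" "p0 * (1 / q0 - 1 / N) < 1"
proof -
  define s where "s = 1 / Q - 1 / N"
  have s: "0 < s" "s < 1 - 1 / N" using assms by (auto simp: s_def field_simps)
  have "1 / s = N * Q / (N - Q)" using assms by (simp add: s_def field_simps)
  then have "P < 1 / s" using assms(4) by (simp only:)
  then have sP: "s < 1 / P" using assms(3) s by (simp add: field_simps)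
  obtain s' where s': "s < s'" "s' < min (1 / P) (1 - 1 / N)" using dense[of s "min (1 / P) (1 - 1 / N)"] s sP by auto
  have s'0: "0 < s'" using s s' by simp
  define q0 where "q0 = 1 / (s' + 1 / N)"
  have N: "0 < N" using assms by simp
  have d: "0 < s' + 1 / N" using s'0 N by (simp add: add_pos_pos)
  have q0: "1 \<le> q0" "q0 < Q" "1 / q0 - 1 / N = s'"
  proof -
    show "1 \<le> q0" using s' d by (simp add: q0_def)
    have "1 / Q < s' + 1 / N" using s' by (simp add: s_def)
    then show "q0 < Q" using d assms by (simp add: q0_def field_simps)
    show "1 / q0 - 1 / N = s'" by (simp add: q0_def)
  qed
  have "P < 1 / s'" using s' s'0 assms by (simp add: field_simps)
  then obtain p1 where p1: "P < p1" "p1 < 1 / s'" using dense by blast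
  show thesis
  proof (rule that[of q0 "max p1 q0"])
    have "p1 * s' < 1" using p1 s'0 by (simp add: field_simps)
    moreover have "q0 * s' < 1" using q0 N unfolding q0(3)[symmetric] by (simp add: field_simps)
    ultimately show "max p1 q0 * (1 / q0 - 1 / N) < 1" unfolding q0(3) by (simp add: max_def)
  qed (use q0 p1 in auto)
qed

text \<open>On bounded measure spaces these inequalities replace Hoelder's inequality for passing to smaller exponents: smallness
of the integral for the large exponent gives smallness for the small one, after choosing \<open>\<eta>\<close> first.\<close>

lemma powr_le_small_plus:
  assumes "0 \<le> t" "1 \<le> a" "a \<le> b" "0 < \<eta>" "\<eta> < (1::real)"
  shows "t powr a \<le> \<eta> + \<eta> powr (1 - b) * t powr b"
    and "t \<le> \<eta> + \<eta> powr (1 - b) * t powr a"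
proof -
  have "t powr a \<le> \<eta> \<and> t \<le> \<eta>" if "t \<le> \<eta>"
  proof -
    have "t powr a \<le> t powr 1" using assms that by (intro powr_mono') auto
    then show ?thesis using assms that by simp
  qed
  moreover have "t powr a \<le> \<eta> powr (1 - b) * t powr b \<and> t \<le> \<eta> powr (1 - b) * t powr a" if t: "\<not> t \<le> \<eta>"
  proof
    have small: "t powr (- c) \<le> \<eta> powr (1 - b)" if c: "0 \<le> c" "c \<le> b - 1" for c
    proof -
      have "t powr (- c) \<le> \<eta> powr (- c)" using t c assms by (intro powr_mono2') auto
      also have "\<dots> \<le> \<eta> powr (1 - b)" using c assms by (intro powr_mono') auto
      finally show ?thesis .
    qed
    have t0: "0 < t" using t assms by simp
    have "t powr a = t powr (- (b - a)) * t powr b" by (simp flip: powr_add)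
    also have "\<dots> \<le> \<eta> powr (1 - b) * t powr b" using assms by (intro mult_right_mono small) auto
    finally show "t powr a \<le> \<eta> powr (1 - b) * t powr b" .
    have "t = t powr (- (a - 1)) * t powr a" using t0 by (simp flip: powr_add)
    also have "\<dots> \<le> \<eta> powr (1 - b) * t powr a" using assms by (intro mult_right_mono small) auto
    finally show "t \<le> \<eta> powr (1 - b) * t powr a" .
  qed
  ultimately show "t powr a \<le> \<eta> + \<eta> powr (1 - b) * t powr b" "t \<le> \<eta> + \<eta> powr (1 - b) * t powr a"
    using assms by (cases "t \<le> \<eta>"; simp add: add_increasing add_increasing2)+
qed

text \<open>Boundedness and total boundedness over \<open>U\<close> for the modular; the latter in the form that any sequence has a
subsequence whose members are pairwise \<open>e\<close>-close.\<close>

definition precompact_on ::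
    "('a, 'n::{finite,wellorder}) riemannian_space \<Rightarrow> ('a \<Rightarrow> real) \<Rightarrow> ('a \<Rightarrow> real) set \<Rightarrow> 'a set \<Rightarrow> bool" where
  "precompact_on M p \<F> U \<longleftrightarrow>
     (\<exists>C\<ge>0. \<forall>w\<in>\<F>. (\<integral>\<^sup>+x\<in>U. ennreal (\<bar>w x\<bar> powr p x) \<partial>riemannian_volume M) \<le> ennreal C) \<and>
     (\<forall>e>0. \<forall>w::nat \<Rightarrow> 'a \<Rightarrow> real. (\<forall>k. w k \<in> \<F>) \<longrightarrow> (\<exists>r::nat \<Rightarrow> nat. strict_mono r \<and>
        (\<forall>i j. (\<integral>\<^sup>+x\<in>U. ennreal (\<bar>w (r i) x - w (r j) x\<bar> powr p x) \<partial>riemannian_volume M) \<le> ennreal e)))"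

context
  fixes M :: "('a, 'n::{finite,wellorder}) riemannian_space"
  assumes M: "riemannian_manifold M"
begin

lemma chart_neighbourhood:
  assumes c: "c \<in> atlas M" and x0: "x0 \<in> fst c" and V0: "openin (mtop M) V0" "x0 \<in> V0"
  obtains B U where "fat B" "openin (mtop M) U" "x0 \<in> U" "U \<subseteq> fst c" "cbox (fst B) (snd B) \<subseteq> chart_image c"
    "\<forall>y\<in>cbox (fst B) (snd B). chart_inv c y \<in> V0"
    "AE y in lborel. y \<in> chart_image c \<longrightarrow> chart_inv c y \<in> U \<longrightarrow> y \<in> ibox B"
proof -
  let ?X = "V0 \<inter> fst c"
  define W where "W = snd c ` ?X"
  have W_iff: "y \<in> W \<longleftrightarrow> y \<in> chart_image c \<and> chart_inv c y \<in> V0" for y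
  proof
    assume "y \<in> W"
    then show "y \<in> chart_image c \<and> chart_inv c y \<in> V0"
      unfolding W_def by (auto simp: chart_inv_left[OF M c] chart_image_def)
  next
    assume y: "y \<in> chart_image c \<and> chart_inv c y \<in> V0"
    then have "chart_inv c y \<in> ?X" using chart_inv_mem[OF M, of y c] by blast
    moreover have "snd c (chart_inv c y) = y" using chart_inv_right[OF M, of y c] y by blast
    ultimately show "y \<in> W" unfolding W_def by (metis imageI)
  qed
  have hom: "homeomorphic_map (subtopology (mtop M) (fst c)) (top_of_set (chart_image c)) (snd c)"
    by (rule chart_homeo[OF M c])
  have "openin (subtopology (mtop M) (fst c)) ?X" using V0 by (auto simp: openin_subtopology)
  then have Wo: "openin (top_of_set (chart_image c)) W"
    unfolding W_def using homeomorphic_map_openness_eq[OF hom] by blast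
  have "open (chart_image c) \<or> openin (top_of_set half_space) (chart_image c)"
    using smooth_manifold_M[OF M] c by (simp add: smooth_manifold_def)
  then have "open W \<or> openin (top_of_set half_space) W"
    using Wo openin_open_trans openin_trans by blast
  moreover have "snd c x0 \<in> W" unfolding W_def using x0 V0 by blast
  ultimately obtain B T where B: "fat B" "open T" "snd c x0 \<in> T" "cbox (fst B) (snd B) \<subseteq> W"
    "AE x in lborel. x \<in> W \<inter> T \<longrightarrow> x \<in> ibox B"
    by (rule fat_cell_near)
  define U where "U = {x \<in> ?X. snd c x \<in> T}"
  show thesis
  proof (rule that[of B U])
    show "fat B" by (rule B(1))
    have "snd c ` U = W \<inter> T" by (auto simp: U_def W_def)
    then have "openin (top_of_set (chart_image c)) (snd c ` U)"
      using Wo B(2) by (simp add: openin_Int_open)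
    then have "openin (subtopology (mtop M) (fst c)) U"
      using homeomorphic_map_openness_eq[OF hom] chart_topspace[OF M c] by (auto simp: U_def)
    then show "openin (mtop M) U" using openin_trans_full chart_open[OF M c] by blast
    show "x0 \<in> U" "U \<subseteq> fst c" using x0 V0 B(3) by (auto simp: U_def)
    show "cbox (fst B) (snd B) \<subseteq> chart_image c" using B(4) W_iff by blast
    show "\<forall>y\<in>cbox (fst B) (snd B). chart_inv c y \<in> V0" using B(4) W_iff by blast
    show "AE y in lborel. y \<in> chart_image c \<longrightarrow> chart_inv c y \<in> U \<longrightarrow> y \<in> ibox B"
      using B(5)
    proof (eventually_elim, intro impI)
      fix y assume h: "y \<in> W \<inter> T \<longrightarrow> y \<in> ibox B" "y \<in> chart_image c" "chart_inv c y \<in> U"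
      then have "y \<in> W" unfolding W_iff by (simp add: U_def)
      moreover have "y \<in> T" using h chart_inv_right[OF M, of y c] by (simp add: U_def)
      ultimately show "y \<in> ibox B" using h by blast
    qed
  qed
qed

text \<open>The volume density is bounded above on the cell, so integrals over the neighbourhood are controlled by integrals over
the cell, and \<open>p(x)\<close> is compared with the constant exponent \<open>p0 \<ge> p(x)\<close> there.\<close>

lemma local_compactness:
  assumes p: "variable_exponent M p" and q: "variable_exponent M q" and x0: "x0 \<in> topspace (mtop M)"
    and qN: "q x0 < real CARD('n)" and pq: "p x0 < real CARD('n) * q x0 / (real CARD('n) - q x0)"
  shows "\<exists>U. openin (mtop M) U \<and> x0 \<in> U \<and> emeasure (riemannian_volume M) U < \<infinity> \<and> precompact_on M p (unit_sobolev M q) U"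
proof -
  let ?\<mu> = "riemannian_volume M" and ?N = "real CARD('n)"
  have pq1: "1 < p x" "1 < q x" if "x \<in> topspace (mtop M)" for x using p q that by (auto simp: variable_exponent_def)
  have pc: "continuous_map (mtop M) euclideanreal p" and qc: "continuous_map (mtop M) euclideanreal q"
    using p q by (auto simp: variable_exponent_def)
  have [measurable]: "p \<in> borel_measurable ?\<mu>" "q \<in> borel_measurable ?\<mu>"
    using continuous_map_measurable[OF M] pc qc by auto
  obtain q0 p0 where q0: "1 \<le> q0" "q0 < q x0" "p x0 < p0" "q0 \<le> p0" "p0 * (1 / q0 - 1 / ?N) < 1"
    by (rule subcritical_exponents[OF pq1(2)[OF x0] qN pq1(1)[OF x0] pq])
  define V0 where "V0 = {x \<in> topspace (mtop M). q x \<in> {q0<..}} \<inter> {x \<in> topspace (mtop M). p x \<in> {..<p0}}"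
  have "openin (mtop M) {x \<in> topspace (mtop M). q x \<in> {q0<..}}"
    by (rule openin_continuous_map_preimage[OF qc]) simp
  moreover have "openin (mtop M) {x \<in> topspace (mtop M). p x \<in> {..<p0}}"
    by (rule openin_continuous_map_preimage[OF pc]) simp
  ultimately have "openin (mtop M) V0" unfolding V0_def by (rule openin_Int)
  moreover have "x0 \<in> V0" using x0 q0 by (simp add: V0_def)
  ultimately have V0: "openin (mtop M) V0" "x0 \<in> V0" .
  obtain c where c: "c \<in> atlas M" "x0 \<in> fst c"
    using smooth_manifold_M[OF M] x0 unfolding smooth_manifold_def by blast
  obtain B U where B: "fat B" and U: "openin (mtop M) U" "x0 \<in> U" "U \<subseteq> fst c"
    and sub: "cbox (fst B) (snd B) \<subseteq> chart_image c"
    and V: "\<forall>y\<in>cbox (fst B) (snd B). chart_inv c y \<in> V0"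
    and ae: "AE y in lborel. y \<in> chart_image c \<longrightarrow> chart_inv c y \<in> U \<longrightarrow> y \<in> ibox B"
    by (rule chart_neighbourhood[OF c V0])
  let ?S = "ibox B" and ?C = "cbox (fst B) (snd B)"
  have SC: "?S \<subseteq> ?C" by (rule box_subset_cbox)
  have S: "?S \<subseteq> chart_image c" using SC sub by blast
  have v: "0 < vol B" by (rule vol_pos[OF B])
  have ne: "?C \<noteq> {}" using emeasure_cell[OF B] v SC by auto
  have "continuous_on ?C (volume_density M c)"
    using volume_density_continuous[OF M c(1)] sub by (rule continuous_on_subset)
  then have "\<exists>y1\<in>?C. \<forall>y\<in>?C. volume_density M c y \<le> volume_density M c y1"
    by (rule continuous_attains_sup[OF compact_cbox ne])
  then obtain y1 where y1: "y1 \<in> ?C" "\<forall>y\<in>?C. volume_density M c y \<le> volume_density M c y1" by blast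
  define d1 where "d1 = volume_density M c y1"
  have d1: "0 < d1" unfolding d1_def using y1(1) sub by (intro volume_density_pos[OF M c(1)]) blast
  have d1': "volume_density M c y \<le> d1" if "y \<in> ?S" for y using y1(2) SC that unfolding d1_def by blast
  have Us: "U \<in> sets ?\<mu>" unfolding sets_volume[OF M] by (rule openin_sets[OF M U(1)])
  note upper = nn_integral_volume_le_cell[OF M c(1) S d1' Us U(3) ae]
  have expo: "q0 \<le> q (chart_inv c y)" "1 \<le> p (chart_inv c y)" "p (chart_inv c y) \<le> p0" if "y \<in> ?S" for y
  proof -
    have "chart_inv c y \<in> V0" using V SC that by blast
    then show "q0 \<le> q (chart_inv c y)" "1 \<le> p (chart_inv c y)" "p (chart_inv c y) \<le> p0"
      using pq1 by (auto simp: V0_def less_imp_le)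
  qed
  have "\<exists>R. \<forall>w\<in>unit_sobolev M q. transplant c B w \<in> sobolev_ball q0 B R"
    by (rule transplant_in_sobolev_ball[OF M c(1) B sub _ q0(1)]) (simp_all add: expo(1))
  then obtain R where R: "\<And>w. w \<in> unit_sobolev M q \<Longrightarrow> transplant c B w \<in> sobolev_ball q0 B R" by blast
  have wm: "w \<in> borel_measurable ?\<mu>" if "w \<in> unit_sobolev M q" for w using that by (simp add: unit_sobolev_def)
  have tm: "transplant c B w \<in> borel_measurable borel" if "w \<in> unit_sobolev M q" for w
    using transplant_measurable[OF M c(1) S wm[OF that]] .
  have key: "(\<integral>\<^sup>+x\<in>U. ennreal (\<bar>u x\<bar> powr p x) \<partial>?\<mu>) \<le> ennreal (d1 * (a * vol B + b * s))"
    if u: "u \<in> borel_measurable ?\<mu>" and h: "h \<in> borel_measurable borel"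
      and hu: "\<And>y. y \<in> ?S \<Longrightarrow> u (chart_inv c y) = h y" and ab: "0 \<le> a" "0 \<le> b" "0 \<le> s"
      and s: "(\<integral>\<^sup>+y\<in>?S. ennreal (\<bar>h y\<bar> powr p0) \<partial>lborel) \<le> ennreal s"
      and le: "\<And>y t. y \<in> ?S \<Longrightarrow> 0 \<le> t \<Longrightarrow> t powr p (chart_inv c y) \<le> a + b * t powr p0"
    for u h a b s
  proof -
    have "(\<integral>\<^sup>+x\<in>U. ennreal (\<bar>u x\<bar> powr p x) \<partial>?\<mu>) \<le>
      ennreal d1 * (\<integral>\<^sup>+y\<in>?S. ennreal (\<bar>u (chart_inv c y)\<bar> powr p (chart_inv c y)) \<partial>lborel)"
      by (rule upper) (use u in measurable)
    also have "\<dots> \<le> ennreal d1 * (\<integral>\<^sup>+y. ennreal a * indicator ?S y + ennreal b * (ennreal (\<bar>h y\<bar> powr p0) * indicator ?S y) \<partial>lborel)"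
    proof (intro mult_left_mono nn_integral_mono)
      fix y
      show "ennreal (\<bar>u (chart_inv c y)\<bar> powr p (chart_inv c y)) * indicator ?S y \<le>
        ennreal a * indicator ?S y + ennreal b * (ennreal (\<bar>h y\<bar> powr p0) * indicator ?S y)"
      proof (cases "y \<in> ?S")
        case True
        have "ennreal (\<bar>h y\<bar> powr p (chart_inv c y)) \<le> ennreal (a + b * \<bar>h y\<bar> powr p0)"
          by (rule ennreal_leI[OF le[OF True]]) simp
        also have "\<dots> = ennreal a + ennreal b * ennreal (\<bar>h y\<bar> powr p0)"
          using ab by (simp add: ennreal_mult)
        finally show ?thesis using True hu by simp
      qed simp
    qed simp
    also have "(\<integral>\<^sup>+y. ennreal a * indicator ?S y + ennreal b * (ennreal (\<bar>h y\<bar> powr p0) * indicator ?S y) \<partial>lborel)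
      = (\<integral>\<^sup>+y. ennreal a * indicator ?S y \<partial>lborel) + (\<integral>\<^sup>+y. ennreal b * (ennreal (\<bar>h y\<bar> powr p0) * indicator ?S y) \<partial>lborel)"
      by (rule nn_integral_add) (use h in measurable)
    also have "\<dots> = ennreal a * ennreal (vol B) + ennreal b * (\<integral>\<^sup>+y\<in>?S. ennreal (\<bar>h y\<bar> powr p0) \<partial>lborel)"
    proof -
      have "(\<integral>\<^sup>+y. ennreal b * (ennreal (\<bar>h y\<bar> powr p0) * indicator ?S y) \<partial>lborel) =
        ennreal b * (\<integral>\<^sup>+y\<in>?S. ennreal (\<bar>h y\<bar> powr p0) \<partial>lborel)"
        by (rule nn_integral_cmult) (use h in measurable)
      then show ?thesis by (simp only: nn_integral_const_cell[OF B])
    qed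
    also have "ennreal d1 * \<dots> \<le> ennreal d1 * (ennreal a * ennreal (vol B) + ennreal b * ennreal s)"
      using s by (intro mult_left_mono add_left_mono) auto
    also have "\<dots> = ennreal (d1 * (a * vol B + b * s))"
      using ab d1 v by (simp add: ennreal_mult)
    finally show ?thesis .
  qed
  have fin: "emeasure ?\<mu> U < \<infinity>"
  proof -
    have "emeasure ?\<mu> U = (\<integral>\<^sup>+x\<in>U. 1 \<partial>?\<mu>)" using Us by simp
    also have "\<dots> \<le> ennreal d1 * (\<integral>\<^sup>+y\<in>?S. 1 \<partial>lborel)" by (rule upper, assumption, rule borel_measurable_const)
    also have "\<dots> < \<infinity>" unfolding nn_integral_const_cell[OF B] by (simp add: ennreal_mult_less_top)
    finally show ?thesis .
  qed
  have sb: "\<exists>C\<ge>0. \<forall>f\<in>sobolev_ball q0 B R. (\<integral>\<^sup>+x\<in>?S. ennreal (\<bar>f x\<bar> powr p0) \<partial>lborel) \<le> ennreal C"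
    by (rule sobolev_ball_precompact(1)[OF B q0(1,4,5)])
  then obtain C where C: "0 \<le> C" "\<forall>f\<in>sobolev_ball q0 B R. (\<integral>\<^sup>+x\<in>?S. ennreal (\<bar>f x\<bar> powr p0) \<partial>lborel) \<le> ennreal C"
    by (elim exE conjE)
  have "precompact_on M p (unit_sobolev M q) U"
    unfolding precompact_on_def
  proof (intro conjI exI[of _ "d1 * (1 * vol B + 1 * C)"] ballI allI impI)
    show "0 \<le> d1 * (1 * vol B + 1 * C)" using d1 v C by simp
    fix w assume w: "w \<in> unit_sobolev M q"
    show "(\<integral>\<^sup>+x\<in>U. ennreal (\<bar>w x\<bar> powr p x) \<partial>?\<mu>) \<le> ennreal (d1 * (1 * vol B + 1 * C))"
    proof (rule key[OF wm[OF w] tm[OF w]])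
      show "(\<integral>\<^sup>+y\<in>?S. ennreal (\<bar>transplant c B w y\<bar> powr p0) \<partial>lborel) \<le> ennreal C" using C(2) R[OF w] by blast
      show "t powr p (chart_inv c y) \<le> 1 + 1 * t powr p0" if "y \<in> ?S" "0 \<le> t" for y t
        using powr_le_1_plus[OF that(2), of "p (chart_inv c y)" p0] expo[OF that(1)] by simp
    qed (use C in \<open>simp_all add: transplant_def\<close>)
  next
    fix e :: real and w :: "nat \<Rightarrow> 'a \<Rightarrow> real" assume e: "0 < e" and w: "\<forall>k. w k \<in> unit_sobolev M q"
    \<comment> \<open>\<open>\<eta>\<close> makes the constant term small; the large coefficient \<open>b\<close> is compensated by the choice of \<open>s\<close>\<close>
    define \<eta> where "\<eta> = min (1/2) (e / (2 * d1 * vol B))"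
    have \<eta>: "0 < \<eta>" "\<eta> < 1" using e d1 v by (auto simp: \<eta>_def)
    have "\<eta> \<le> e / (2 * d1 * vol B)" by (simp add: \<eta>_def)
    then have \<eta>e: "d1 * (\<eta> * vol B) \<le> e / 2" using d1 v by (simp add: field_simps)
    define b where "b = \<eta> powr (1 - p0)"
    have b: "0 < b" using \<eta> by (simp add: b_def)
    define s where "s = e / (2 * d1 * b)"
    have s: "0 < s" "d1 * (b * s) = e / 2" using e d1 b by (auto simp: s_def)
    have "\<exists>r::nat \<Rightarrow> nat. strict_mono r \<and> (\<forall>i j. (\<integral>\<^sup>+x\<in>?S. ennreal (\<bar>transplant c B (w (r i)) x - transplant c B (w (r j)) x\<bar> powr p0) \<partial>lborel) \<le> ennreal s)"
      by (rule sobolev_ball_precompact(2)[OF B q0(1,4,5) s(1), where f="\<lambda>k. transplant c B (w k)"]) (use R w in blast)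
    then obtain r :: "nat \<Rightarrow> nat" where r: "strict_mono r" "\<forall>i j. (\<integral>\<^sup>+x\<in>?S. ennreal (\<bar>transplant c B (w (r i)) x - transplant c B (w (r j)) x\<bar> powr p0) \<partial>lborel) \<le> ennreal s"
      by (elim exE conjE)
    show "\<exists>r::nat \<Rightarrow> nat. strict_mono r \<and> (\<forall>i j. (\<integral>\<^sup>+x\<in>U. ennreal (\<bar>w (r i) x - w (r j) x\<bar> powr p x) \<partial>?\<mu>) \<le> ennreal e)"
    proof (intro exI[of _ r] conjI allI r(1))
      fix i j
      have wu: "w (r i) \<in> unit_sobolev M q" "w (r j) \<in> unit_sobolev M q" using w by auto
      have "(\<integral>\<^sup>+x\<in>U. ennreal (\<bar>w (r i) x - w (r j) x\<bar> powr p x) \<partial>?\<mu>) \<le> ennreal (d1 * (\<eta> * vol B + b * s))"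
      proof (rule key)
        show "(\<lambda>x. w (r i) x - w (r j) x) \<in> borel_measurable ?\<mu>" using wm[OF wu(1)] wm[OF wu(2)] by measurable
        show "(\<lambda>y. transplant c B (w (r i)) y - transplant c B (w (r j)) y) \<in> borel_measurable borel"
          using tm[OF wu(1)] tm[OF wu(2)] by measurable
        show "(\<integral>\<^sup>+y\<in>?S. ennreal (\<bar>transplant c B (w (r i)) y - transplant c B (w (r j)) y\<bar> powr p0) \<partial>lborel) \<le> ennreal s"
          using r(2) by blast
        show "t powr p (chart_inv c y) \<le> \<eta> + b * t powr p0" if "y \<in> ?S" "0 \<le> t" for y t
          unfolding b_def using expo[OF that(1)] \<eta> that by (intro powr_le_small_plus(1)) auto
      qed (use \<eta> b s in \<open>simp_all add: transplant_def\<close>)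
      also have "\<dots> \<le> ennreal e" using \<eta>e s(2) by (intro ennreal_leI) (simp add: distrib_left)
      finally show "(\<integral>\<^sup>+x\<in>U. ennreal (\<bar>w (r i) x - w (r j) x\<bar> powr p x) \<partial>?\<mu>) \<le> ennreal e" .
    qed
  qed
  then show ?thesis using U fin by blast
qed

end

section \<open>From local to global\<close>

lemma nn_integral_le_sum_cover:
  assumes fin: "finite \<F>" and sub: "\<F> \<subseteq> sets \<mu>" and cov: "space \<mu> \<subseteq> \<Union>\<F>" and F: "F \<in> borel_measurable \<mu>"
  shows "(\<integral>\<^sup>+x. F x \<partial>\<mu>) \<le> (\<Sum>U\<in>\<F>. \<integral>\<^sup>+x\<in>U. F x \<partial>\<mu>)"
proof -
  have "(\<integral>\<^sup>+x. F x \<partial>\<mu>) \<le> (\<integral>\<^sup>+x. (\<Sum>U\<in>\<F>. F x * indicator U x) \<partial>\<mu>)"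
  proof (rule nn_integral_mono)
    fix x assume "x \<in> space \<mu>"
    then obtain U where U: "U \<in> \<F>" "x \<in> U" using cov by blast
    then have "F x = (\<Sum>U\<in>{U}. F x * indicator U x)" by simp
    also have "\<dots> \<le> (\<Sum>U\<in>\<F>. F x * indicator U x)" using fin U by (intro sum_mono2) auto
    finally show "F x \<le> (\<Sum>U\<in>\<F>. F x * indicator U x)" .
  qed
  also have "\<dots> = (\<Sum>U\<in>\<F>. \<integral>\<^sup>+x\<in>U. F x \<partial>\<mu>)"
    using sub F by (intro nn_integral_sum) (auto intro!: borel_measurable_times_ennreal borel_measurable_indicator)
  finally show ?thesis .
qed

lemma precompact_onD:
  assumes "precompact_on M p \<W> U" "0 < e" "\<forall>k::nat. w k \<in> \<W>"
  shows "\<exists>r::nat \<Rightarrow> nat. strict_mono r \<and>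
    (\<forall>i j. (\<integral>\<^sup>+x\<in>U. ennreal (\<bar>w (r i) x - w (r j) x\<bar> powr p x) \<partial>riemannian_volume M) \<le> ennreal e)"
  using assms(1)[unfolded precompact_on_def, THEN conjunct2, THEN spec, THEN mp, OF assms(2), THEN spec, THEN mp, OF assms(3)] .

lemma precompact_on_sum:
  assumes "finite \<F>" "\<forall>U\<in>\<F>. precompact_on M p \<W> U" "0 < e" "\<forall>k::nat. w k \<in> \<W>"
  shows "\<exists>r::nat \<Rightarrow> nat. strict_mono r \<and>
    (\<forall>i j. (\<Sum>U\<in>\<F>. \<integral>\<^sup>+x\<in>U. ennreal (\<bar>w (r i) x - w (r j) x\<bar> powr p x) \<partial>riemannian_volume M) \<le> ennreal e)"
  using assms
proof (induction \<F> arbitrary: w e rule: finite_induct)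
  case empty
  have "strict_mono (\<lambda>i::nat. i)" by (simp add: strict_mono_def)
  then show ?case by (intro exI[of _ "\<lambda>i. i"]) simp
next
  case (insert U \<F>)
  let ?I = "\<lambda>U u v. \<integral>\<^sup>+x\<in>U. ennreal (\<bar>u x - v x\<bar> powr p x) \<partial>riemannian_volume M"
  have e: "0 < e / 2" using insert.prems(2) by simp
  have "\<exists>r::nat \<Rightarrow> nat. strict_mono r \<and> (\<forall>i j. (\<Sum>U\<in>\<F>. ?I U (w (r i)) (w (r j))) \<le> ennreal (e / 2))"
    by (rule insert.IH) (use insert.prems in auto)
  then obtain r :: "nat \<Rightarrow> nat" where r: "strict_mono r" "\<forall>i j. (\<Sum>U\<in>\<F>. ?I U (w (r i)) (w (r j))) \<le> ennreal (e / 2)"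
    by (elim exE conjE)
  have wr: "\<forall>k. w (r k) \<in> \<W>" using insert.prems(3) by blast
  have "precompact_on M p \<W> U" using insert.prems(1) by blast
  from precompact_onD[OF this e wr] have "\<exists>s::nat \<Rightarrow> nat. strict_mono s \<and> (\<forall>i j. ?I U (w (r (s i))) (w (r (s j))) \<le> ennreal (e / 2))" .
  then obtain s :: "nat \<Rightarrow> nat" where s: "strict_mono s" "\<forall>i j. ?I U (w (r (s i))) (w (r (s j))) \<le> ennreal (e / 2)"
    by (elim exE conjE)
  show ?case
  proof (intro exI[of _ "\<lambda>i. r (s i)"] conjI allI)
    show "strict_mono (\<lambda>i. r (s i))" using r(1) s(1) by (simp add: strict_mono_def)
    fix i j
    have "(\<Sum>U\<in>insert U \<F>. ?I U (w (r (s i))) (w (r (s j)))) =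
      ?I U (w (r (s i))) (w (r (s j))) + (\<Sum>U\<in>\<F>. ?I U (w (r (s i))) (w (r (s j))))"
      using insert.hyps by simp
    also have "\<dots> \<le> ennreal (e / 2) + ennreal (e / 2)" using r(2) s(2) by (intro add_mono) auto
    also have "\<dots> = ennreal e" using e by (subst ennreal_plus[symmetric]) auto
    finally show "(\<Sum>U\<in>insert U \<F>. ?I U (w (r (s i))) (w (r (s j)))) \<le> ennreal e" .
  qed
qed

lemma precompact_on_sum_bound:
  assumes "finite \<F>" "\<forall>U\<in>\<F>. precompact_on M p \<W> U"
  shows "\<exists>C\<ge>0. \<forall>w\<in>\<W>. (\<Sum>U\<in>\<F>. \<integral>\<^sup>+x\<in>U. ennreal (\<bar>w x\<bar> powr p x) \<partial>riemannian_volume M) \<le> ennreal C"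
proof -
  have "\<forall>U\<in>\<F>. \<exists>C\<ge>0. \<forall>w\<in>\<W>. (\<integral>\<^sup>+x\<in>U. ennreal (\<bar>w x\<bar> powr p x) \<partial>riemannian_volume M) \<le> ennreal C"
    using assms(2) unfolding precompact_on_def by blast
  then have "\<exists>C. \<forall>U\<in>\<F>. 0 \<le> C U \<and> (\<forall>w\<in>\<W>. (\<integral>\<^sup>+x\<in>U. ennreal (\<bar>w x\<bar> powr p x) \<partial>riemannian_volume M) \<le> ennreal (C U))"
    by (intro bchoice) blast
  then obtain C where C: "\<forall>U\<in>\<F>. 0 \<le> C U \<and> (\<forall>w\<in>\<W>. (\<integral>\<^sup>+x\<in>U. ennreal (\<bar>w x\<bar> powr p x) \<partial>riemannian_volume M) \<le> ennreal (C U))"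
    by (elim exE)
  show ?thesis
  proof (intro exI[of _ "\<Sum>U\<in>\<F>. C U"] conjI ballI)
    show "0 \<le> (\<Sum>U\<in>\<F>. C U)" using C by (simp add: sum_nonneg)
    fix w assume "w \<in> \<W>"
    then have "(\<Sum>U\<in>\<F>. \<integral>\<^sup>+x\<in>U. ennreal (\<bar>w x\<bar> powr p x) \<partial>riemannian_volume M) \<le> (\<Sum>U\<in>\<F>. ennreal (C U))"
      using C by (intro sum_mono) blast
    also have "\<dots> = ennreal (\<Sum>U\<in>\<F>. C U)" using C by (intro sum_ennreal) blast
    finally show "(\<Sum>U\<in>\<F>. \<integral>\<^sup>+x\<in>U. ennreal (\<bar>w x\<bar> powr p x) \<partial>riemannian_volume M) \<le> ennreal (\<Sum>U\<in>\<F>. C U)" .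
  qed
qed

lemma precompact_on_space:
  assumes fin: "finite \<F>" and sub: "\<F> \<subseteq> sets (riemannian_volume M)" and cov: "space (riemannian_volume M) \<subseteq> \<Union>\<F>"
    and pc: "\<forall>U\<in>\<F>. precompact_on M p \<W> U"
    and [measurable]: "p \<in> borel_measurable (riemannian_volume M)"
    and \<W>: "\<W> \<subseteq> borel_measurable (riemannian_volume M)"
  shows "\<exists>C\<ge>0. \<forall>w\<in>\<W>. modular M p w \<le> ennreal C"
    and "0 < e \<Longrightarrow> (\<forall>k::nat. w k \<in> \<W>) \<Longrightarrow> \<exists>r::nat \<Rightarrow> nat. strict_mono r \<and> (\<forall>i j. modular M p (\<lambda>x. w (r i) x - w (r j) x) \<le> ennreal e)"
proof -
  have le: "modular M p u \<le> (\<Sum>U\<in>\<F>. \<integral>\<^sup>+x\<in>U. ennreal (\<bar>u x\<bar> powr p x) \<partial>riemannian_volume M)"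
    if [measurable]: "u \<in> borel_measurable (riemannian_volume M)" for u
    unfolding modular_def by (rule nn_integral_le_sum_cover[OF fin sub cov]) measurable
  obtain C where "0 \<le> C" "\<forall>w\<in>\<W>. (\<Sum>U\<in>\<F>. \<integral>\<^sup>+x\<in>U. ennreal (\<bar>w x\<bar> powr p x) \<partial>riemannian_volume M) \<le> ennreal C"
    using precompact_on_sum_bound[OF fin pc] by (elim exE conjE)
  then show "\<exists>C\<ge>0. \<forall>w\<in>\<W>. modular M p w \<le> ennreal C"
    using le \<W> by (intro exI[of _ C]) (meson order_trans subsetD)
  assume e: "0 < e" and w: "\<forall>k::nat. w k \<in> \<W>"
  obtain r :: "nat \<Rightarrow> nat" where r: "strict_mono r" "\<forall>i j. (\<Sum>U\<in>\<F>. \<integral>\<^sup>+x\<in>U. ennreal (\<bar>w (r i) x - w (r j) x\<bar> powr p x) \<partial>riemannian_volume M) \<le> ennreal e"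
    using precompact_on_sum[OF fin pc e w] by (elim exE conjE)
  show "\<exists>r::nat \<Rightarrow> nat. strict_mono r \<and> (\<forall>i j. modular M p (\<lambda>x. w (r i) x - w (r j) x) \<le> ennreal e)"
  proof (intro exI[of _ r] conjI allI r(1))
    fix i j
    have [measurable]: "w k \<in> borel_measurable (riemannian_volume M)" for k using w \<W> by blast
    have "modular M p (\<lambda>x. w (r i) x - w (r j) x) \<le> (\<Sum>U\<in>\<F>. \<integral>\<^sup>+x\<in>U. ennreal (\<bar>w (r i) x - w (r j) x\<bar> powr p x) \<partial>riemannian_volume M)"
      by (rule le) measurable
    also have "\<dots> \<le> ennreal e" using r(2) by blast
    finally show "modular M p (\<lambda>x. w (r i) x - w (r j) x) \<le> ennreal e" .
  qed
qed

text \<open>Diagonal sequence over the tolerances \<open>1/(n+1)\<close>.\<close>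

lemma modular_Cauchy_subsequence:
  assumes eps: "\<And>e w. 0 < e \<Longrightarrow> \<forall>k::nat. w k \<in> \<W> \<Longrightarrow> \<exists>r::nat \<Rightarrow> nat. strict_mono r \<and> (\<forall>i j. modular M p (\<lambda>x. w (r i) x - w (r j) x) \<le> ennreal e)"
    and w: "\<forall>k::nat. w k \<in> \<W>"
  shows "\<exists>s::nat \<Rightarrow> nat. strict_mono s \<and> (\<forall>n. \<forall>i>n. \<forall>j>n. modular M p (\<lambda>x. w (s i) x - w (s j) x) \<le> ennreal (1 / real (Suc n)))"
proof -
  define P where "P n s \<longleftrightarrow> (\<forall>i j. modular M p (\<lambda>x. w (s i) x - w (s j) x) \<le> ennreal (1 / real (Suc n)))" for n and s :: "nat \<Rightarrow> nat"
  interpret subseqs P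
  proof
    fix n and s :: "nat \<Rightarrow> nat"
    have "\<forall>k. w (s k) \<in> \<W>" using w by blast
    then have "\<exists>r::nat \<Rightarrow> nat. strict_mono r \<and> (\<forall>i j. modular M p (\<lambda>x. w (s (r i)) x - w (s (r j)) x) \<le> ennreal (1 / real (Suc n)))"
      by (intro eps) simp_all
    then show "\<exists>r'. strict_mono r' \<and> P n (s \<circ> r')" by (simp only: P_def o_def)
  qed
  have "P n (diagseq \<circ> (+) (Suc n))" for n
    by (rule diagseq_holds) (simp add: P_def o_def)
  then have *: "modular M p (\<lambda>x. w (diagseq (Suc n + i)) x - w (diagseq (Suc n + j)) x) \<le> ennreal (1 / real (Suc n))" for n i j
    unfolding P_def o_def by blast
  show ?thesis
  proof (intro exI[of _ diagseq] conjI allI impI subseq_diagseq)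
    fix n i j :: nat assume "n < i" "n < j"
    then show "modular M p (\<lambda>x. w (diagseq i) x - w (diagseq j) x) \<le> ennreal (1 / real (Suc n))"
      using *[of n "i - Suc n" "j - Suc n"] by (simp only: le_add_diff_inverse Suc_leI)
  qed
qed

lemma nn_integral_le_small_plus_modular:
  assumes [measurable]: "p \<in> borel_measurable (riemannian_volume M)" "u \<in> borel_measurable (riemannian_volume M)"
    and p: "\<And>x. x \<in> space (riemannian_volume M) \<Longrightarrow> 1 \<le> p x \<and> p x \<le> P" and \<eta>: "0 < \<eta>" "\<eta> < 1"
  shows "(\<integral>\<^sup>+x. ennreal \<bar>u x\<bar> \<partial>riemannian_volume M) \<le>
     ennreal \<eta> * emeasure (riemannian_volume M) (space (riemannian_volume M)) + ennreal (\<eta> powr (1 - P)) * modular M p u"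
proof -
  let ?\<mu> = "riemannian_volume M"
  have "(\<integral>\<^sup>+x. ennreal \<bar>u x\<bar> \<partial>?\<mu>) \<le> (\<integral>\<^sup>+x. ennreal \<eta> + ennreal (\<eta> powr (1 - P)) * ennreal (\<bar>u x\<bar> powr p x) \<partial>?\<mu>)"
  proof (rule nn_integral_mono)
    fix x assume "x \<in> space ?\<mu>"
    then have "\<bar>u x\<bar> \<le> \<eta> + \<eta> powr (1 - P) * \<bar>u x\<bar> powr p x" using p \<eta> by (intro powr_le_small_plus(2)) auto
    then have "ennreal \<bar>u x\<bar> \<le> ennreal (\<eta> + \<eta> powr (1 - P) * \<bar>u x\<bar> powr p x)" by (rule ennreal_leI)
    also have "\<dots> = ennreal \<eta> + ennreal (\<eta> powr (1 - P)) * ennreal (\<bar>u x\<bar> powr p x)" using \<eta> by (simp add: ennreal_mult)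
    finally show "ennreal \<bar>u x\<bar> \<le> ennreal \<eta> + ennreal (\<eta> powr (1 - P)) * ennreal (\<bar>u x\<bar> powr p x)" .
  qed
  also have "\<dots> = (\<integral>\<^sup>+x. ennreal \<eta> \<partial>?\<mu>) + (\<integral>\<^sup>+x. ennreal (\<eta> powr (1 - P)) * ennreal (\<bar>u x\<bar> powr p x) \<partial>?\<mu>)"
    by (rule nn_integral_add) measurable
  also have "(\<integral>\<^sup>+x. ennreal (\<eta> powr (1 - P)) * ennreal (\<bar>u x\<bar> powr p x) \<partial>?\<mu>) = ennreal (\<eta> powr (1 - P)) * modular M p u"
    unfolding modular_def by (rule nn_integral_cmult) measurable
  finally show ?thesis by simp
qed

text \<open>A modular Cauchy sequence is Cauchy in \<open>L^1\<close> because the measure is finite. A subsequence converges almost everywhere,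
and Fatou's lemma turns the Cauchy bounds into bounds for the distance to the limit.\<close>

lemma modular_complete:
  fixes w :: "nat \<Rightarrow> 'a \<Rightarrow> real" and M :: "('a, 'n::{finite,wellorder}) riemannian_space"
  assumes fin: "emeasure (riemannian_volume M) (space (riemannian_volume M)) < \<infinity>"
    and [measurable]: "p \<in> borel_measurable (riemannian_volume M)" "\<And>k. w k \<in> borel_measurable (riemannian_volume M)"
    and p: "\<And>x. x \<in> space (riemannian_volume M) \<Longrightarrow> 1 \<le> p x \<and> p x \<le> P"
    and w: "\<And>k. modular M p (w k) < \<infinity>"
    and Cau: "\<forall>n. \<forall>i>n. \<forall>j>n. modular M p (\<lambda>x. w i x - w j x) \<le> ennreal (1 / real (Suc n))"
  obtains r v where "strict_mono r" "v \<in> borel_measurable (riemannian_volume M)"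
    "\<forall>n. \<forall>i>n. modular M p (\<lambda>x. w (r i) x - v x) \<le> ennreal (1 / real (Suc n))"
proof -
  let ?\<mu> = "riemannian_volume M"
  define m where "m = measure ?\<mu> (space ?\<mu>)"
  have m: "emeasure ?\<mu> (space ?\<mu>) = ennreal m" using fin by (simp add: m_def emeasure_eq_ennreal_measure)
  have m0: "0 \<le> m" by (simp add: m_def)
  have int: "integrable ?\<mu> (w k)" for k
  proof (rule integrableI_bounded)
    \<comment> \<open>any number strictly between \<open>0\<close> and \<open>1\<close>\<close>
    define h :: real where "h = 1/2"
    have h: "0 < h" "h < 1" by (simp_all add: h_def)
    have "(\<integral>\<^sup>+x. ennreal \<bar>w k x\<bar> \<partial>?\<mu>) \<le> ennreal h * ennreal m + ennreal (h powr (1 - P)) * modular M p (w k)"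
      unfolding m[symmetric] by (rule nn_integral_le_small_plus_modular[OF _ _ p h]) simp_all
    also have "\<dots> < \<infinity>" using w[of k] by (simp add: ennreal_mult_less_top)
    finally show "(\<integral>\<^sup>+x. ennreal (norm (w k x)) \<partial>?\<mu>) < \<infinity>" by simp
  qed simp
  have L1: "\<exists>N. \<forall>i\<ge>N. \<forall>j\<ge>N. (LINT x|?\<mu>. norm (w i x - w j x)) < e" if e: "0 < e" for e :: real
  proof -
    define \<eta> where "\<eta> = min (1/2) (e / (4 * (m + 1)))"
    have \<eta>: "0 < \<eta>" "\<eta> < 1" using e m0 by (auto simp: \<eta>_def)
    have "\<eta> \<le> e / (4 * (m + 1))" by (simp add: \<eta>_def)
    then have "\<eta> * (m + 1) \<le> e / 4" using m0 by (simp add: field_simps)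
    moreover have "\<eta> * m \<le> \<eta> * (m + 1)" using \<eta> by simp
    ultimately have \<eta>m: "\<eta> * m \<le> e / 4" by simp
    define b where "b = \<eta> powr (1 - P)"
    have b: "0 < b" using \<eta> by (simp add: b_def)
    obtain n where n: "1 / real (Suc n) < e / (4 * b)"
      using reals_Archimedean[of "e / (4 * b)"] e b by (auto simp: inverse_eq_divide)
    show ?thesis
    proof (intro exI[of _ "Suc n"] allI impI)
      fix i j assume "Suc n \<le> i" "Suc n \<le> j"
      then have c: "modular M p (\<lambda>x. w i x - w j x) \<le> ennreal (1 / real (Suc n))" using Cau by simp
      have "(\<integral>\<^sup>+x. ennreal \<bar>w i x - w j x\<bar> \<partial>?\<mu>) \<le> ennreal \<eta> * ennreal m + ennreal b * modular M p (\<lambda>x. w i x - w j x)"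
        unfolding m[symmetric] b_def by (rule nn_integral_le_small_plus_modular[OF _ _ p \<eta>]) simp_all
      also have "\<dots> \<le> ennreal \<eta> * ennreal m + ennreal b * ennreal (e / (4 * b))"
        using order_trans[OF c ennreal_leI[OF less_imp_le[OF n]]] by (intro add_left_mono mult_left_mono) auto
      also have "\<dots> = ennreal (\<eta> * m + b * (e / (4 * b)))"
      proof -
        have "ennreal (\<eta> * m) = ennreal \<eta> * ennreal m" using \<eta> m0 by (intro ennreal_mult) auto
        moreover have "ennreal (b * (e / (4 * b))) = ennreal b * ennreal (e / (4 * b))"
          using b e by (intro ennreal_mult) auto
        moreover have "ennreal (\<eta> * m + b * (e / (4 * b))) = ennreal (\<eta> * m) + ennreal (b * (e / (4 * b)))"
          using \<eta> m0 b e by (intro ennreal_plus) auto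
        ultimately show ?thesis by (simp only:)
      qed
      also have "b * (e / (4 * b)) = e / 4" using b by simp
      finally have le: "(\<integral>\<^sup>+x. ennreal \<bar>w i x - w j x\<bar> \<partial>?\<mu>) \<le> ennreal (\<eta> * m + e / 4)" .
      have "integrable ?\<mu> (\<lambda>x. norm (w i x - w j x))" using int by (intro integrable_norm Bochner_Integration.integrable_diff)
      then have "ennreal (LINT x|?\<mu>. norm (w i x - w j x)) = (\<integral>\<^sup>+x. ennreal (norm (w i x - w j x)) \<partial>?\<mu>)"
        by (intro nn_integral_eq_integral[symmetric]) auto
      then have "ennreal (LINT x|?\<mu>. norm (w i x - w j x)) \<le> ennreal (\<eta> * m + e / 4)" using le by simp
      then have "(LINT x|?\<mu>. norm (w i x - w j x)) \<le> \<eta> * m + e / 4"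
        using \<eta> m0 e by (subst (asm) ennreal_le_iff) auto
      then show "(LINT x|?\<mu>. norm (w i x - w j x)) < e" using \<eta>m e by linarith
    qed
  qed
  obtain r where r: "strict_mono r" "AE x in ?\<mu>. Cauchy (\<lambda>i. w (r i) x)"
    by (rule cauchy_L1_AE_cauchy_subseq[OF int L1])
  define v where "v x = lim (\<lambda>i. w (r i) x)" for x
  have vm [measurable]: "v \<in> borel_measurable ?\<mu>"
    unfolding v_def[abs_def] by (rule borel_measurable_lim_metric) simp
  show thesis
  proof (rule that[OF r(1) vm], intro allI impI)
    fix n i :: nat assume i: "n < i"
    have "modular M p (\<lambda>x. w (r i) x - v x) = (\<integral>\<^sup>+x. liminf (\<lambda>j. ennreal (\<bar>w (r i) x - w (r j) x\<bar> powr p x)) \<partial>?\<mu>)"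
      unfolding modular_def
    proof (rule nn_integral_cong_AE)
      show "AE x in ?\<mu>. ennreal (\<bar>w (r i) x - v x\<bar> powr p x) = liminf (\<lambda>j. ennreal (\<bar>w (r i) x - w (r j) x\<bar> powr p x))"
        using r(2) AE_space
      proof eventually_elim
        case (elim x)
        have px: "0 < p x" using p[OF elim(2)] by simp
        have "(\<lambda>j. w (r j) x) \<longlonglongrightarrow> v x"
          using elim(1) unfolding v_def by (simp add: Cauchy_convergent_iff convergent_LIMSEQ_iff)
        then have "(\<lambda>j. \<bar>w (r i) x - w (r j) x\<bar> powr p x) \<longlonglongrightarrow> \<bar>w (r i) x - v x\<bar> powr p x"
          using px by (intro tendsto_powr' tendsto_intros) auto
        then have "(\<lambda>j. ennreal (\<bar>w (r i) x - w (r j) x\<bar> powr p x)) \<longlonglongrightarrow> ennreal (\<bar>w (r i) x - v x\<bar> powr p x)"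
          by (rule tendsto_ennrealI)
        then show ?case by (intro lim_imp_Liminf[symmetric]) auto
      qed
    qed
    also have "\<dots> \<le> liminf (\<lambda>j. modular M p (\<lambda>x. w (r i) x - w (r j) x))"
      unfolding modular_def by (rule nn_integral_liminf) measurable
    also have "\<dots> \<le> limsup (\<lambda>j. modular M p (\<lambda>x. w (r i) x - w (r j) x))" by (rule Liminf_le_Limsup) simp
    also have "\<dots> \<le> ennreal (1 / real (Suc n))"
    proof (rule Limsup_bounded, rule eventually_sequentiallyI[of "Suc n"])
      fix j assume "Suc n \<le> j"
      then have "n < r j" "n < r i" using i seq_suble[OF r(1), of j] seq_suble[OF r(1), of i] by auto
      then show "modular M p (\<lambda>x. w (r i) x - w (r j) x) \<le> ennreal (1 / real (Suc n))" using Cau by blast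
    qed
    finally show "modular M p (\<lambda>x. w (r i) x - v x) \<le> ennreal (1 / real (Suc n))" .
  qed
qed

lemma precompact_unit_sobolev:
  fixes M :: "('a, 'n::{finite,wellorder}) riemannian_space"
  assumes M: "riemannian_manifold M" and comp: "compact_space (mtop M)"
    and p: "variable_exponent M p" and q: "variable_exponent M q"
    and qN: "\<forall>x\<in>topspace (mtop M). q x < real CARD('n)"
    and pq: "\<forall>x\<in>topspace (mtop M). p x < real CARD('n) * q x / (real CARD('n) - q x)"
  shows "emeasure (riemannian_volume M) (space (riemannian_volume M)) < \<infinity>"
    and "\<exists>C\<ge>0. \<forall>w\<in>unit_sobolev M q. modular M p w \<le> ennreal C"
    and "0 < e \<Longrightarrow> (\<forall>k::nat. w k \<in> unit_sobolev M q) \<Longrightarrow>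
      \<exists>r::nat \<Rightarrow> nat. strict_mono r \<and> (\<forall>i j. modular M p (\<lambda>x. w (r i) x - w (r j) x) \<le> ennreal e)"
proof -
  let ?\<mu> = "riemannian_volume M"
  define \<U> where "\<U> = {U. openin (mtop M) U \<and> emeasure ?\<mu> U < \<infinity> \<and> precompact_on M p (unit_sobolev M q) U}"
  have "\<exists>U\<in>\<U>. x \<in> U" if "x \<in> topspace (mtop M)" for x
    using local_compactness[OF M p q that qN[rule_format, OF that] pq[rule_format, OF that]]
    unfolding \<U>_def by blast
  then have cover: "topspace (mtop M) \<subseteq> \<Union>\<U>" by blast
  have "\<forall>U\<in>\<U>. openin (mtop M) U" by (simp add: \<U>_def)
  from comp[unfolded compact_space_alt, THEN spec, THEN mp, OF conjI[OF this cover]]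
  obtain \<F> where \<F>: "finite \<F>" "\<F> \<subseteq> \<U>" "topspace (mtop M) \<subseteq> \<Union>\<F>" by (elim exE conjE)
  have sub: "\<F> \<subseteq> sets ?\<mu>"
    using \<F>(2) openin_sets[OF M] unfolding sets_volume[OF M] \<U>_def by blast
  have cov: "space ?\<mu> \<subseteq> \<Union>\<F>" using \<F>(3) by (simp add: space_volume[OF M])
  have pc: "\<forall>U\<in>\<F>. precompact_on M p (unit_sobolev M q) U" using \<F>(2) by (auto simp: \<U>_def)
  have pm: "p \<in> borel_measurable ?\<mu>" using p by (intro continuous_map_measurable[OF M]) (simp add: variable_exponent_def)
  have W: "unit_sobolev M q \<subseteq> borel_measurable ?\<mu>" by (auto simp: unit_sobolev_def)
  show "emeasure ?\<mu> (space ?\<mu>) < \<infinity>"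
  proof -
    have "emeasure ?\<mu> (space ?\<mu>) \<le> emeasure ?\<mu> (\<Union>U\<in>\<F>. U)" using cov sub \<F>(1) by (intro emeasure_mono) auto
    also have "\<dots> \<le> (\<Sum>U\<in>\<F>. emeasure ?\<mu> U)" by (rule emeasure_subadditive_finite) (use \<F>(1) sub in auto)
    also have "\<dots> < \<infinity>" using \<F> by (auto simp: \<U>_def)
    finally show ?thesis .
  qed
  show "\<exists>C\<ge>0. \<forall>w\<in>unit_sobolev M q. modular M p w \<le> ennreal C"
    by (rule precompact_on_space(1)[OF \<F>(1) sub cov pc pm W])
  show "0 < e \<Longrightarrow> (\<forall>k::nat. w k \<in> unit_sobolev M q) \<Longrightarrow>
      \<exists>r::nat \<Rightarrow> nat. strict_mono r \<and> (\<forall>i j. modular M p (\<lambda>x. w (r i) x - w (r j) x) \<le> ennreal e)"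
    by (rule precompact_on_space(2)[OF \<F>(1) sub cov pc pm W])
qed

section \<open>Luxemburg norms and the embedding theorem\<close>

lemma Lvar_modular: "Lvar M r = {u \<in> borel_measurable (riemannian_volume M). modular M r u < \<infinity>}"
  by (simp add: Lvar_def modular_def)

lemma Lvar_norm_modular: "Lvar_norm M r u = Inf {\<gamma>. 0 < \<gamma> \<and> modular M r (\<lambda>x. u x / \<gamma>) \<le> 1}"
  by (simp add: Lvar_norm_def modular_def)

lemma modular_scale:
  assumes [measurable]: "r \<in> borel_measurable (riemannian_volume M)" "u \<in> borel_measurable (riemannian_volume M)"
    and \<kappa>: "0 < \<kappa>" "0 \<le> K" "\<And>x. x \<in> space (riemannian_volume M) \<Longrightarrow> \<kappa> powr r x \<le> K"
  shows "modular M r (\<lambda>x. \<kappa> * u x) \<le> ennreal K * modular M r u"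
proof -
  have "modular M r (\<lambda>x. \<kappa> * u x) \<le> (\<integral>\<^sup>+x. ennreal K * ennreal (\<bar>u x\<bar> powr r x) \<partial>riemannian_volume M)"
    unfolding modular_def
  proof (rule nn_integral_mono)
    fix x assume x: "x \<in> space (riemannian_volume M)"
    have "\<bar>\<kappa> * u x\<bar> powr r x = \<kappa> powr r x * \<bar>u x\<bar> powr r x" using \<kappa>(1) by (simp add: abs_mult powr_mult)
    also have "\<dots> \<le> K * \<bar>u x\<bar> powr r x" using \<kappa>(3)[OF x] by (rule mult_right_mono) simp
    finally have "ennreal (\<bar>\<kappa> * u x\<bar> powr r x) \<le> ennreal (K * \<bar>u x\<bar> powr r x)" by (rule ennreal_leI)
    then show "ennreal (\<bar>\<kappa> * u x\<bar> powr r x) \<le> ennreal K * ennreal (\<bar>u x\<bar> powr r x)" using \<kappa>(2) by (simp add: ennreal_mult)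
  qed
  also have "\<dots> = ennreal K * modular M r u" unfolding modular_def by (rule nn_integral_cmult) measurable
  finally show ?thesis .
qed

text \<open>For exponents at least \<open>1\<close>, dividing by \<open>C \<ge> 1\<close> divides the modular by at least \<open>C\<close>.\<close>

lemma modular_divide_ge_1:
  assumes "r \<in> borel_measurable (riemannian_volume M)" "u \<in> borel_measurable (riemannian_volume M)"
    and "\<And>x. x \<in> space (riemannian_volume M) \<Longrightarrow> 1 \<le> r x" and C: "1 \<le> C" "modular M r u \<le> ennreal C"
  shows "modular M r (\<lambda>x. u x / C) \<le> 1"
proof -
  have "modular M r (\<lambda>x. (1 / C) * u x) \<le> ennreal (1 / C) * modular M r u"
  proof (rule modular_scale[OF assms(1,2)])
    fix x assume "x \<in> space (riemannian_volume M)"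
    then have "(1 / C) powr r x \<le> (1 / C) powr 1" using assms(3) C(1) by (intro powr_mono') auto
    then show "(1 / C) powr r x \<le> 1 / C" using C(1) by simp
  qed (use C in auto)
  also have "\<dots> \<le> ennreal (1 / C) * ennreal C" using C(2) by (rule mult_left_mono) simp
  also have "\<dots> = 1" using C(1) by (subst ennreal_mult'[symmetric]) auto
  finally show ?thesis by simp
qed

context
  fixes M :: "('a, 'n::{finite,wellorder}) riemannian_space" and r :: "'a \<Rightarrow> real"
  assumes r_meas: "r \<in> borel_measurable (riemannian_volume M)"
    and r_ge_1: "\<And>x. x \<in> space (riemannian_volume M) \<Longrightarrow> 1 \<le> r x"
begin

lemma Lvar_norm_le:
  assumes "u \<in> borel_measurable (riemannian_volume M)" "0 < \<gamma>" "1 \<le> C" "modular M r (\<lambda>x. u x / \<gamma>) \<le> ennreal C"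
  shows "Lvar_norm M r u \<le> \<gamma> * C"
proof -
  have "modular M r (\<lambda>x. u x / \<gamma> / C) \<le> 1"
    by (rule modular_divide_ge_1[OF r_meas _ r_ge_1 assms(3,4)]) (use assms(1) in measurable)
  then have "\<gamma> * C \<in> {\<gamma>. 0 < \<gamma> \<and> modular M r (\<lambda>x. u x / \<gamma>) \<le> 1}" using assms(2,3) by simp
  then show ?thesis unfolding Lvar_norm_modular by (intro cInf_lower) (auto intro: bdd_belowI[of _ 0])
qed

lemma Lvar_norm_attained:
  assumes u: "u \<in> Lvar M r"
  shows "{\<gamma>. 0 < \<gamma> \<and> modular M r (\<lambda>x. u x / \<gamma>) \<le> 1} \<noteq> {}"
proof -
  have um: "u \<in> borel_measurable (riemannian_volume M)" and "modular M r u < \<infinity>" using u by (auto simp: Lvar_modular)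
  then obtain m where m: "0 \<le> m" "modular M r u = ennreal m" by (cases "modular M r u" rule: ennreal_cases) auto
  have "modular M r (\<lambda>x. u x / max 1 m) \<le> 1"
    by (rule modular_divide_ge_1[OF r_meas um r_ge_1]) (auto simp: m(2) intro: ennreal_leI)
  then have "max 1 m \<in> {\<gamma>. 0 < \<gamma> \<and> modular M r (\<lambda>x. u x / \<gamma>) \<le> 1}" by auto
  then show ?thesis by blast
qed

lemma Lvar_norm_nonneg: "u \<in> Lvar M r \<Longrightarrow> 0 \<le> Lvar_norm M r u"
  unfolding Lvar_norm_modular by (rule cInf_greatest[OF Lvar_norm_attained]) auto

text \<open>The infimum in the Luxemburg norm is approached by admissible numbers, and every larger number is admissible.\<close>

lemma modular_le_1:
  assumes u: "u \<in> Lvar M r" and g: "Lvar_norm M r u < \<gamma>"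
  shows "modular M r (\<lambda>x. u x / \<gamma>) \<le> 1"
proof -
  obtain \<gamma>' where g': "0 < \<gamma>'" "modular M r (\<lambda>x. u x / \<gamma>') \<le> 1" "\<gamma>' < \<gamma>"
    using cInf_lessD[OF Lvar_norm_attained[OF u] g[unfolded Lvar_norm_modular]] by blast
  have "modular M r (\<lambda>x. u x / \<gamma>) \<le> modular M r (\<lambda>x. u x / \<gamma>')"
    unfolding modular_def
  proof (intro nn_integral_mono ennreal_leI powr_mono2)
    fix x assume "x \<in> space (riemannian_volume M)"
    then show "0 \<le> r x" using r_ge_1[of x] by simp
    show "\<bar>u x / \<gamma>\<bar> \<le> \<bar>u x / \<gamma>'\<bar>" using g' by (simp add: frac_le)
  qed simp
  then show ?thesis using g'(2) by (rule order_trans)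
qed

end

lemma weak_partial_divide:
  assumes "weak_partial \<Omega> i f h"
  shows "weak_partial \<Omega> i (\<lambda>y. f y / \<gamma>) (\<lambda>y. h y / \<gamma>)"
proof -
  have loc: "locally_integrable \<Omega> (\<lambda>y. k y / \<gamma>)" if "locally_integrable \<Omega> k" for k
    using that by (simp add: locally_integrable_def set_integrable_divide)
  have "(LINT y:\<Omega>|lborel. f y / \<gamma> * frechet_derivative \<eta> (at y) (axis i 1)) = - (LINT y:\<Omega>|lborel. h y / \<gamma> * \<eta> y)"
    if "test_function \<Omega> \<eta>" for \<eta>
  proof -
    have "(LINT y:\<Omega>|lborel. f y * frechet_derivative \<eta> (at y) (axis i 1)) = - (LINT y:\<Omega>|lborel. h y * \<eta> y)"
      using assms that unfolding weak_partial_def by blast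
    then have "(LINT y:\<Omega>|lborel. f y * frechet_derivative \<eta> (at y) (axis i 1)) / \<gamma> = - ((LINT y:\<Omega>|lborel. h y * \<eta> y) / \<gamma>)"
      by simp
    then show ?thesis by (simp only: set_integral_divide_zero[symmetric] times_divide_eq_left)
  qed
  then show ?thesis using assms loc unfolding weak_partial_def by blast
qed

lemma is_weak_gradient_divide:
  assumes "is_weak_gradient M u V"
  shows "is_weak_gradient M (\<lambda>x. u x / \<gamma>) (\<lambda>c x. (1 / \<gamma>) *\<^sub>R V c x)"
  unfolding is_weak_gradient_def
proof (intro conjI ballI allI)
  have mV: "measurable_vector_field M V" using assms by (simp add: is_weak_gradient_def)
  show "measurable_vector_field M (\<lambda>c x. (1 / \<gamma>) *\<^sub>R V c x)"
    unfolding measurable_vector_field_def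
  proof (intro conjI ballI)
    fix c assume "c \<in> atlas M"
    then have "V c \<in> borel_measurable (restrict_space (borel_of_manifold M) (fst c))"
      using mV by (simp add: measurable_vector_field_def)
    then show "(\<lambda>x. (1 / \<gamma>) *\<^sub>R V c x) \<in> borel_measurable (restrict_space (borel_of_manifold M) (fst c))"
      by (rule borel_measurable_scaleR[OF borel_measurable_const])
  next
    fix c d x assume "c \<in> atlas M" "d \<in> atlas M" "x \<in> fst c \<inter> fst d"
    then have "V d x = transition_jacobian c d x *v V c x" using mV unfolding measurable_vector_field_def by blast
    then show "(1 / \<gamma>) *\<^sub>R V d x = transition_jacobian c d x *v ((1 / \<gamma>) *\<^sub>R V c x)"
      by (simp add: matrix_vector_mult_scaleR)
  qed
  fix c i assume "c \<in> atlas M"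
  then have "weak_partial (interior (chart_image c)) i (\<lambda>y. u (chart_inv c y))
      (\<lambda>y. (metric M c (chart_inv c y) *v V c (chart_inv c y)) $ i)"
    using assms unfolding is_weak_gradient_def by blast
  from weak_partial_divide[OF this, of \<gamma>]
  show "weak_partial (interior (chart_image c)) i (\<lambda>y. u (chart_inv c y) / \<gamma>)
      (\<lambda>y. (metric M c (chart_inv c y) *v ((1 / \<gamma>) *\<^sub>R V c (chart_inv c y))) $ i)"
    by (simp add: matrix_vector_mult_scaleR)
qed

lemma field_norm_divide:
  fixes M :: "('a, 'n::{finite,wellorder}) riemannian_space"
  assumes "0 < \<gamma>"
  shows "field_norm M (\<lambda>c x. (1 / \<gamma>) *\<^sub>R V c x) x = field_norm M V x / \<gamma>"
proof -
  have "((1 / \<gamma>) *\<^sub>R v) \<bullet> (g *v ((1 / \<gamma>) *\<^sub>R v)) = (v \<bullet> (g *v v)) / \<gamma>\<^sup>2" for v and g :: "((real, 'n) vec, 'n) vec"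
    by (simp add: matrix_vector_mult_scaleR power2_eq_square)
  then have "field_norm M (\<lambda>c x. (1 / \<gamma>) *\<^sub>R V c x) x =
      sqrt ((V (chart_at M x) x \<bullet> (metric M (chart_at M x) x *v V (chart_at M x) x)) / \<gamma>\<^sup>2)"
    by (simp only: field_norm_def Let_def)
  then show ?thesis using assms by (simp add: field_norm_def Let_def real_sqrt_divide)
qed

text \<open>The two Luxemburg norms in the Sobolev norm are nonnegative, so each of them is below \<open>\<gamma>\<close>.\<close>

lemma unit_sobolev_normalized:
  assumes qm: "q \<in> borel_measurable (riemannian_volume M)" and q1: "\<And>x. x \<in> space (riemannian_volume M) \<Longrightarrow> 1 \<le> q x"
    and u: "u \<in> W1var M q"
  shows "0 \<le> W1var_norm M q u" and "W1var_norm M q u < \<gamma> \<Longrightarrow> (\<lambda>x. u x / \<gamma>) \<in> unit_sobolev M q"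
proof -
  let ?V = "weak_gradient M u"
  have uL: "u \<in> Lvar M q" "field_norm M ?V \<in> Lvar M q" and ex: "\<exists>V. is_weak_gradient M u V"
    using u by (auto simp: W1var_def)
  have V: "is_weak_gradient M u ?V" unfolding weak_gradient_def using ex by (rule someI_ex)
  have n: "0 \<le> Lvar_norm M q u" "0 \<le> Lvar_norm M q (field_norm M ?V)"
    using uL by (auto intro: Lvar_norm_nonneg[OF qm q1])
  then show "0 \<le> W1var_norm M q u" by (simp add: W1var_norm_def)
  assume "W1var_norm M q u < \<gamma>"
  then have g: "Lvar_norm M q u < \<gamma>" "Lvar_norm M q (field_norm M ?V) < \<gamma>" "0 < \<gamma>"
    using n by (auto simp: W1var_norm_def)
  have fn: "field_norm M (\<lambda>c x. (1 / \<gamma>) *\<^sub>R ?V c x) = (\<lambda>x. field_norm M ?V x / \<gamma>)"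
    using field_norm_divide[OF g(3), of M ?V] by blast
  have m: "modular M q (\<lambda>x. u x / \<gamma>) \<le> 1" "modular M q (\<lambda>x. field_norm M ?V x / \<gamma>) \<le> 1"
    using modular_le_1[OF qm q1 uL(1) g(1)] modular_le_1[OF qm q1 uL(2) g(2)] by auto
  have um: "u \<in> borel_measurable (riemannian_volume M)" "field_norm M ?V \<in> borel_measurable (riemannian_volume M)"
    using uL by (auto simp: Lvar_modular)
  show "(\<lambda>x. u x / \<gamma>) \<in> unit_sobolev M q"
    unfolding unit_sobolev_def
  proof (intro CollectI conjI exI[of _ "\<lambda>c x. (1 / \<gamma>) *\<^sub>R ?V c x"])
    show "(\<lambda>x. u x / \<gamma>) \<in> borel_measurable (riemannian_volume M)" using um(1) by measurable
    show "modular M q (\<lambda>x. u x / \<gamma>) \<le> 1" by (rule m(1))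
    show "is_weak_gradient M (\<lambda>x. u x / \<gamma>) (\<lambda>c x. (1 / \<gamma>) *\<^sub>R ?V c x)" by (rule is_weak_gradient_divide[OF V])
    show "field_norm M (\<lambda>c x. (1 / \<gamma>) *\<^sub>R ?V c x) \<in> borel_measurable (riemannian_volume M)"
      unfolding fn using um(2) by measurable
    show "modular M q (field_norm M (\<lambda>c x. (1 / \<gamma>) *\<^sub>R ?V c x)) \<le> 1" unfolding fn by (rule m(2))
  qed
qed

lemma modular_diff_finite:
  assumes [measurable]: "r \<in> borel_measurable (riemannian_volume M)" "u \<in> borel_measurable (riemannian_volume M)" "v \<in> borel_measurable (riemannian_volume M)"
    and P: "\<And>x. x \<in> space (riemannian_volume M) \<Longrightarrow> 1 \<le> r x \<and> r x \<le> P"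
    and fin: "modular M r u < \<infinity>" "modular M r (\<lambda>x. u x - v x) < \<infinity>"
  shows "modular M r v < \<infinity>"
proof -
  let ?K = "ennreal (2 powr P)"
  have "modular M r v \<le> (\<integral>\<^sup>+x. ?K * (ennreal (\<bar>u x\<bar> powr r x) + ennreal (\<bar>u x - v x\<bar> powr r x)) \<partial>riemannian_volume M)"
    unfolding modular_def
  proof (rule nn_integral_mono)
    fix x assume "x \<in> space (riemannian_volume M)"
    then have r: "1 \<le> r x" "r x \<le> P" using P by auto
    define m where "m = max \<bar>u x\<bar> \<bar>u x - v x\<bar>"
    have "\<bar>u x\<bar> \<le> m" "\<bar>u x - v x\<bar> \<le> m" by (simp_all add: m_def)
    then have "\<bar>v x\<bar> \<le> 2 * m" by linarith
    then have "\<bar>v x\<bar> powr r x \<le> (2 * m) powr r x" using r by (intro powr_mono2) auto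
    also have "\<dots> = 2 powr r x * m powr r x" by (simp add: powr_mult m_def)
    also have "\<dots> \<le> 2 powr P * (\<bar>u x\<bar> powr r x + \<bar>u x - v x\<bar> powr r x)"
      using r by (intro mult_mono powr_mono) (auto simp: m_def max_def)
    finally have "ennreal (\<bar>v x\<bar> powr r x) \<le> ennreal (2 powr P * (\<bar>u x\<bar> powr r x + \<bar>u x - v x\<bar> powr r x))"
      by (rule ennreal_leI)
    then show "ennreal (\<bar>v x\<bar> powr r x) \<le> ?K * (ennreal (\<bar>u x\<bar> powr r x) + ennreal (\<bar>u x - v x\<bar> powr r x))"
      by (simp add: ennreal_mult)
  qed
  also have "\<dots> = ?K * (\<integral>\<^sup>+x. ennreal (\<bar>u x\<bar> powr r x) + ennreal (\<bar>u x - v x\<bar> powr r x) \<partial>riemannian_volume M)"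
    by (rule nn_integral_cmult) measurable
  also have "(\<integral>\<^sup>+x. ennreal (\<bar>u x\<bar> powr r x) + ennreal (\<bar>u x - v x\<bar> powr r x) \<partial>riemannian_volume M) =
     modular M r u + modular M r (\<lambda>x. u x - v x)"
    unfolding modular_def by (rule nn_integral_add) measurable
  also have "?K * \<dots> < \<infinity>" using fin by (simp add: ennreal_mult_less_top)
  finally show ?thesis .
qed

text \<open>The bound for the modular on \<open>unit_sobolev\<close> yields the continuous embedding by homogeneity: any \<open>\<gamma>\<close> above the
Sobolev norm of \<open>u\<close> puts \<open>u/\<gamma>\<close> into that set. For a bounded sequence one \<open>\<gamma>\<close> works for all members; the modular
limit of a subsequence of the rescaled functions, multiplied by \<open>\<gamma>\<close>, is the limit in the norm.\<close>

theorem theorem2p5: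
  fixes M :: "('a, 'n::{finite,wellorder}) riemannian_space"
    and p q :: "'a \<Rightarrow> real"
  assumes "riemannian_manifold M" and "compact_space (mtop M)"
    and "variable_exponent M p" and "variable_exponent M q"
    and "\<forall>x\<in>topspace (mtop M). q x < real CARD('n)"
    and "\<forall>x\<in>topspace (mtop M). p x < real CARD('n) * q x / (real CARD('n) - q x)"
  shows "continuously_embedded (W1var M q) (W1var_norm M q) (Lvar M p) (Lvar_norm M p) \<and>
    compactly_embedded (W1var M q) (W1var_norm M q) (Lvar M p) (Lvar_norm M p)"
proof -
  let ?\<mu> = "riemannian_volume M"
  note M = assms(1)
  note pre = precompact_unit_sobolev[OF assms]
  have sp: "space ?\<mu> = topspace (mtop M)" by (rule space_volume[OF M])
  have pm: "p \<in> borel_measurable ?\<mu>" and qm: "q \<in> borel_measurable ?\<mu>"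
    using assms(3,4) by (auto intro!: continuous_map_measurable[OF M] simp: variable_exponent_def)
  have p1: "1 \<le> p x" and q1: "1 \<le> q x" if "x \<in> space ?\<mu>" for x
    using assms(3,4) that by (auto simp: variable_exponent_def sp less_imp_le)
  have "bounded (p ` topspace (mtop M))" using assms(3) by (simp add: variable_exponent_def)
  then obtain P where "\<forall>x\<in>topspace (mtop M). \<bar>p x\<bar> \<le> P" by (auto simp: bounded_iff)
  then have pP: "1 \<le> p x \<and> p x \<le> P" if "x \<in> space ?\<mu>" for x using that p1[OF that] by (auto simp: sp abs_le_iff)
  obtain C0 where C0: "0 \<le> C0" "\<forall>w\<in>unit_sobolev M q. modular M p w \<le> ennreal C0" using pre(2) by (elim exE conjE)
  define C where "C = max 1 C0"
  have C: "1 \<le> C" by (simp add: C_def)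
  have CW: "modular M p w \<le> ennreal C" if "w \<in> unit_sobolev M q" for w
  proof -
    have "modular M p w \<le> ennreal C0" using C0(2) that by blast
    also have "\<dots> \<le> ennreal C" by (rule ennreal_leI) (simp add: C_def)
    finally show ?thesis .
  qed
  have um: "u \<in> borel_measurable ?\<mu>" if "u \<in> W1var M q" for u using that by (simp add: W1var_def Lvar_modular)
  have norm0: "0 \<le> W1var_norm M q u" if "u \<in> W1var M q" for u
    by (rule unit_sobolev_normalized(1)[OF qm _ that]) (rule q1)
  have normalized: "(\<lambda>x. u x / \<gamma>) \<in> unit_sobolev M q" if "u \<in> W1var M q" "W1var_norm M q u < \<gamma>" for u \<gamma>
    by (rule unit_sobolev_normalized(2)[OF qm _ that]) (rule q1)
  have rescale: "modular M p (\<lambda>x. \<kappa> * u x) \<le> ennreal (max 1 \<kappa> powr P) * modular M p u"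
    if "0 < \<kappa>" "u \<in> borel_measurable ?\<mu>" for \<kappa> u
  proof (rule modular_scale[OF pm that(2,1)])
    fix x assume x: "x \<in> space ?\<mu>"
    have "\<kappa> powr p x \<le> max 1 \<kappa> powr p x" using that pP[OF x] by (intro powr_mono2) auto
    also have "\<dots> \<le> max 1 \<kappa> powr P" using pP[OF x] by (intro powr_mono) auto
    finally show "\<kappa> powr p x \<le> max 1 \<kappa> powr P" .
  qed simp
  have sub: "W1var M q \<subseteq> Lvar M p"
  proof
    fix u assume u: "u \<in> W1var M q"
    define \<gamma> where "\<gamma> = W1var_norm M q u + 1"
    have g: "0 < \<gamma>" "W1var_norm M q u < \<gamma>" using norm0[OF u] by (auto simp: \<gamma>_def)
    have "(\<lambda>x. u x / \<gamma>) \<in> borel_measurable ?\<mu>" using um[OF u] by measurable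
    from rescale[OF g(1) this] have "modular M p u \<le> ennreal (max 1 \<gamma> powr P) * modular M p (\<lambda>x. u x / \<gamma>)"
      using g(1) by simp
    also have "\<dots> \<le> ennreal (max 1 \<gamma> powr P) * ennreal C" by (rule mult_left_mono[OF CW[OF normalized[OF u g(2)]]]) simp
    also have "\<dots> < \<infinity>" by (simp add: ennreal_mult_less_top)
    finally show "u \<in> Lvar M p" using um[OF u] by (simp add: Lvar_modular)
  qed
  have cont: "Lvar_norm M p u \<le> C * W1var_norm M q u" if u: "u \<in> W1var M q" for u
  proof (rule dense_ge)
    fix z assume z: "C * W1var_norm M q u < z"
    have g: "W1var_norm M q u < z / C" using z C by (simp add: field_simps)
    have z0: "0 < z / C" using norm0[OF u] g by linarith
    have "Lvar_norm M p u \<le> z / C * C"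
      by (rule Lvar_norm_le[OF pm _ um[OF u] z0 C CW[OF normalized[OF u g]]]) (rule p1)
    then show "Lvar_norm M p u \<le> z" using C by simp
  qed
  have comp: "\<exists>v\<in>Lvar M p. \<exists>s. strict_mono s \<and> (\<lambda>k. Lvar_norm M p (\<lambda>x. u (s k) x - v x)) \<longlonglongrightarrow> 0"
    if u: "\<forall>k::nat. u k \<in> W1var M q" and bd: "\<forall>k. W1var_norm M q (u k) \<le> Bd" for u Bd
  proof -
    define \<gamma> where "\<gamma> = Bd + 1"
    have u': "u k \<in> W1var M q" for k using u by blast
    have g: "W1var_norm M q (u k) < \<gamma>" for k using bd[rule_format, of k] by (simp add: \<gamma>_def)
    have g0: "0 < \<gamma>" using norm0[OF u'[of 0]] g[of 0] by simp
    define w where "w k x = u k x / \<gamma>" for k x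
    have wU: "\<forall>k. w k \<in> unit_sobolev M q" unfolding w_def[abs_def] using normalized[OF u' g] by blast
    have wm: "w k \<in> borel_measurable ?\<mu>" for k using wU by (simp add: unit_sobolev_def)
    have "\<exists>s::nat \<Rightarrow> nat. strict_mono s \<and> (\<forall>n. \<forall>i>n. \<forall>j>n. modular M p (\<lambda>x. w (s i) x - w (s j) x) \<le> ennreal (1 / real (Suc n)))"
      by (rule modular_Cauchy_subsequence[OF _ wU]) (rule pre(3))
    then obtain s :: "nat \<Rightarrow> nat" where s: "strict_mono s"
      "\<forall>n. \<forall>i>n. \<forall>j>n. modular M p (\<lambda>x. w (s i) x - w (s j) x) \<le> ennreal (1 / real (Suc n))"
      by (elim exE conjE)
    have wfin: "modular M p (w k) < \<infinity>" for k using CW[of "w k"] wU by (auto intro: le_less_trans)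
    obtain r v where r: "strict_mono r" and vm: "v \<in> borel_measurable ?\<mu>"
      and lim: "\<forall>n. \<forall>i>n. modular M p (\<lambda>x. w (s (r i)) x - v x) \<le> ennreal (1 / real (Suc n))"
      by (rule modular_complete[where w="\<lambda>i. w (s i)", OF pre(1) pm wm pP wfin s(2)])
    define t where "t i = s (r i)" for i
    have t: "strict_mono t" using s(1) r by (simp add: strict_mono_def t_def)
    have vfin: "modular M p v < \<infinity>"
    proof (rule modular_diff_finite[OF pm wm vm pP wfin])
      have "modular M p (\<lambda>x. w (t 1) x - v x) \<le> ennreal (1 / real (Suc 0))" using lim unfolding t_def by blast
      then show "modular M p (\<lambda>x. w (t 1) x - v x) < \<infinity>" by (rule le_less_trans) simp
    qed
    show ?thesis
    proof (intro bexI[of _ "\<lambda>x. \<gamma> * v x"] exI[of _ t] conjI t)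
      have "modular M p (\<lambda>x. \<gamma> * v x) < \<infinity>"
        by (rule le_less_trans[OF rescale[OF g0 vm]]) (use vfin in \<open>simp add: ennreal_mult_less_top\<close>)
      then show "(\<lambda>x. \<gamma> * v x) \<in> Lvar M p" using vm by (simp add: Lvar_modular)
      show "(\<lambda>k. Lvar_norm M p (\<lambda>x. u (t k) x - \<gamma> * v x)) \<longlonglongrightarrow> 0"
      proof (rule LIMSEQ_I)
        fix e :: real assume e: "0 < e"
        \<comment> \<open>passing from the modular of \<open>w - v\<close> to that of \<open>\<gamma> (w - v) / (e/2)\<close> costs the factor \<open>K\<close>\<close>
        define K where "K = max 1 (\<gamma> / (e / 2)) powr P"
        have K: "0 < K" by (simp add: K_def)
        obtain n where n: "1 / real (Suc n) < 1 / K" using reals_Archimedean[of "1 / K"] K by (auto simp: inverse_eq_divide)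
        show "\<exists>N. \<forall>k\<ge>N. norm (Lvar_norm M p (\<lambda>x. u (t k) x - \<gamma> * v x) - 0) < e"
        proof (intro exI[of _ "Suc n"] allI impI)
          fix k assume k: "Suc n \<le> k"
          let ?d = "\<lambda>x. w (t k) x - v x" and ?D = "\<lambda>x. u (t k) x - \<gamma> * v x"
          have dm: "?d \<in> borel_measurable ?\<mu>" and Dm: "?D \<in> borel_measurable ?\<mu>"
            using wm[of "t k"] vm um[OF u'[of "t k"]] by measurable
          have eq: "(\<lambda>x. ?D x / (e / 2)) = (\<lambda>x. \<gamma> / (e / 2) * ?d x)"
            using g0 e by (auto simp: fun_eq_iff w_def field_simps)
          have "modular M p (\<lambda>x. ?D x / (e / 2)) \<le> ennreal K * modular M p ?d"
            unfolding eq K_def using g0 e by (intro rescale dm) simp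
          also have "\<dots> \<le> ennreal K * ennreal (1 / K)"
          proof (rule mult_left_mono)
            have "modular M p ?d \<le> ennreal (1 / real (Suc n))" using lim k unfolding t_def by (simp only: Suc_le_eq)
            also have "\<dots> \<le> ennreal (1 / K)" using n by (intro ennreal_leI less_imp_le)
            finally show "modular M p ?d \<le> ennreal (1 / K)" .
          qed simp
          also have "\<dots> = 1" using K by (subst ennreal_mult'[symmetric]) auto
          finally have le1: "modular M p (\<lambda>x. ?D x / (e / 2)) \<le> 1" .
          have "Lvar_norm M p ?D \<le> e / 2 * 1" by (rule Lvar_norm_le[OF pm _ Dm]) (use e le1 p1 in auto)
          moreover have "0 \<le> Lvar_norm M p ?D"
            unfolding Lvar_norm_modular using e le1 by (intro cInf_greatest) (auto intro!: exI[of _ "e / 2"])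
          ultimately show "norm (Lvar_norm M p ?D - 0) < e" using e by simp
        qed
      qed
    qed
  qed
  show ?thesis
    unfolding continuously_embedded_def compactly_embedded_def
  proof (intro conjI sub allI impI)
    show "\<exists>C. \<forall>u\<in>W1var M q. Lvar_norm M p u \<le> C * W1var_norm M q u" using cont by blast
    fix u :: "nat \<Rightarrow> 'a \<Rightarrow> real"
    assume "(\<forall>k. u k \<in> W1var M q) \<and> (\<exists>B. \<forall>k. W1var_norm M q (u k) \<le> B)"
    then show "\<exists>v\<in>Lvar M p. \<exists>s. strict_mono s \<and> (\<lambda>k. Lvar_norm M p (\<lambda>x. u (s k) x - v x)) \<longlonglongrightarrow> 0"
      by (elim conjE exE) (rule comp)
  qed
qed

end
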